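(* Fix $L\ge 0$ and a set $\tilde\Omega$ with $\Omega^L\subseteq\tilde\Omega\subseteq C([0,T],H)$. Let $u$ be a minimax $L$-subsolution and let $v$ be a minimax $L$-supersolution of (TVP) on $[0,T]\times\tilde\Omega$. Then $u\le v$ on $[0,T]\times\tilde\Omega$.
   Context: Spaces. Let $T>0$. $H$ is a real Hilbert space with inner product $(\cdot,\cdot)$ and norm $|\cdot|$; $V$ is a separable reflexive Banach space with norm $\|\cdot\|$, continuously, densely and compactly embedded into $H$; $V^\ast$ is its dual with norm $\|\cdot\|_\ast$ and duality pairing $\langle x^\ast,x\rangle=x^\ast(x)$. With the usual identifications, $V\subseteq H\subseteq V^\ast$ and $\langle x,y\rangle=(x,y)$ for $x\in H$, $y\in V$. Fix $p\ge 2$, $q>1$ with $1/p+1/q=1$. For $t_0\in[0,T)$, $W_{pq}(t_0,T)$ is the space of all $\mathbf{x}\in L^p(t_0,T;V)$ possessing a generalized derivative $\mathbf{x}'\in L^q(t_0,T;V^\ast)$. Operator. $A:[0,T]\times V\to V^\ast$ is fixed and satisfies: (i) $t\mapsto\langle A(t,x),v\rangle$ is measurable for all $x,v\in V$; (ii) for a.e. $t$ and all $x,y\in V$, $\langle A(t,x)-A(t,y),x-y\rangle\ge 0$; (iii) for a.e. $t$ and all $x,y,v\in V$, $s\mapsto\langle A(t,x+sy),v\rangle$ is continuous on $[0,1]$; (iv) there are $a_1\in L^q(0,T)$, $c_1\ge0$ with $\|A(t,x)\|_\ast\le a_1(t)+c_1\|x\|^{p-1}$ for all $x\in V$ and a.e.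 $t$; (v) there is $c_2>0$ with $\langle A(t,x),x\rangle\ge c_2\|x\|^p$ for all $x\in V$ and a.e. $t$. Paths and continuity. $C([0,T],H)$ carries the sup norm. On $[0,T]\times C([0,T],H)$ and its subsets use the pseudo-metric $\mathbf{d}_\infty((t,x),(s,y))=|t-s|+\sup_{r\in[0,T]}|x(r\wedge t)-y(r\wedge s)|$; (semi-)continuity in $(t,x)$ is meant with respect to $\mathbf{d}_\infty$ (so such functions are non-anticipating, i.e. their value at time $t$ depends only on the path up to time $t$). USC and LSC denote real-valued upper and lower semicontinuous functions. Trajectories. For $L\ge 0$ and $(t_0,x_0)\in[0,T)\times C([0,T],H)$, $\mathcal{X}^L(t_0,x_0)$ is the set of all $x\in C([0,T],H)$ with $x=x_0$ on $[0,t_0]$ for which there exist $\mathbf{x}\in W_{pq}(t_0,T)$ and $f^x\in L^2(t_0,T;H)$ with $x=\mathbf{x}$ a.e. on $(t_0,T)$, $\mathbf{x}'(t)+A(t,\mathbf{x}(t))=f^x(t)$ a.e. on $(t_0,T)$, and $|f^x(t)|\le L(1+\sup_{0\le s\le t}|x(s)|)$ a.e. on $(t_0,T)$ ($\mathbf{x}$, $f^x$ are uniquely determined by $x$). Fix $x_\ast\in H$, regarded as a constant path, and put $\Omega^L:=\mathcal{X}^L(0,x_\ast)$. Data. $h:C([0,T],H)\to\mathbb{R}$ is continuous. $F:[0,T]\times C([0,T],H)\times H\to\mathbb{R}$ satisfies: (i) $F$ is continuous; (ii) there is $L_0\ge0$ with $|F(t,x,z)-F(t,x,\tilde z)|\le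 L_0(1+\sup_{0\le s\le t}|x(s)|)|z-\tilde z|$ for all $t,x,z,\tilde z$; (iii) for every $L\ge0$ and $(t_0,x_0)\in[0,T)\times C([0,T],H)$ there is a modulus of continuity $m_{L,t_0,x_0}$ such that for all $\varepsilon>0$, $t\in[t_0,T]$, $x,y\in\mathcal{X}^L(t_0,x_0)$: $F(t,x,\varepsilon^{-1}[x(t)-y(t)])-F(t,y,\varepsilon^{-1}[x(t)-y(t)])\le m_{L,t_0,x_0}(\varepsilon^{-1}|x(t)-y(t)|^2+\sup_{s\le t}|x(s)-y(s)|)$. (TVP) denotes the terminal-value problem $\partial_tu-\langle A(t,x(t)),\partial_xu\rangle+F(t,x,\partial_xu)=0$ on $[0,T)\times C([0,T],H)$, $u(T,x)=h(x)$. Minimax semisolutions. $u:[0,T]\times\tilde\Omega\to\mathbb{R}$ is a minimax $L$-subsolution (resp. $L$-supersolution) of (TVP) on $[0,T]\times\tilde\Omega$ if $u\in\mathrm{USC}([0,T]\times\tilde\Omega)$ (resp. $\mathrm{LSC}$), $u(T,\cdot)\le h$ (resp. $\ge h$) on $\tilde\Omega$, and for every $(t_0,x_0,z)\in[0,T)\times\tilde\Omega\times H$ there is $x\in\mathcal{X}^L(t_0,x_0)\cap\tilde\Omega$ such that for every $t\in[t_0,T]$: $u(t_0,x_0)\le$ (resp. $\ge$) $\int_{t_0}^t[(-f^x(s),z)+F(s,x,z)]\,ds+u(t,x)$. *)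

theory Defs
  imports "HOL-Analysis.Analysis"
begin

text \<open>The Borel-measurability notion of the library needs second countability as a type class,
  which is not available for \<open>'v \<Rightarrow>\<^sub>L real\<close>; hence strong measurability is defined here.\<close>

definition strongly_measurable :: "'a measure \<Rightarrow> ('a \<Rightarrow> 'b::real_normed_vector) \<Rightarrow> bool" where
  "strongly_measurable M f \<longleftrightarrow>
     (\<exists>s. (\<forall>n::nat. simple_function M (s n)) \<and> (AE x in M. (\<lambda>n. s n x) \<longlonglongrightarrow> f x))"

definition bochner_Lp :: "real \<Rightarrow> real \<Rightarrow> real \<Rightarrow> (real \<Rightarrow> 'b::real_normed_vector) \<Rightarrow> bool" where
  "bochner_Lp r a b f \<longleftrightarrow>
     strongly_measurable (lebesgue_on {a<..<b}) f \<and>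
     integrable (lebesgue_on {a<..<b}) (\<lambda>t. norm (f t) powr r)"

definition test_fun :: "real \<Rightarrow> real \<Rightarrow> (real \<Rightarrow> real) \<Rightarrow> bool" where
  "test_fun a b \<phi> \<longleftrightarrow>
     (\<forall>n::nat. (deriv ^^ n) \<phi> differentiable_on UNIV) \<and>
     (\<exists>c d. a < c \<and> c \<le> d \<and> d < b \<and> (\<forall>t. t \<notin> {c..d} \<longrightarrow> \<phi> t = 0))"

text \<open>The embedding of \<open>V\<close> into \<open>H\<close> is an explicit bounded linear map \<open>j\<close>; the dual of \<open>V\<close> with its
  operator norm is the type \<open>'v \<Rightarrow>\<^sub>L real\<close>.  An element \<open>h\<close> of \<open>H\<close> is identified with the functional
  \<open>v \<mapsto> (h, j v)\<close>.\<close>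

definition dual_embed ::
    "('v::real_normed_vector \<Rightarrow>\<^sub>L 'h::real_inner) \<Rightarrow> 'h \<Rightarrow> ('v \<Rightarrow>\<^sub>L real)" where
  "dual_embed j h = blinfun_inner_left h o\<^sub>L j"

text \<open>The identity \<open>\<integral> \<phi>' x = - \<integral> \<phi> w\<close> between Bochner integrals in the dual of \<open>V\<close>,
  evaluated at every \<open>v \<in> V\<close>.\<close>

definition gen_deriv ::
    "('v::real_normed_vector \<Rightarrow>\<^sub>L 'h::real_inner) \<Rightarrow> real \<Rightarrow> real \<Rightarrow>
     (real \<Rightarrow> 'v) \<Rightarrow> (real \<Rightarrow> 'v \<Rightarrow>\<^sub>L real) \<Rightarrow> bool" where
  "gen_deriv j a b x w \<longleftrightarrow>
     (\<forall>\<phi> v. test_fun a b \<phi> \<longrightarrow>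
        (LINT t|lebesgue_on {a<..<b}. deriv \<phi> t * blinfun_apply (dual_embed j (j (x t))) v) =
        - (LINT t|lebesgue_on {a<..<b}. \<phi> t * blinfun_apply (w t) v))"

text \<open>\<open>x\<close> belongs to \<open>W\<^sub>p\<^sub>q(a, b)\<close> and has generalized derivative \<open>w\<close>.\<close>

definition Wpq_deriv ::
    "('v::real_normed_vector \<Rightarrow>\<^sub>L 'h::real_inner) \<Rightarrow> real \<Rightarrow> real \<Rightarrow> real \<Rightarrow> real \<Rightarrow>
     (real \<Rightarrow> 'v) \<Rightarrow> (real \<Rightarrow> 'v \<Rightarrow>\<^sub>L real) \<Rightarrow> bool" where
  "Wpq_deriv j p q a b x w \<longleftrightarrow> bochner_Lp p a b x \<and> bochner_Lp q a b w \<and> gen_deriv j a b x w"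

definition reflexive_space :: "'v::real_normed_vector itself \<Rightarrow> bool" where
  "reflexive_space _ \<longleftrightarrow>
     (\<forall>\<Psi> :: ('v \<Rightarrow>\<^sub>L real) \<Rightarrow>\<^sub>L real. \<exists>v. \<forall>\<xi>. blinfun_apply \<Psi> \<xi> = blinfun_apply \<xi> v)"

text \<open>Continuity of the embedding is part of the type of \<open>j\<close>.\<close>

definition evolution_triple :: "('v::banach \<Rightarrow>\<^sub>L 'h::{real_inner, complete_space}) \<Rightarrow> bool" where
  "evolution_triple j \<longleftrightarrow>
     separable_space (euclidean :: 'v topology) \<and> reflexive_space TYPE('v) \<and>
     inj (blinfun_apply j) \<and> closure (range (blinfun_apply j)) = UNIV \<and>
     (\<forall>B. bounded B \<longrightarrow> compact (closure (blinfun_apply j ` B)))"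

definition admissible_operator ::
    "real \<Rightarrow> real \<Rightarrow> real \<Rightarrow> (real \<Rightarrow> 'v::real_normed_vector \<Rightarrow> ('v \<Rightarrow>\<^sub>L real)) \<Rightarrow> bool" where
  "admissible_operator T p q A \<longleftrightarrow>
     (\<forall>x v. (\<lambda>t. blinfun_apply (A t x) v) \<in> borel_measurable (lebesgue_on {0..T})) \<and>
     (AE t in lebesgue_on {0..T}. \<forall>x y. blinfun_apply (A t x - A t y) (x - y) \<ge> 0) \<and>
     (AE t in lebesgue_on {0..T}. \<forall>x y v.
        continuous_on {0..1} (\<lambda>s. blinfun_apply (A t (x + s *\<^sub>R y)) v)) \<and>
     (\<exists>(a1 :: real \<Rightarrow> real) c1. bochner_Lp q 0 T a1 \<and> c1 \<ge> 0 \<and>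
        (AE t in lebesgue_on {0..T}. \<forall>x. norm (A t x) \<le> a1 t + c1 * norm x powr (p - 1))) \<and>
     (\<exists>c2 > 0. AE t in lebesgue_on {0..T}. \<forall>x. blinfun_apply (A t x) x \<ge> c2 * norm x powr p)"

text \<open>Paths are extensional (fixed outside \<open>[0,T]\<close>), so that elements of \<open>paths T\<close> correspond
  one-to-one to continuous functions on \<open>[0,T]\<close>.\<close>

definition paths :: "real \<Rightarrow> (real \<Rightarrow> 'h::real_normed_vector) set" where
  "paths T = {x \<in> extensional {0..T}. continuous_on {0..T} x}"

definition const_path :: "real \<Rightarrow> 'h \<Rightarrow> real \<Rightarrow> 'h" where
  "const_path T a = restrict (\<lambda>_. a) {0..T}"

definition dist_sup ::
    "real \<Rightarrow> (real \<Rightarrow> 'h::real_normed_vector) \<Rightarrow> (real \<Rightarrow> 'h) \<Rightarrow> real" where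
  "dist_sup T x y = (SUP r\<in>{0..T}. norm (x r - y r))"

definition d_infty ::
    "real \<Rightarrow> real \<times> (real \<Rightarrow> 'h::real_normed_vector) \<Rightarrow> real \<times> (real \<Rightarrow> 'h) \<Rightarrow> real" where
  "d_infty T = (\<lambda>(t, x) (s, y).
     \<bar>t - s\<bar> + (SUP r\<in>{0..T}. norm (x (min r t) - y (min r s))))"

definition usc_on ::
    "real \<Rightarrow> (real \<Rightarrow> 'h::real_normed_vector) set \<Rightarrow> (real \<Rightarrow> (real \<Rightarrow> 'h) \<Rightarrow> real) \<Rightarrow> bool" where
  "usc_on T \<Omega> u \<longleftrightarrow>
     (\<forall>t\<in>{0..T}. \<forall>x\<in>\<Omega>. \<forall>e>0. \<exists>d>0. \<forall>s\<in>{0..T}. \<forall>y\<in>\<Omega>.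
        d_infty T (t, x) (s, y) < d \<longrightarrow> u s y < u t x + e)"

definition lsc_on ::
    "real \<Rightarrow> (real \<Rightarrow> 'h::real_normed_vector) set \<Rightarrow> (real \<Rightarrow> (real \<Rightarrow> 'h) \<Rightarrow> real) \<Rightarrow> bool" where
  "lsc_on T \<Omega> u \<longleftrightarrow>
     (\<forall>t\<in>{0..T}. \<forall>x\<in>\<Omega>. \<forall>e>0. \<exists>d>0. \<forall>s\<in>{0..T}. \<forall>y\<in>\<Omega>.
        d_infty T (t, x) (s, y) < d \<longrightarrow> u s y > u t x - e)"

text \<open>\<open>is_trajectory j A T p q L t0 x0 x f\<close>: \<open>x\<close> is an admissible trajectory starting from
  \<open>(t0, x0)\<close>, and \<open>f\<close> is its forcing term \<open>f\<^sup>x\<close>, which \<open>x\<close> determines up to null sets.\<close>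

definition is_trajectory ::
    "('v::banach \<Rightarrow>\<^sub>L 'h::{real_inner, complete_space}) \<Rightarrow> (real \<Rightarrow> 'v \<Rightarrow> ('v \<Rightarrow>\<^sub>L real)) \<Rightarrow>
     real \<Rightarrow> real \<Rightarrow> real \<Rightarrow> real \<Rightarrow> real \<Rightarrow> (real \<Rightarrow> 'h) \<Rightarrow> (real \<Rightarrow> 'h) \<Rightarrow> (real \<Rightarrow> 'h) \<Rightarrow> bool" where
  "is_trajectory j A T p q L t0 x0 x f \<longleftrightarrow>
     x \<in> paths T \<and> (\<forall>t\<in>{0..t0}. x t = x0 t) \<and> bochner_Lp 2 t0 T f \<and>
     (\<exists>\<xi> w. Wpq_deriv j p q t0 T \<xi> w \<and>
        (AE t in lebesgue_on {t0<..<T}. x t = j (\<xi> t)) \<and>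
        (AE t in lebesgue_on {t0<..<T}. w t + A t (\<xi> t) = dual_embed j (f t))) \<and>
     (AE t in lebesgue_on {t0<..<T}. norm (f t) \<le> L * (1 + (SUP s\<in>{0..t}. norm (x s))))"

definition trajectories ::
    "('v::banach \<Rightarrow>\<^sub>L 'h::{real_inner, complete_space}) \<Rightarrow> (real \<Rightarrow> 'v \<Rightarrow> ('v \<Rightarrow>\<^sub>L real)) \<Rightarrow>
     real \<Rightarrow> real \<Rightarrow> real \<Rightarrow> real \<Rightarrow> real \<Rightarrow> (real \<Rightarrow> 'h) \<Rightarrow> (real \<Rightarrow> 'h) set" where
  "trajectories j A T p q L t0 x0 = {x. \<exists>f. is_trajectory j A T p q L t0 x0 x f}"

definition terminal_continuous ::
    "real \<Rightarrow> ((real \<Rightarrow> 'h::real_normed_vector) \<Rightarrow> real) \<Rightarrow> bool" where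
  "terminal_continuous T h \<longleftrightarrow>
     (\<forall>x\<in>paths T. \<forall>e>0. \<exists>d>0. \<forall>y\<in>paths T. dist_sup T x y < d \<longrightarrow> \<bar>h x - h y\<bar> < e)"

definition hamiltonian_continuous ::
    "real \<Rightarrow> (real \<Rightarrow> (real \<Rightarrow> 'h::real_normed_vector) \<Rightarrow> 'h \<Rightarrow> real) \<Rightarrow> bool" where
  "hamiltonian_continuous T F \<longleftrightarrow>
     (\<forall>t\<in>{0..T}. \<forall>x\<in>paths T. \<forall>z. \<forall>e>0. \<exists>d>0. \<forall>s\<in>{0..T}. \<forall>y\<in>paths T. \<forall>z'.
        d_infty T (t, x) (s, y) < d \<and> norm (z - z') < d \<longrightarrow> \<bar>F t x z - F s y z'\<bar> < e)"

definition modulus_of_continuity :: "(real \<Rightarrow> real) \<Rightarrow> bool" where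
  "modulus_of_continuity m \<longleftrightarrow> m 0 = 0 \<and> mono_on {0..} m \<and> (m \<longlongrightarrow> 0) (at_right 0)"

definition admissible_hamiltonian ::
    "('v::banach \<Rightarrow>\<^sub>L 'h::{real_inner, complete_space}) \<Rightarrow> (real \<Rightarrow> 'v \<Rightarrow> ('v \<Rightarrow>\<^sub>L real)) \<Rightarrow>
     real \<Rightarrow> real \<Rightarrow> real \<Rightarrow> (real \<Rightarrow> (real \<Rightarrow> 'h) \<Rightarrow> 'h \<Rightarrow> real) \<Rightarrow> bool" where
  "admissible_hamiltonian j A T p q F \<longleftrightarrow>
     hamiltonian_continuous T F \<and>
     (\<exists>L0\<ge>0. \<forall>t\<in>{0..T}. \<forall>x\<in>paths T. \<forall>z z'.
        \<bar>F t x z - F t x z'\<bar> \<le> L0 * (1 + (SUP s\<in>{0..t}. norm (x s))) * norm (z - z')) \<and>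
     (\<forall>L\<ge>0. \<forall>t0\<in>{0..<T}. \<forall>x0\<in>paths T. \<exists>m. modulus_of_continuity m \<and>
        (\<forall>\<epsilon>>0. \<forall>t\<in>{t0..T}.
          \<forall>x\<in>trajectories j A T p q L t0 x0. \<forall>y\<in>trajectories j A T p q L t0 x0.
            F t x ((1 / \<epsilon>) *\<^sub>R (x t - y t)) - F t y ((1 / \<epsilon>) *\<^sub>R (x t - y t))
              \<le> m ((1 / \<epsilon>) * (norm (x t - y t))\<^sup>2 + (SUP s\<in>{0..t}. norm (x s - y s)))))"

text \<open>Since \<open>f\<^sup>x\<close> is unique up to null sets, the integrals below do not depend on the chosen \<open>f\<close>.\<close>

definition minimax_subsolution ::
    "('v::banach \<Rightarrow>\<^sub>L 'h::{real_inner, complete_space}) \<Rightarrow> (real \<Rightarrow> 'v \<Rightarrow> ('v \<Rightarrow>\<^sub>L real)) \<Rightarrow>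
     real \<Rightarrow> real \<Rightarrow> real \<Rightarrow> (real \<Rightarrow> (real \<Rightarrow> 'h) \<Rightarrow> 'h \<Rightarrow> real) \<Rightarrow> ((real \<Rightarrow> 'h) \<Rightarrow> real) \<Rightarrow>
     real \<Rightarrow> (real \<Rightarrow> 'h) set \<Rightarrow> (real \<Rightarrow> (real \<Rightarrow> 'h) \<Rightarrow> real) \<Rightarrow> bool" where
  "minimax_subsolution j A T p q F h L \<Omega> u \<longleftrightarrow>
     usc_on T \<Omega> u \<and> (\<forall>x\<in>\<Omega>. u T x \<le> h x) \<and>
     (\<forall>t0\<in>{0..<T}. \<forall>x0\<in>\<Omega>. \<forall>z.
        \<exists>x\<in>\<Omega>. \<exists>f. is_trajectory j A T p q L t0 x0 x f \<and>
          (\<forall>t\<in>{t0..T}. u t0 x0 \<le>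
             (LINT s|lebesgue_on {t0..t}. - (f s \<bullet> z) + F s x z) + u t x))"

definition minimax_supersolution ::
    "('v::banach \<Rightarrow>\<^sub>L 'h::{real_inner, complete_space}) \<Rightarrow> (real \<Rightarrow> 'v \<Rightarrow> ('v \<Rightarrow>\<^sub>L real)) \<Rightarrow>
     real \<Rightarrow> real \<Rightarrow> real \<Rightarrow> (real \<Rightarrow> (real \<Rightarrow> 'h) \<Rightarrow> 'h \<Rightarrow> real) \<Rightarrow> ((real \<Rightarrow> 'h) \<Rightarrow> real) \<Rightarrow>
     real \<Rightarrow> (real \<Rightarrow> 'h) set \<Rightarrow> (real \<Rightarrow> (real \<Rightarrow> 'h) \<Rightarrow> real) \<Rightarrow> bool" where
  "minimax_supersolution j A T p q F h L \<Omega> u \<longleftrightarrow>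
     lsc_on T \<Omega> u \<and> (\<forall>x\<in>\<Omega>. u T x \<ge> h x) \<and>
     (\<forall>t0\<in>{0..<T}. \<forall>x0\<in>\<Omega>. \<forall>z.
        \<exists>x\<in>\<Omega>. \<exists>f. is_trajectory j A T p q L t0 x0 x f \<and>
          (\<forall>t\<in>{t0..T}. u t0 x0 \<ge>
             (LINT s|lebesgue_on {t0..t}. - (f s \<bullet> z) + F s x z) + u t x))"

end

theory Submission
  imports Defs "HOL-Complex_Analysis.Great_Picard"
begin

text \<open>
  The proof doubles the variables: \<open>u\<close> is followed along one trajectory \<open>x\<close>, \<open>v\<close> along another
  trajectory \<open>y\<close>, both issuing from \<open>(t0, x0)\<close>, and their distance is penalised by
  \<open>|x(t) - y(t)|\<^sup>2 / (2 \<epsilon>)\<close>.  If \<open>f\<close> and \<open>g\<close> are the forcing terms of \<open>x\<close> and \<open>y\<close>, then monotonicity of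
  \<open>A\<close> shows that the penalty grows at most at the rate \<open>(f - g, z)\<close> with \<open>z = (x - y) / \<epsilon>\<close>.  The minimax
  inequalities with this \<open>z\<close> contain the same term with the opposite sign.  What is left of the evolution
  of \<open>u(t,x) - v(t,y) - |x(t) - y(t)|\<^sup>2 / (2 \<epsilon>)\<close> is the difference \<open>F(t,x,z) - F(t,y,z)\<close>, and this is bounded
  by \<open>m(|x(t) - y(t)|\<^sup>2 / \<epsilon> + sup |x - y|)\<close>.  In the minimax inequalities \<open>z\<close> does not depend on
  time, so it is frozen on the steps of a time grid; the trajectories are equicontinuous, hence a fine
  grid makes the error small (\<open>Euler_step\<close>, \<open>Euler_scheme\<close>).

  The modulus \<open>m\<close> controls the error only while the penalty is small, and along an arbitrary pair it may
  become large.  Therefore the scheme starts at a nearly maximal pair.  Suppose that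
  \<open>\<kappa> = u(t0,x0) - v(t0,x0)\<close> is positive, put \<open>c = \<kappa> / (2 T)\<close>, and let \<open>M\<close> be the limit, as \<open>\<sigma>\<close> decreases to \<open>0\<close>,
  of the suprema of \<open>u(t,x) - v(t,y) + c t\<close> over all times \<open>t\<close> and all pairs of trajectories with
  \<open>|x - y| \<le> \<sigma>\<close> on \<open>[0,t]\<close>.  As long as the penalty stays below a fixed small \<open>\<delta>\<close>, the two paths stay close
  when \<open>\<epsilon>\<close> is small, so that this value cannot exceed \<open>M\<close> by much; but along the scheme it increases at
  least by the growth of the penalty.  Hence the penalty never reaches \<open>\<delta>\<close>, the scheme runs until time \<open>T\<close>, and there the
  terminal conditions give \<open>M \<le> c T\<close>.  This contradicts \<open>M \<ge> \<kappa> + c t0\<close> (\<open>comparison_at\<close>).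

  Compactness of the set of trajectories in the uniform norm (\<open>trajectories_seq_compact\<close>) yields the
  equicontinuity, the bounds on \<open>u - v\<close>, and the uniform continuity of \<open>h\<close> near trajectories.  A limit of
  trajectories is only used as a path, it is never claimed to solve the evolution equation.  The
  compactness rests on three facts: tested with a fixed vector, trajectories are equicontinuous;
  an inequality of Ehrling type turns convergence of such tests into convergence in the mean; and the
  energy inequality for differences turns convergence in the mean into uniform convergence.

  Two facts about the spaces \<open>W\<^sub>p\<^sub>q\<close> carry everything.  The first is the energy inequality
  \<open>|x(t)|\<^sup>2 - |x(s)|\<^sup>2 \<le> 2 \<integral> \<langle>w, \<xi>\<rangle>\<close> for \<open>x = j \<xi>\<close> with generalized derivative \<open>w\<close> (\<open>energy_inequality\<close>).  It is
  obtained from scalar integrals only, by Lebesgue's differentiation theorem and Fatou's lemma.  The second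
  is the description of generalized derivatives by increments (\<open>gen_deriv_iff_increments\<close>), through which
  trajectories can be concatenated, so that restarting a trajectory never leaves the set of trajectories
  from \<open>(t0, x0)\<close>.
\<close>

section \<open>Smooth step functions\<close>

text \<open>For \<open>a = 0\<close> this is the classical smooth function \<open>exp
  (-1/x)\<close>; with the powers of \<open>1/x\<close> the family is closed under differentiation
  up to linear combinations.\<close>

definition flat :: "nat \<Rightarrow> real \<Rightarrow> real" where
  "flat a x = (if x \<le> 0 then 0 else exp (- (1 / x)) / x ^ a)"

lemma flat_tendsto_0: "(flat a \<longlongrightarrow> 0) (at 0)"
proof -
  have "((\<lambda>x. flat a x) \<longlongrightarrow> 0) (at_left 0)"
    by (rule Lim_transform_eventually[where f="\<lambda>_. 0"])
      (auto simp: flat_def eventually_at_filter)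
  moreover have "((\<lambda>x. flat a x) \<longlongrightarrow> 0) (at_right 0)"
  proof (rule Lim_transform_eventually)
    have "((\<lambda>y. y ^ a / exp y) \<longlongrightarrow> (0::real)) at_top"
      by (rule tendsto_power_div_exp_0)
    then show "((\<lambda>x. inverse x ^ a / exp (inverse x)) \<longlongrightarrow> (0::real)) (at_right 0)"
      by (rule filterlim_compose[OF _ filterlim_inverse_at_top_right])
    show "\<forall>\<^sub>F x in at_right 0. inverse x ^ a / exp (inverse x) = flat a x"
      unfolding eventually_at_filter
      by (rule always_eventually) (auto simp: flat_def exp_minus divide_inverse power_inverse)
  qed
  ultimately show ?thesis
    by (simp add: filterlim_split_at)
qed

lemma flat_has_derivative:
  "(flat a has_real_derivative (flat (a + 2) x - a * flat (a + 1) x)) (at x)"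
proof -
  consider "x < 0" | "x = 0" | "x > 0" by linarith
  then show ?thesis
  proof cases
    case 1
    have "((\<lambda>x. 0) has_real_derivative 0) (at x)" by simp
    then have "(flat a has_real_derivative 0) (at x)"
      by (rule has_field_derivative_transform_within_open[of _ _ _ "{..<0}"])
        (use 1 in \<open>auto simp: flat_def\<close>)
    then show ?thesis using 1 by (simp add: flat_def)
  next
    case 2
    have "((\<lambda>h. (flat a (0 + h) - flat a 0) / h) \<longlongrightarrow> 0) (at 0)"
      by (rule Lim_transform_eventually[OF flat_tendsto_0[of "a+1"]])
        (auto simp: eventually_at_filter flat_def)
    then show ?thesis using 2 by (simp add: DERIV_def flat_def)
  next
    case 3
    have "((\<lambda>x. exp (- inverse x) * inverse x ^ a) has_real_derivative
        exp (- inverse x) * inverse (x ^ 2) * inverse x ^ a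
          + a * inverse x ^ (a - 1) * (- inverse (x ^ 2)) * exp (- inverse x)) (at x)"
      using 3 by (auto intro!: derivative_eq_intros simp: power2_eq_square)
    moreover have "exp (- inverse x) * inverse (x ^ 2) * inverse x ^ a
        + a * inverse x ^ (a - 1) * (- inverse (x ^ 2)) * exp (- inverse x)
        = flat (a + 2) x - a * flat (a + 1) x"
      using 3 by (cases a) (simp_all add: flat_def power2_eq_square divide_inverse mult_ac power_inverse)
    ultimately have "((\<lambda>x. exp (- inverse x) * inverse x ^ a) has_real_derivative
        flat (a + 2) x - a * flat (a + 1) x) (at x)" by metis
    then show ?thesis
      by (rule has_field_derivative_transform_within_open[of _ _ _ "{0<..}"])
        (use 3 in \<open>auto simp: flat_def divide_inverse power_inverse\<close>)
  qed
qed

text \<open>A class of functions that contains the derivatives of its members, so that all members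
  are infinitely differentiable. Closure under antiderivatives produces smooth steps from
  bumps.\<close>

inductive smooth_fun :: "(real \<Rightarrow> real) \<Rightarrow> bool" where
  flat: "smooth_fun (flat a)"
| const: "smooth_fun (\<lambda>_. c)"
| add: "smooth_fun f \<Longrightarrow> smooth_fun g \<Longrightarrow> smooth_fun (\<lambda>x. f x + g x)"
| mult: "smooth_fun f \<Longrightarrow> smooth_fun g \<Longrightarrow> smooth_fun (\<lambda>x. f x * g x)"
| affine: "smooth_fun f \<Longrightarrow> smooth_fun (\<lambda>x. f (\<alpha> * x + \<beta>))"
| antiderivative: "smooth_fun f \<Longrightarrow> (\<And>x. (g has_real_derivative f x) (at x)) \<Longrightarrow> smooth_fun g"

lemma smooth_fun_has_derivative:
  "smooth_fun f \<Longrightarrow> \<exists>g. smooth_fun g \<and> (\<forall>x. (f has_real_derivative g x) (at x))"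
proof (induction rule: smooth_fun.induct)
  case (flat a)
  have "smooth_fun (\<lambda>x. flat (a + 2) x + (- real a) * flat (a + 1) x)"
    by (rule smooth_fun.add[OF smooth_fun.flat smooth_fun.mult[OF smooth_fun.const smooth_fun.flat]])
  moreover have "(flat a has_real_derivative (flat (a + 2) x + (- real a) * flat (a + 1) x)) (at x)" for x
    using flat_has_derivative[of a x] by simp
  ultimately show ?case by blast
next
  case (const c)
  show ?case by (rule exI[of _ "\<lambda>_. 0"]) (auto intro: smooth_fun.const)
next
  case (add f g)
  then obtain f' g' where *: "smooth_fun f'" "smooth_fun g'"
    "\<And>x. (f has_real_derivative f' x) (at x)" "\<And>x. (g has_real_derivative g' x) (at x)" by blast
  show ?case
    by (rule exI[of _ "\<lambda>x. f' x + g' x"]) (auto intro!: smooth_fun.add * DERIV_add)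
next
  case (mult f g)
  then obtain f' g' where *: "smooth_fun f'" "smooth_fun g'"
    "\<And>x. (f has_real_derivative f' x) (at x)" "\<And>x. (g has_real_derivative g' x) (at x)" by blast
  show ?case
    by (rule exI[of _ "\<lambda>x. f' x * g x + g' x * f x"])
      (auto intro!: smooth_fun.add smooth_fun.mult * DERIV_mult mult.hyps)
next
  case (affine f \<alpha> \<beta>)
  then obtain f' where *: "smooth_fun f'" "\<And>x. (f has_real_derivative f' x) (at x)" by blast
  have "((\<lambda>x. f (\<alpha> * x + \<beta>)) has_real_derivative (f' (\<alpha> * x + \<beta>) * \<alpha>)) (at x)" for x
    by (rule DERIV_chain2[OF *(2)]) (auto intro!: derivative_eq_intros)
  moreover have "smooth_fun (\<lambda>x. f' (\<alpha> * x + \<beta>) * \<alpha>)"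
    by (rule smooth_fun.mult[OF smooth_fun.affine[OF *(1)] smooth_fun.const])
  ultimately show ?case
    by (intro exI[of _ "\<lambda>x. f' (\<alpha> * x + \<beta>) * \<alpha>"]) simp
next
  case (antiderivative f g)
  then show ?case by blast
qed

lemma smooth_fun_higher_deriv: "smooth_fun f \<Longrightarrow> smooth_fun ((deriv ^^ n) f)"
proof (induction n)
  case (Suc n)
  then obtain g where g: "smooth_fun g" "\<And>x. ((deriv ^^ n) f has_real_derivative g x) (at x)"
    using smooth_fun_has_derivative by blast
  then have "deriv ((deriv ^^ n) f) = g" by (intro ext DERIV_imp_deriv) auto
  with g show ?case by simp
qed simp

lemma smooth_fun_test_fun:
  assumes "smooth_fun \<phi>" "a < c" "c \<le> d" "d < b" "\<And>t. t \<notin> {c..d} \<Longrightarrow> \<phi> t = 0"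
  shows "test_fun a b \<phi>"
proof -
  have "(deriv ^^ n) \<phi> differentiable_on UNIV" for n
    using smooth_fun_has_derivative[OF smooth_fun_higher_deriv[OF assms(1)]]
    by (auto simp: differentiable_on_def real_differentiable_def)
  then show ?thesis using assms unfolding test_fun_def by blast
qed

text \<open>Integrate the bump \<open>flat 0 x * flat 0 (1 - x)\<close>, which is positive exactly
  on \<open>(0,1)\<close>, and normalize.\<close>

lemma smooth_step_exists:
  obtains \<Theta> \<theta> where "smooth_fun \<Theta>" "smooth_fun \<theta>" "\<And>x. (\<Theta> has_real_derivative \<theta> x) (at x)"
    "\<And>x. x \<le> 0 \<Longrightarrow> \<Theta> x = 0" "\<And>x. x \<ge> 1 \<Longrightarrow> \<Theta> x = 1" "\<And>x. 0 \<le> \<theta> x"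
    "\<And>x. 0 \<le> \<Theta> x" "\<And>x. \<Theta> x \<le> 1" "\<And>x. x \<notin> {0..1} \<Longrightarrow> \<theta> x = 0"
proof -
  define b where "b = (\<lambda>x. flat 0 x * flat 0 ((-1) * x + 1))"
  have b: "smooth_fun b" unfolding b_def
    by (rule smooth_fun.mult[OF smooth_fun.flat smooth_fun.affine[OF smooth_fun.flat]])
  have b0: "b x \<ge> 0" for x by (auto simp: b_def flat_def)
  have b1: "b x > 0" if "0 < x" "x < 1" for x using that by (auto simp: b_def flat_def)
  have b2: "b x = 0" if "x \<le> 0 \<or> x \<ge> 1" for x using that by (auto simp: b_def flat_def)
  have cont: "isCont b x" for x
    using smooth_fun_has_derivative[OF b] DERIV_isCont by blast
  obtain B where B: "\<And>x. (B has_real_derivative b x) (at x)"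
    using einterval_antiderivative[of "-\<infinity>" "\<infinity>" b] cont
    by (auto simp: has_real_derivative_iff_has_vector_derivative)
  have sB: "smooth_fun B" by (rule smooth_fun.antiderivative[OF b B])
  have mono: "B x \<le> B y" if "x \<le> y" for x y
    by (rule DERIV_nonneg_imp_nondecreasing[OF that]) (use B b0 in blast)
  have contB: "continuous_on S B" for S
    using B DERIV_isCont continuous_at_imp_continuous_on by blast
  have lo: "B x = B 0" if "x \<le> 0" for x
  proof (cases "x < 0")
    case True
    have "(B has_real_derivative 0) (at y)" if "y < 0" for y
      using B[of y] b2[of y] that by simp
    then have "B 0 = B x"
      by (intro DERIV_isconst2[OF True contB]) (use that in auto)
    then show ?thesis ..
  qed (use that in auto)
  have hi: "B x = B 1" if "x \<ge> 1" for x
  proof (cases "x > 1")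
    case True
    have "(B has_real_derivative 0) (at y)" if "y > 1" for y
      using B[of y] b2[of y] that by simp
    then show ?thesis
      by (intro DERIV_isconst2[OF True contB]) (use that in auto)
  qed (use that in auto)
  have lt: "B 0 < B 1"
    by (rule DERIV_pos_imp_increasing_open[of 0 1]) (use B b1 contB in auto)
  define c where "c = inverse (B 1 - B 0)"
  have c: "c > 0" "c * (B 1 - B 0) = 1" using lt by (auto simp: c_def)
  define \<Theta> where "\<Theta> = (\<lambda>x. c * (B x + (- B 0)))"
  define \<theta> where "\<theta> = (\<lambda>x. c * b x)"
  show thesis
  proof (rule that[of \<Theta> \<theta>])
    show "smooth_fun \<Theta>" "smooth_fun \<theta>"
      unfolding \<Theta>_def \<theta>_def by (intro smooth_fun.add smooth_fun.mult smooth_fun.const b sB)+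
    show "(\<Theta> has_real_derivative \<theta> x) (at x)" for x
      unfolding \<Theta>_def \<theta>_def by (auto intro!: derivative_eq_intros B)
    show "0 \<le> \<theta> x" for x using c b0 by (simp add: \<theta>_def)
    show 0: "\<Theta> x = 0" if "x \<le> 0" for x using lo[OF that] by (simp add: \<Theta>_def)
    show 1: "\<Theta> x = 1" if "x \<ge> 1" for x using hi[OF that] c by (simp add: \<Theta>_def)
    show "\<theta> x = 0" if "x \<notin> {0..1}" for x using b2 that by (auto simp: \<theta>_def)
    have \<Theta>mono: "\<Theta> x \<le> \<Theta> y" if "x \<le> y" for x y using mono[OF that] c by (simp add: \<Theta>_def)
    show "0 \<le> \<Theta> x" for x
      using \<Theta>mono[of 0 x] 0[of x] 0[of 0] by (cases "x \<le> 0") auto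
    show "\<Theta> x \<le> 1" for x
      using \<Theta>mono[of x 1] 1[of x] 1[of 1] by (cases "x \<le> 1") auto
  qed
qed

section \<open>The lemma of du Bois-Reymond and integration by parts\<close>

text \<open>The weight \<open>\<theta> ((r - s) / h) / h\<close> is a probability density on
  \<open>[s, s + h]\<close>, so the weighted mean of \<open>g\<close> differs from \<open>g
  s\<close> by no more than the oscillation there.\<close>

lemma mollify_at_point:
  fixes g \<Theta> \<theta> :: "real \<Rightarrow> real"
  assumes der: "\<And>x. (\<Theta> has_real_derivative \<theta> x) (at x)"
    and lo: "\<And>x. x \<le> 0 \<Longrightarrow> \<Theta> x = 0" and hi: "\<And>x. x \<ge> 1 \<Longrightarrow> \<Theta> x = 1"
    and pos: "\<And>x. 0 \<le> \<theta> x" and supp: "\<And>x. x \<notin> {0..1} \<Longrightarrow> \<theta> x = 0"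
    and cont: "continuous_on UNIV \<theta>"
    and g: "continuous_on {a..b} g" and h: "h > 0" "a \<le> s" "s + h \<le> b"
    and osc: "\<And>r. r \<in> {s..s+h} \<Longrightarrow> \<bar>g r - g s\<bar> \<le> e"
  shows "\<bar>integral {a..b} (\<lambda>r. \<theta> ((r - s) / h) / h * g r) - g s\<bar> \<le> e"
proof -
  have ab: "a \<le> b" using h by linarith
  have c1: "continuous_on {a..b} (\<lambda>r. \<theta> ((r - s) / h))"
    by (rule continuous_on_compose2[OF cont]) (use h in \<open>auto intro!: continuous_intros\<close>)
  have c: "continuous_on {a..b} (\<lambda>r. \<theta> ((r - s) / h) / h)"
    by (intro continuous_intros c1) (use h in auto)
  have "((\<lambda>r. \<theta> ((r - s) / h) / h) has_integral (\<Theta> ((b - s) / h) - \<Theta> ((a - s) / h))) {a..b}"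
  proof (rule fundamental_theorem_of_calculus[OF ab])
    fix r assume "r \<in> {a..b}"
    have "((\<lambda>r. \<Theta> ((r - s) / h)) has_real_derivative \<theta> ((r - s) / h) * (1 / h)) (at r)"
      by (rule DERIV_chain2[OF der]) (use h in \<open>auto intro!: derivative_eq_intros\<close>)
    then show "((\<lambda>r. \<Theta> ((r - s) / h)) has_vector_derivative \<theta> ((r - s) / h) / h) (at r within {a..b})"
      by (simp add: has_real_derivative_iff_has_vector_derivative has_vector_derivative_at_within)
  qed
  moreover have "\<Theta> ((b - s) / h) = 1" by (rule hi) (use h in \<open>simp add: field_simps\<close>)
  moreover have "\<Theta> ((a - s) / h) = 0" by (rule lo) (use h in \<open>simp add: field_simps\<close>)
  ultimately have one: "((\<lambda>r. \<theta> ((r - s) / h) / h) has_integral 1) {a..b}" by simp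
  define \<rho> where "\<rho> r = \<theta> ((r - s) / h) / h" for r
  note c = c[folded \<rho>_def] and one = one[folded \<rho>_def]
  have gi: "((\<lambda>r. \<rho> r * g r) has_integral integral {a..b} (\<lambda>r. \<rho> r * g r)) {a..b}"
    by (intro integrable_integral integrable_continuous_interval continuous_intros c g)
  have gsi: "((\<lambda>r. \<rho> r * g r - \<rho> r * g s) has_integral
      integral {a..b} (\<lambda>r. \<rho> r * g r) - 1 * g s) {a..b}"
    by (rule has_integral_diff[OF gi has_integral_mult_left[OF one]])
  have ei: "((\<lambda>r. \<rho> r * e) has_integral 1 * e) {a..b}"
    by (rule has_integral_mult_left[OF one])
  have "norm (integral {a..b} (\<lambda>r. \<rho> r * g r - \<rho> r * g s)) \<le> integral {a..b} (\<lambda>r. \<rho> r * e)"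
  proof (rule integral_norm_bound_integral)
    fix r assume "r \<in> {a..b}"
    show "norm (\<rho> r * g r - \<rho> r * g s) \<le> \<rho> r * e"
    proof (cases "(r - s) / h \<in> {0..1}")
      case True
      then have "r \<in> {s..s+h}" using h by (simp add: field_simps)
      then have "\<rho> r * \<bar>g r - g s\<bar> \<le> \<rho> r * e"
        using osc pos h by (intro mult_left_mono) (auto simp: \<rho>_def)
      moreover have "\<rho> r \<ge> 0" using pos h by (simp add: \<rho>_def)
      ultimately show ?thesis by (simp add: abs_mult flip: right_diff_distrib)
    qed (simp add: supp \<rho>_def)
  qed (use gsi ei in auto)
  then show ?thesis
    using integral_unique[OF gsi] integral_unique[OF ei] by (simp add: \<rho>_def)
qed

text \<open>On a partition of mesh below \<open>d\<close> the increments of \<open>\<Phi>\<close>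
  add up to at most \<open>e\<close> times the total increase of \<open>m\<close>, and
  \<open>e\<close> is arbitrary.\<close>

lemma telescoping_zero:
  fixes \<Phi> m :: "real \<Rightarrow> real"
  assumes "a \<le> b"
    and small: "\<And>e. e > 0 \<Longrightarrow> \<exists>d>0. \<forall>s t. a \<le> s \<longrightarrow> s \<le> t \<longrightarrow> t \<le> b \<longrightarrow> t - s < d \<longrightarrow>
        \<bar>\<Phi> t - \<Phi> s\<bar> \<le> e * (m t - m s)"
  shows "\<Phi> b = \<Phi> a"
proof -
  have bound: "\<bar>\<Phi> b - \<Phi> a\<bar> \<le> e * (m b - m a)" if e: "e > 0" for e
  proof -
    obtain d where d: "d > 0" "\<And>s t. a \<le> s \<Longrightarrow> s \<le> t \<Longrightarrow> t \<le> b \<Longrightarrow> t - s < d \<Longrightarrow>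
        \<bar>\<Phi> t - \<Phi> s\<bar> \<le> e * (m t - m s)" using small[OF e] by blast
    obtain n :: nat where n: "(b - a) / d < n" using reals_Archimedean2 by blast
    then have "n > 0" using d(1) assms(1) by (cases n) (auto simp: divide_less_0_iff)
    define t where "t i = a + (b - a) * (real i / n)" for i
    have step: "t (Suc i) - t i = (b - a) / n" for i
      using \<open>n > 0\<close> by (simp add: t_def field_simps)
    have small': "(b - a) / n < d" using n d \<open>n > 0\<close> by (simp add: field_simps)
    have mono: "t i \<le> t (Suc i)" for i
    proof -
      have "0 \<le> (b - a) / n" using assms(1) by simp
      with step[of i] show ?thesis by simp
    qed
    have up: "t i \<le> b" if "i \<le> n" for i
    proof -
      have "(b - a) * (real i / n) \<le> (b - a) * 1"
        by (rule mult_left_mono) (use that \<open>n > 0\<close> assms(1) in auto)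
      then show ?thesis by (simp add: t_def)
    qed
    have lo: "a \<le> t i" for i using assms(1) by (simp add: t_def)
    have "\<bar>\<Phi> (t i) - \<Phi> a\<bar> \<le> e * (m (t i) - m a)" if "i \<le> n" for i
      using that
    proof (induction i)
      case 0
      then show ?case by (simp add: t_def)
    next
      case (Suc i)
      have "\<bar>\<Phi> (t (Suc i)) - \<Phi> (t i)\<bar> \<le> e * (m (t (Suc i)) - m (t i))"
        by (rule d(2)) (use lo up[OF Suc.prems] mono step small' in auto)
      with Suc show ?case by (simp add: algebra_simps)
    qed
    from this[of n] show ?thesis using \<open>n > 0\<close> by (simp add: t_def)
  qed
  show ?thesis
  proof (rule ccontr)
    assume ne: "\<Phi> b \<noteq> \<Phi> a"
    define D where "D = \<bar>\<Phi> b - \<Phi> a\<bar>"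
    have "D > 0" using ne by (simp add: D_def)
    define \<mu> where "\<mu> = m b - m a"
    have "\<mu> > 0" using bound[of 1] \<open>D > 0\<close> by (simp add: D_def \<mu>_def)
    have "D \<le> D / (2 * \<mu>) * \<mu>"
      using bound[of "D / (2 * \<mu>)"] \<open>D > 0\<close> \<open>\<mu> > 0\<close> by (simp add: D_def \<mu>_def)
    also have "\<dots> = D / 2" using \<open>\<mu> > 0\<close> by simp
    finally show False using \<open>D > 0\<close> by simp
  qed
qed

lemmas abs_int_imp_int = set_lebesgue_integral_eq_integral(1)

lemma absolutely_integrable_continuous_mult:
  fixes f k :: "real \<Rightarrow> real"
  assumes "continuous_on {a..b} f" "k absolutely_integrable_on {a..b}"
  shows "(\<lambda>r. f r * k r) absolutely_integrable_on {a..b}"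
  by (rule absolutely_integrable_bounded_measurable_product_real)
    (use assms in \<open>auto intro!: continuous_imp_measurable_on_sets_lebesgue
      compact_imp_bounded compact_continuous_image\<close>)

text \<open>Test with the smooth trapezoids \<open>\<Theta> ((r - s) / h) - \<Theta> ((r - t) /
  h)\<close>. As \<open>h\<close> tends to \<open>0\<close> they converge boundedly to the indicator
  function of \<open>(s, t]\<close>, while their derivatives concentrate at \<open>s\<close> and at
  \<open>t\<close>.\<close>

lemma du_Bois_Reymond_interior:
  fixes g k :: "real \<Rightarrow> real"
  assumes g: "continuous_on {a..b} g" and k: "k absolutely_integrable_on {a..b}"
    and weak: "\<And>\<phi>. test_fun a b \<phi> \<Longrightarrow>
      integral {a..b} (\<lambda>t. deriv \<phi> t * g t) = - integral {a..b} (\<lambda>t. \<phi> t * k t)"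
    and st: "a < s" "s < t" "t < b"
  shows "g t - g s = integral {s..t} k"
proof -
  obtain \<Theta> \<theta> where *: "smooth_fun \<Theta>" "smooth_fun \<theta>"
    and der: "\<And>x. (\<Theta> has_real_derivative \<theta> x) (at x)"
    and lo: "\<And>x. x \<le> 0 \<Longrightarrow> \<Theta> x = 0" and hi: "\<And>x. x \<ge> 1 \<Longrightarrow> \<Theta> x = 1"
    and pos: "\<And>x. 0 \<le> \<theta> x" and b0: "\<And>x. 0 \<le> \<Theta> x" and b1: "\<And>x. \<Theta> x \<le> 1"
    and supp: "\<And>x. x \<notin> {0..1} \<Longrightarrow> \<theta> x = 0"
    by (rule smooth_step_exists) metis
  have cont: "continuous_on UNIV \<theta>"
    using smooth_fun_has_derivative[OF *(2)] DERIV_isCont continuous_at_imp_continuous_on by metis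
  define h where "h n = (b - t) / real (n + 2)" for n
  have h: "h n > 0" "h n < b - t" for n
  proof -
    show "h n > 0" using st by (simp add: h_def)
    have "(b - t) * 1 < (b - t) * real (n + 2)" using st by (intro mult_strict_left_mono) auto
    then show "h n < b - t" by (simp add: h_def divide_less_eq)
  qed
  have h0: "h \<longlonglongrightarrow> 0"
    using LIMSEQ_ignore_initial_segment[OF lim_const_over_n[of "b - t"], of 2] by (simp add: h_def[abs_def])
  define \<phi> where "\<phi> n r = \<Theta> ((r - s) / h n) - \<Theta> ((r - t) / h n)" for n r
  define \<phi>' where "\<phi>' n r = \<theta> ((r - s) / h n) / h n - \<theta> ((r - t) / h n) / h n" for n r
  have der': "(\<phi> n has_real_derivative \<phi>' n r) (at r)" for n r
  proof -
    have "((\<lambda>r. \<Theta> ((r - x) / h n)) has_real_derivative \<theta> ((r - x) / h n) * (1 / h n)) (at r)" for x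
      by (rule DERIV_chain2[OF der]) (use h(1)[of n] in \<open>auto intro!: derivative_eq_intros\<close>)
    from DERIV_diff[OF this[of s] this[of t]] show ?thesis by (simp add: \<phi>_def[abs_def] \<phi>'_def)
  qed
  have test: "test_fun a b (\<phi> n)" for n
  proof (rule smooth_fun_test_fun[of _ a s "t + h n"])
    have "smooth_fun (\<lambda>r. \<Theta> ((1 / h n) * r + (- s / h n)) + (-1) * \<Theta> ((1 / h n) * r + (- t / h n)))"
      by (rule smooth_fun.add[OF smooth_fun.affine[OF *(1)] smooth_fun.mult[OF smooth_fun.const smooth_fun.affine[OF *(1)]]])
    moreover have "(\<lambda>r. \<Theta> ((1 / h n) * r + (- s / h n)) + (-1) * \<Theta> ((1 / h n) * r + (- t / h n))) = \<phi> n"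
      by (rule ext) (simp add: \<phi>_def diff_divide_distrib)
    ultimately show "smooth_fun (\<phi> n)" by simp
    show "a < s" "s \<le> t + h n" "t + h n < b" using st h[of n] by auto
    fix r assume r: "r \<notin> {s..t + h n}"
    show "\<phi> n r = 0"
    proof (cases "r < s")
      case True
      then show ?thesis using st h[of n] lo[of "(r - s) / h n"] lo[of "(r - t) / h n"]
        by (simp add: \<phi>_def divide_nonpos_pos)
    next
      case False
      then have "(r - s) / h n \<ge> 1" "(r - t) / h n \<ge> 1"
        using r st h[of n] by (auto simp: field_simps)
      then show ?thesis using hi by (simp add: \<phi>_def)
    qed
  qed
  have D: "deriv (\<phi> n) = \<phi>' n" for n using der' by (auto intro!: DERIV_imp_deriv)
  have lim: "(\<lambda>n. integral {a..b} (\<lambda>r. \<theta> ((r - x) / h n) / h n * g r)) \<longlonglongrightarrow> g x"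
    if x: "a < x" "x \<le> t" for x
  proof (rule LIMSEQ_I)
    fix e :: real assume "e > 0"
    have "x \<in> {a..b}" using x st by auto
    then obtain d where d: "d > 0" "\<And>r. r \<in> {a..b} \<Longrightarrow> \<bar>r - x\<bar> < d \<Longrightarrow> \<bar>g r - g x\<bar> < e / 2"
      using g[unfolded continuous_on_iff] \<open>e > 0\<close> unfolding dist_real_def
      by (metis half_gt_zero)
    obtain N where N: "\<And>n. n \<ge> N \<Longrightarrow> h n < d"
      using order_tendstoD(2)[OF h0 d(1)] by (auto simp: eventually_sequentially)
    show "\<exists>no. \<forall>n\<ge>no. norm (integral {a..b} (\<lambda>r. \<theta> ((r - x) / h n) / h n * g r) - g x) < e"
    proof (intro exI[of _ N] allI impI)
      fix n assume n: "n \<ge> N"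
      have "\<bar>integral {a..b} (\<lambda>r. \<theta> ((r - x) / h n) / h n * g r) - g x\<bar> \<le> e / 2"
      proof (rule mollify_at_point[OF der lo hi pos supp cont g h(1)])
        show "a \<le> x" "x + h n \<le> b" using x h[of n] by auto
        fix r assume "r \<in> {x..x + h n}"
        then show "\<bar>g r - g x\<bar> \<le> e / 2"
          using d(2)[of r] N[OF n] x h[of n] by (auto intro!: less_imp_le)
      qed
      then show "norm (integral {a..b} (\<lambda>r. \<theta> ((r - x) / h n) / h n * g r) - g x) < e"
        using \<open>e > 0\<close> by simp
    qed
  qed
  have c1: "continuous_on {a..b} (\<lambda>r. \<theta> ((r - x) / h n) / h n * g r)" for x n
  proof -
    have "continuous_on {a..b} (\<lambda>r. \<theta> ((r - x) / h n))"
      by (rule continuous_on_compose2[OF cont]) (auto intro!: continuous_intros less_imp_neq[OF h(1), symmetric])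
    then show ?thesis using h(1)[of n] by (intro continuous_intros g) auto
  qed
  have split: "integral {a..b} (\<lambda>r. \<phi>' n r * g r) =
      integral {a..b} (\<lambda>r. \<theta> ((r - s) / h n) / h n * g r)
      - integral {a..b} (\<lambda>r. \<theta> ((r - t) / h n) / h n * g r)" for n
    unfolding \<phi>'_def left_diff_distrib
    by (intro Henstock_Kurzweil_Integration.integral_diff integrable_continuous_interval c1)
  have L1: "(\<lambda>n. integral {a..b} (\<lambda>r. \<phi>' n r * g r)) \<longlonglongrightarrow> g s - g t"
    unfolding split by (intro tendsto_diff lim) (use st in auto)
  have L2: "(\<lambda>n. integral {a..b} (\<lambda>r. \<phi> n r * k r)) \<longlonglongrightarrow>
      integral {a..b} (\<lambda>r. if r \<in> {s<..t} then k r else 0)"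
  proof (rule dominated_convergence(2)[where h="\<lambda>r. \<bar>k r\<bar>"])
    show "(\<lambda>r. \<phi> n r * k r) integrable_on {a..b}" for n
    proof -
      have "continuous_on {a..b} (\<phi> n)"
        using der' DERIV_isCont continuous_at_imp_continuous_on by blast
      from absolutely_integrable_continuous_mult[OF this k] show ?thesis
        by (auto simp: absolutely_integrable_on_def)
    qed
    show "(\<lambda>r. \<bar>k r\<bar>) integrable_on {a..b}" using k by (auto simp: absolutely_integrable_on_def)
    fix n r
    have "\<bar>\<phi> n r\<bar> \<le> 1"
      using b0[of "(r - s) / h n"] b1[of "(r - s) / h n"] b0[of "(r - t) / h n"] b1[of "(r - t) / h n"]
      by (simp add: \<phi>_def)
    then show "norm (\<phi> n r * k r) \<le> \<bar>k r\<bar>" by (simp add: abs_mult mult_left_le_one_le)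
  next
    fix r
    have ev: "\<forall>\<^sub>F n in sequentially. \<Theta> ((r - x) / h n) = (if r \<le> x then 0 else 1)" for x
    proof (cases "r \<le> x")
      case True
      then show ?thesis using lo h(1) by (auto intro!: always_eventually simp: divide_nonpos_pos)
    next
      case False
      then have "\<forall>\<^sub>F n in sequentially. h n < r - x" using order_tendstoD(2)[OF h0] by simp
      then show ?thesis
        by eventually_elim (use False hi h(1) in \<open>auto simp: field_simps\<close>)
    qed
    have "\<forall>\<^sub>F n in sequentially. \<phi> n r = (if r \<in> {s<..t} then 1 else 0)"
      using ev[of s] ev[of t] by eventually_elim (use st in \<open>auto simp: \<phi>_def\<close>)
    then have "\<forall>\<^sub>F n in sequentially. \<phi> n r * k r = (if r \<in> {s<..t} then k r else 0)"
      by eventually_elim auto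
    then show "(\<lambda>n. \<phi> n r * k r) \<longlonglongrightarrow> (if r \<in> {s<..t} then k r else 0)"
      by (rule tendsto_eventually)
  qed
  have "integral {a..b} (\<lambda>r. if r \<in> {s<..t} then k r else 0) = integral ({s<..t} \<inter> {a..b}) k"
    by (simp only: Henstock_Kurzweil_Integration.integral_restrict_Int)
  also have "{s<..t} \<inter> {a..b} = {s<..t}" using st by auto
  also have "integral {s<..t} k = integral {s..t} k"
    by (rule integral_subset_negligible) (auto intro: negligible_subset[of "{s}"])
  finally have I: "integral {a..b} (\<lambda>r. if r \<in> {s<..t} then k r else 0) = integral {s..t} k" .
  have "(\<lambda>n. integral {a..b} (\<lambda>r. \<phi>' n r * g r)) \<longlonglongrightarrow> - integral {s..t} k"
    using tendsto_minus[OF L2] weak[OF test] unfolding D I by simp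
  with L1 have "g s - g t = - integral {s..t} k" by (rule LIMSEQ_unique)
  then show ?thesis by simp
qed

text \<open>The interior identity says that \<open>g\<close> minus the indefinite integral of
  \<open>k\<close> is constant on \<open>(a, b)\<close>; continuity extends this to the end
  points.\<close>

lemma du_Bois_Reymond:
  fixes g k :: "real \<Rightarrow> real"
  assumes "a < b" and g: "continuous_on {a..b} g" and k: "k absolutely_integrable_on {a..b}"
    and weak: "\<And>\<phi>. test_fun a b \<phi> \<Longrightarrow>
      integral {a..b} (\<lambda>t. deriv \<phi> t * g t) = - integral {a..b} (\<lambda>t. \<phi> t * k t)"
    and st: "a \<le> s" "s \<le> t" "t \<le> b"
  shows "g t - g s = integral {s..t} k"
proof -
  have ki: "k integrable_on {a..b}" using k by (auto simp: absolutely_integrable_on_def)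
  define c where "c = (a + b) / 2"
  define f where "f t = g t - integral {a..t} k" for t
  have cf: "continuous_on {a..b} f" unfolding f_def
    by (intro continuous_intros g indefinite_integral_continuous_1 ki)
  have comb: "integral {a..y} k - integral {a..x} k = integral {x..y} k" if "a \<le> x" "x \<le> y" "y \<le> b" for x y
    using Henstock_Kurzweil_Integration.integral_combine[of a x y k]
      integrable_subinterval_real[OF ki, of a y] that by simp
  have eq: "f x = f y" if "a < x" "x < y" "y < b" for x y
    using du_Bois_Reymond_interior[OF g k weak that] comb[of x y] that by (simp add: f_def)
  have c: "a < c" "c < b" using \<open>a < b\<close> by (auto simp: c_def)
  have int: "f x = f c" if "x \<in> {a<..<b}" for x
    using eq[of x c] eq[of c x, symmetric] that by (cases x c rule: linorder_cases) (use c in auto)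
  have "f x = f c" if "x \<in> {a..b}" for x
  proof (rule continuous_constant_on_closure[of "{a<..<b}" f "f c" x])
    show "continuous_on (closure {a<..<b}) f" using cf \<open>a < b\<close> by simp
    show "x \<in> closure {a<..<b}" using that \<open>a < b\<close> by simp
  qed (rule int)
  then have "f t = f s" using st by simp
  then show ?thesis using comb[OF st] by (simp add: f_def)
qed

text \<open>\<open>G\<close> is an indefinite integral and need not be differentiable. Write the
  increment of \<open>\<phi> G\<close> over a short interval as \<open>\<phi>(s) (G(t) - G(s)) +
  G(t) (\<phi>(t) - \<phi>(s))\<close>. It differs from the integral of \<open>\<phi>' G + \<phi>
  k\<close> by at most the oscillation of \<open>\<phi>\<close> and \<open>G\<close> times the
  integral of \<open>|k| + |\<phi>'|\<close>, so the lemma \<open>telescoping_zero\<close>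
  applies.\<close>

lemma integral_by_parts_indefinite:
  fixes \<phi> \<phi>' G k :: "real \<Rightarrow> real"
  assumes "a \<le> b" and k: "k absolutely_integrable_on {a..b}"
    and der: "\<And>x. (\<phi> has_real_derivative \<phi>' x) (at x)" and c': "continuous_on {a..b} \<phi>'"
    and cG: "continuous_on {a..b} G"
    and G: "\<And>s t. a \<le> s \<Longrightarrow> s \<le> t \<Longrightarrow> t \<le> b \<Longrightarrow> G t - G s = integral {s..t} k"
  shows "integral {a..b} (\<lambda>t. \<phi>' t * G t) + integral {a..b} (\<lambda>t. \<phi> t * k t) = \<phi> b * G b - \<phi> a * G a"
proof -
  have c: "continuous_on S \<phi>" for S
    using der DERIV_isCont continuous_at_imp_continuous_on by blast
  define F where "F = (\<lambda>t. \<phi>' t * G t + \<phi> t * k t)"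
  define M where "M = (\<lambda>t. \<bar>k t\<bar> + \<bar>\<phi>' t\<bar>)"
  have ki: "k integrable_on {a..b}" "(\<lambda>t. \<bar>k t\<bar>) integrable_on {a..b}"
    using k by (auto simp: absolutely_integrable_on_def)
  have p1: "(\<lambda>t. \<phi>' t * G t) integrable_on {a..b}"
    by (intro integrable_continuous_interval continuous_intros c' cG)
  have p2: "(\<lambda>t. \<phi> t * k t) integrable_on {a..b}"
    using absolutely_integrable_continuous_mult[OF c k] by (auto simp: absolutely_integrable_on_def)
  have Fi: "F integrable_on {a..b}" unfolding F_def by (intro integrable_add p1 p2)
  have Mi: "M integrable_on {a..b}" unfolding M_def
    by (intro integrable_add ki integrable_continuous_interval continuous_intros c')
  \<comment> \<open>the claim says that \<open>\<Phi>\<close> takes the same value at both ends\<close>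
  define \<Phi> where "\<Phi> t = \<phi> t * G t - integral {a..t} F" for t
  have sub: "f integrable_on {s..t}" if "f integrable_on {a..b}" "a \<le> s" "t \<le> b" for f :: "real \<Rightarrow> real" and s t
    by (rule integrable_subinterval_real[OF that(1)]) (use that in auto)
  have diff: "integral {a..t} f - integral {a..s} f = integral {s..t} f"
    if "f integrable_on {a..b}" "a \<le> s" "s \<le> t" "t \<le> b" for f :: "real \<Rightarrow> real" and s t
    using Henstock_Kurzweil_Integration.integral_combine[of a s t f] sub[OF that(1), of a t] that by simp
  have "\<Phi> b = \<Phi> a"
  proof (rule telescoping_zero[where \<Phi>=\<Phi> and m="\<lambda>t. integral {a..t} M"])
    show "a \<le> b" by fact
    fix e :: real assume "e > 0"
    have "uniformly_continuous_on {a..b} \<phi>" "uniformly_continuous_on {a..b} G"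
      by (auto intro!: compact_uniformly_continuous c cG)
    with \<open>e > 0\<close> obtain d1 d2 where d: "d1 > 0" "d2 > 0"
      "\<And>x y. x \<in> {a..b} \<Longrightarrow> y \<in> {a..b} \<Longrightarrow> \<bar>y - x\<bar> < d1 \<Longrightarrow> \<bar>\<phi> y - \<phi> x\<bar> < e"
      "\<And>x y. x \<in> {a..b} \<Longrightarrow> y \<in> {a..b} \<Longrightarrow> \<bar>y - x\<bar> < d2 \<Longrightarrow> \<bar>G y - G x\<bar> < e"
      by (elim uniformly_continuous_onE[OF _ \<open>e > 0\<close>]) (auto simp: dist_real_def)
    show "\<exists>d>0. \<forall>s t. a \<le> s \<longrightarrow> s \<le> t \<longrightarrow> t \<le> b \<longrightarrow> t - s < d \<longrightarrow>
        \<bar>\<Phi> t - \<Phi> s\<bar> \<le> e * (integral {a..t} M - integral {a..s} M)"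
    proof (intro exI[of _ "min d1 d2"] conjI allI impI)
      show "min d1 d2 > 0" using d by simp
      fix s t assume st: "a \<le> s" "s \<le> t" "t \<le> b" "t - s < min d1 d2"
      have i1: "((\<lambda>r. \<phi> s * k r) has_integral \<phi> s * (G t - G s)) {s..t}"
        unfolding G[OF st(1-3)]
        by (intro has_integral_mult_right integrable_integral sub[OF ki(1)] st)
      have "(\<phi>' has_integral (\<phi> t - \<phi> s)) {s..t}"
        by (rule fundamental_theorem_of_calculus[OF st(2)])
          (auto intro!: has_field_derivative_at_within der
            simp flip: has_real_derivative_iff_has_vector_derivative)
      then have i2: "((\<lambda>r. \<phi>' r * G t) has_integral (\<phi> t - \<phi> s) * G t) {s..t}"
        by (rule has_integral_mult_left)
      have i3: "(F has_integral integral {s..t} F) {s..t}"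
        by (intro integrable_integral sub[OF Fi] st)
      have i4: "((\<lambda>r. \<phi> s * k r + \<phi>' r * G t - F r) has_integral
          \<phi> s * (G t - G s) + (\<phi> t - \<phi> s) * G t - integral {s..t} F) {s..t}"
        by (intro has_integral_diff has_integral_add i1 i2 i3)
      have i5: "((\<lambda>r. e * M r) has_integral e * integral {s..t} M) {s..t}"
        by (intro has_integral_mult_right integrable_integral sub[OF Mi] st)
      have "\<bar>\<phi> s * (G t - G s) + (\<phi> t - \<phi> s) * G t - integral {s..t} F\<bar> \<le> e * integral {s..t} M"
      proof -
        have "norm (integral {s..t} (\<lambda>r. \<phi> s * k r + \<phi>' r * G t - F r)) \<le> integral {s..t} (\<lambda>r. e * M r)"
        proof (rule integral_norm_bound_integral)
          fix r assume r: "r \<in> {s..t}"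
          have "\<phi> s * k r + \<phi>' r * G t - F r = (\<phi> s - \<phi> r) * k r + (G t - G r) * \<phi>' r"
            by (simp add: F_def algebra_simps)
          also have "norm \<dots> \<le> \<bar>\<phi> s - \<phi> r\<bar> * \<bar>k r\<bar> + \<bar>G t - G r\<bar> * \<bar>\<phi>' r\<bar>"
            using norm_triangle_ineq[of "(\<phi> s - \<phi> r) * k r" "(G t - G r) * \<phi>' r"] by (simp add: abs_mult)
          also have "\<dots> \<le> e * \<bar>k r\<bar> + e * \<bar>\<phi>' r\<bar>"
            using d(3)[of r s] d(4)[of r t] r st by (intro add_mono mult_right_mono) auto
          finally show "norm (\<phi> s * k r + \<phi>' r * G t - F r) \<le> e * M r"
            by (simp add: M_def algebra_simps)
        qed (use i4 i5 in auto)
        then show ?thesis using integral_unique[OF i4] integral_unique[OF i5] by simp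
      qed
      moreover have "\<Phi> t - \<Phi> s = \<phi> s * (G t - G s) + (\<phi> t - \<phi> s) * G t - integral {s..t} F"
        using diff[OF Fi st(1-3)] by (simp add: \<Phi>_def algebra_simps)
      ultimately show "\<bar>\<Phi> t - \<Phi> s\<bar> \<le> e * (integral {a..t} M - integral {a..s} M)"
        using diff[OF Mi st(1-3)] by simp
    qed
  qed
  moreover have "integral {a..b} F = integral {a..b} (\<lambda>t. \<phi>' t * G t) + integral {a..b} (\<lambda>t. \<phi> t * k t)"
    unfolding F_def by (rule Henstock_Kurzweil_Integration.integral_add[OF p1 p2])
  ultimately show ?thesis by (simp add: \<Phi>_def)
qed

section \<open>Strongly measurable and Bochner integrable functions\<close>

lemma continuous_on_Icc_bdd_above:
  fixes f :: "real \<Rightarrow> real"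
  assumes "continuous_on {a..b} f"
  shows "bdd_above (f ` {a..b})"
  using compact_continuous_image[OF assms compact_Icc]
  by (simp add: bounded_imp_bdd_above compact_imp_bounded)

lemma AE_lebesgue_on_iff:
  "S \<in> sets lebesgue \<Longrightarrow> (AE x in lebesgue_on S. P x) \<longleftrightarrow> (AE x in lebesgue. x \<in> S \<longrightarrow> P x)"
  by (simp add: AE_restrict_space_iff)

text \<open>Lebesgue measure is complete, so the exceptional null set does not affect
  measurability.\<close>

lemma borel_measurable_AE_LIMSEQ:
  fixes f :: "nat \<Rightarrow> real \<Rightarrow> real"
  assumes S: "S \<in> sets lebesgue" and f: "\<And>n. f n \<in> borel_measurable (lebesgue_on S)"
    and lim: "AE x in lebesgue_on S. (\<lambda>n. f n x) \<longlonglongrightarrow> g x"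
  shows "g \<in> borel_measurable (lebesgue_on S)"
proof -
  have "AE x in lebesgue. x \<in> S \<longrightarrow> (\<lambda>n. f n x) \<longlonglongrightarrow> g x"
    using lim S by (subst (asm) AE_lebesgue_on_iff)
  then obtain N where N: "N \<in> null_sets lebesgue" "\<And>x. x \<notin> N \<Longrightarrow> x \<in> S \<Longrightarrow> (\<lambda>n. f n x) \<longlonglongrightarrow> g x"
    by (force elim!: AE_E3)
  have "(\<lambda>x. if x \<in> S - N then f n x else 0) \<in> borel_measurable lebesgue" for n
  proof -
    have "(\<lambda>x. if x \<in> S then f n x else 0) \<in> borel_measurable lebesgue"
      using f S by (simp add: borel_measurable_if)
    then have "(\<lambda>x. (1 - indicator N x) * (if x \<in> S then f n x else 0)) \<in> borel_measurable lebesgue"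
      using N(1) by (intro borel_measurable_times borel_measurable_diff borel_measurable_const borel_measurable_indicator)
        (auto simp: null_setsD2)
    also have "(\<lambda>x. (1 - indicator N x) * (if x \<in> S then f n x else 0)) = (\<lambda>x. if x \<in> S - N then f n x else 0)"
      by (auto simp: indicator_def)
    finally show ?thesis .
  qed
  then have "(\<lambda>x. if x \<in> S - N then g x else 0) \<in> borel_measurable lebesgue"
    by (rule borel_measurable_LIMSEQ_real[rotated]) (use N in auto)
  moreover have "AE x in lebesgue. (if x \<in> S - N then g x else 0) = (if x \<in> S then g x else 0)"
    by (rule AE_I'[OF N(1)]) auto
  ultimately have "(\<lambda>x. if x \<in> S then g x else 0) \<in> borel_measurable lebesgue"
    by (rule borel_measurable_AE)
  then show ?thesis using S by (simp add: borel_measurable_if)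
qed

lemma strongly_measurable_Pair:
  assumes "strongly_measurable M f" "strongly_measurable M g"
  shows "strongly_measurable M (\<lambda>x. (f x, g x))"
proof -
  from assms obtain s t where *: "\<And>n::nat. simple_function M (s n)" "AE x in M. (\<lambda>n. s n x) \<longlonglongrightarrow> f x"
    "\<And>n::nat. simple_function M (t n)" "AE x in M. (\<lambda>n. t n x) \<longlonglongrightarrow> g x"
    unfolding strongly_measurable_def by blast
  have "AE x in M. (\<lambda>n. (s n x, t n x)) \<longlonglongrightarrow> (f x, g x)"
    using *(2,4) by eventually_elim (rule tendsto_Pair)
  then show ?thesis unfolding strongly_measurable_def
    by (intro exI[of _ "\<lambda>n x. (s n x, t n x)"]) (auto intro: *)
qed

lemma strongly_measurable_continuous:
  assumes "strongly_measurable M f" "continuous_on UNIV \<Phi>"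
  shows "strongly_measurable M (\<lambda>x. \<Phi> (f x))"
proof -
  from assms obtain s where *: "\<And>n::nat. simple_function M (s n)" "AE x in M. (\<lambda>n. s n x) \<longlonglongrightarrow> f x"
    unfolding strongly_measurable_def by blast
  have "AE x in M. (\<lambda>n. \<Phi> (s n x)) \<longlonglongrightarrow> \<Phi> (f x)"
    using *(2) by eventually_elim (use assms(2) in \<open>auto intro: continuous_on_tendsto_compose\<close>)
  then show ?thesis unfolding strongly_measurable_def
    using simple_function_compose1[OF *(1), of \<Phi>] by (intro exI[of _ "\<lambda>n x. \<Phi> (s n x)"]) blast
qed

lemma strongly_measurable_imp_borel:
  fixes f :: "real \<Rightarrow> real"
  assumes "S \<in> sets lebesgue" "strongly_measurable (lebesgue_on S) f"
  shows "f \<in> borel_measurable (lebesgue_on S)"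
proof -
  from assms obtain s where *: "\<And>n::nat. simple_function (lebesgue_on S) (s n)"
    "AE x in lebesgue_on S. (\<lambda>n. s n x) \<longlonglongrightarrow> f x"
    unfolding strongly_measurable_def by blast
  show ?thesis
    by (rule borel_measurable_AE_LIMSEQ[OF assms(1) _ *(2)]) (rule borel_measurable_simple_function[OF *(1)])
qed

lemma strongly_measurable_diff:
  fixes f g :: "'a \<Rightarrow> 'b::real_normed_vector"
  assumes "strongly_measurable M f" "strongly_measurable M g"
  shows "strongly_measurable M (\<lambda>x. f x - g x)"
proof -
  have "continuous_on UNIV (\<lambda>z::'b \<times> 'b. fst z - snd z)" by (intro continuous_intros)
  from strongly_measurable_continuous[OF strongly_measurable_Pair[OF assms] this]
  show ?thesis by simp
qed

lemma strongly_measurable_AE_cong: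
  assumes f: "strongly_measurable M f" and eq: "AE x in M. f x = g x"
  shows "strongly_measurable M g"
proof -
  obtain s where s: "\<And>n::nat. simple_function M (s n)" "AE x in M. (\<lambda>n. s n x) \<longlonglongrightarrow> f x"
    using f unfolding strongly_measurable_def by blast
  have "AE x in M. (\<lambda>n. s n x) \<longlonglongrightarrow> g x" using s(2) eq by eventually_elim simp
  then show ?thesis using s(1) unfolding strongly_measurable_def by blast
qed

lemma strongly_measurable_glue:
  fixes f g :: "real \<Rightarrow> 'b::real_normed_vector"
  assumes f: "strongly_measurable (lebesgue_on {a<..<c}) f"
    and g: "strongly_measurable (lebesgue_on {c<..<b}) g" and "a < c" "c < b"
  shows "strongly_measurable (lebesgue_on {a<..<b}) (\<lambda>t. if t < c then f t else g t)"
proof -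
  from f g obtain s t where *: "\<And>n::nat. simple_function (lebesgue_on {a<..<c}) (s n)"
    "AE x in lebesgue_on {a<..<c}. (\<lambda>n. s n x) \<longlonglongrightarrow> f x"
    "\<And>n::nat. simple_function (lebesgue_on {c<..<b}) (t n)"
    "AE x in lebesgue_on {c<..<b}. (\<lambda>n. t n x) \<longlonglongrightarrow> g x"
    unfolding strongly_measurable_def by blast
  define r where "r n x = (if x < c then s n x else if x = c then 0 else t n x)" for n x
  have "simple_function (lebesgue_on {a<..<b}) (r n)" for n
    unfolding simple_function_def
  proof (intro conjI ballI)
    have sub: "r n ` {a<..<b} \<subseteq> s n ` {a<..<c} \<union> {0} \<union> t n ` {c<..<b}"
    proof (rule image_subsetI)
      fix x assume "x \<in> {a<..<b}"
      then show "r n x \<in> s n ` {a<..<c} \<union> {0} \<union> t n ` {c<..<b}"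
        by (cases x c rule: linorder_cases) (auto simp: r_def)
    qed
    have "finite (s n ` {a<..<c})" "finite (t n ` {c<..<b})"
      using *(1,3)[of n] by (auto simp: simple_function_def)
    then show "finite (r n ` space (lebesgue_on {a<..<b}))"
      using finite_subset[OF sub] by simp
    fix y assume "y \<in> r n ` space (lebesgue_on {a<..<b})"
    have 1: "s n -` {y} \<inter> {a<..<c} \<in> sets lebesgue"
    proof (cases "y \<in> s n ` {a<..<c}")
      case True
      then have "s n -` {y} \<inter> {a<..<c} \<in> sets (lebesgue_on {a<..<c})"
        using *(1)[of n] by (auto simp: simple_function_def)
      then show ?thesis by (simp add: sets_restrict_space_iff)
    next
      case False
      then have "s n -` {y} \<inter> {a<..<c} = {}" by auto
      then show ?thesis by simp
    qed
    have 2: "t n -` {y} \<inter> {c<..<b} \<in> sets lebesgue"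
    proof (cases "y \<in> t n ` {c<..<b}")
      case True
      then have "t n -` {y} \<inter> {c<..<b} \<in> sets (lebesgue_on {c<..<b})"
        using *(3)[of n] by (auto simp: simple_function_def)
      then show ?thesis by (simp add: sets_restrict_space_iff)
    next
      case False
      then have "t n -` {y} \<inter> {c<..<b} = {}" by auto
      then show ?thesis by simp
    qed
    have "r n -` {y} \<inter> {a<..<b} = (s n -` {y} \<inter> {a<..<c}) \<union> (if y = 0 then {c} else {}) \<union> (t n -` {y} \<inter> {c<..<b})"
      using \<open>a < c\<close> \<open>c < b\<close> by (auto simp: r_def split: if_splits)
    also have "\<dots> \<in> sets lebesgue" using 1 2 by (intro sets.Un) auto
    finally show "r n -` {y} \<inter> space (lebesgue_on {a<..<b}) \<in> sets (lebesgue_on {a<..<b})"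
      by (simp add: sets_restrict_space_iff)
  qed
  moreover have "AE x in lebesgue_on {a<..<b}. (\<lambda>n. r n x) \<longlonglongrightarrow> (if x < c then f x else g x)"
  proof -
    have "AE x in lebesgue. x \<noteq> c" by (rule AE_I'[of "{c}"]) auto
    moreover have "AE x in lebesgue. x \<in> {a<..<c} \<longrightarrow> (\<lambda>n. s n x) \<longlonglongrightarrow> f x"
      "AE x in lebesgue. x \<in> {c<..<b} \<longrightarrow> (\<lambda>n. t n x) \<longlonglongrightarrow> g x"
      using *(2,4) by (simp_all add: AE_lebesgue_on_iff)
    ultimately have "AE x in lebesgue. x \<in> {a<..<b} \<longrightarrow> (\<lambda>n. r n x) \<longlonglongrightarrow> (if x < c then f x else g x)"
      by eventually_elim (auto simp: r_def)
    then show ?thesis by (simp add: AE_lebesgue_on_iff)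
  qed
  ultimately show ?thesis unfolding strongly_measurable_def by blast
qed

lemma integrable_lebesgue_on_open_iff:
  fixes f :: "real \<Rightarrow> real"
  shows "integrable (lebesgue_on {a<..<b}) f \<longleftrightarrow> f absolutely_integrable_on {a..b}"
proof -
  have "integrable (lebesgue_on {a<..<b}) f \<longleftrightarrow> f absolutely_integrable_on {a<..<b}"
    by (simp add: set_integrable_def integrable_restrict_space)
  also have "\<dots> \<longleftrightarrow> f absolutely_integrable_on {a..b}"
    using absolutely_integrable_on_open_interval[where f=f and a=a and b=b] by simp
  finally show ?thesis .
qed

lemma integral_lebesgue_on_open:
  fixes f :: "real \<Rightarrow> real"
  assumes "f absolutely_integrable_on {a..b}"
  shows "integral\<^sup>L (lebesgue_on {a<..<b}) f = integral {a..b} f"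
  using lebesgue_integral_eq_integral[where S="{a<..<b}" and f=f] assms
    integral_open_interval_real[where f=f and a=a and b=b]
  by (simp add: integrable_lebesgue_on_open_iff)

lemma absolutely_integrable_sub:
  fixes f :: "real \<Rightarrow> real"
  assumes "f absolutely_integrable_on {a..b}" "a \<le> s" "t \<le> b"
  shows "f absolutely_integrable_on {s..t}"
  by (rule absolutely_integrable_on_subinterval[OF assms(1)]) (use assms in auto)

lemma integral_diff_indefinite:
  fixes f :: "real \<Rightarrow> real"
  assumes "f absolutely_integrable_on {a..b}" "a \<le> s" "s \<le> t" "t \<le> b"
  shows "integral {a..t} f - integral {a..s} f = integral {s..t} f"
  using Henstock_Kurzweil_Integration.integral_combine[of a s t f]
    integrable_subinterval_real[OF abs_int_imp_int[OF assms(1)], of a t] assms by simp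

lemma integral_bound_real:
  fixes f g :: "real \<Rightarrow> real"
  assumes "f absolutely_integrable_on {a..b}" "g absolutely_integrable_on {a..b}"
    and "AE t in lebesgue_on {a<..<b}. f t \<le> g t"
  shows "integral {a..b} f \<le> integral {a..b} g"
  using integral_mono_AE[of "lebesgue_on {a<..<b}" f g] assms
  by (simp add: integrable_lebesgue_on_open_iff integral_lebesgue_on_open)

lemma AE_subinterval:
  fixes a b s t :: real
  assumes "AE t in lebesgue_on {a<..<b}. P t" "a \<le> s" "t \<le> b"
  shows "AE t in lebesgue_on {s<..<t}. P t"
proof -
  have "AE t in lebesgue. t \<in> {a<..<b} \<longrightarrow> P t" using assms(1) by (subst (asm) AE_lebesgue_on_iff) auto
  then have "AE r in lebesgue. r \<in> {s<..<t} \<longrightarrow> P r" by eventually_elim (use assms in auto)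
  then show ?thesis by (simp add: AE_lebesgue_on_iff)
qed

lemma absolutely_integrable_bound:
  fixes f g :: "real \<Rightarrow> real"
  assumes "f \<in> borel_measurable (lebesgue_on {a<..<b})" "g absolutely_integrable_on {a..b}"
    and "AE t in lebesgue_on {a<..<b}. \<bar>f t\<bar> \<le> g t"
  shows "f absolutely_integrable_on {a..b}"
proof -
  have "integrable (lebesgue_on {a<..<b}) f"
    by (rule Bochner_Integration.integrable_bound[of _ g])
      (use assms in \<open>auto simp: integrable_lebesgue_on_open_iff elim!: eventually_mono\<close>)
  then show ?thesis by (simp add: integrable_lebesgue_on_open_iff)
qed

lemma absolutely_integrable_const [simp]:
  "(\<lambda>_. c::real) absolutely_integrable_on {a..b::real}"
  by (rule absolutely_integrable_continuous_real) simp

lemma bochner_Lp_strongly_measurable: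
  "bochner_Lp r a b f \<Longrightarrow> strongly_measurable (lebesgue_on {a<..<b}) f"
  by (simp add: bochner_Lp_def)

lemma bochner_Lp_powr:
  "bochner_Lp r a b f \<Longrightarrow> (\<lambda>t. norm (f t) powr r) absolutely_integrable_on {a..b}"
  by (simp add: bochner_Lp_def integrable_lebesgue_on_open_iff)

lemma le_one_add_powr:
  fixes y r :: real
  assumes "y \<ge> 0" "r \<ge> 1"
  shows "y \<le> 1 + y powr r"
proof (cases "y \<le> 1")
  case False
  then have "y powr 1 \<le> y powr r" using assms(2) by (intro powr_mono) auto
  then show ?thesis using False by simp
qed (use assms in \<open>simp add: add_increasing2\<close>)

lemma bochner_Lp_norm:
  assumes "bochner_Lp r a b f" "r \<ge> 1"
  shows "(\<lambda>t. norm (f t)) absolutely_integrable_on {a..b}"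
proof (rule absolutely_integrable_bound)
  show "(\<lambda>t. norm (f t)) \<in> borel_measurable (lebesgue_on {a<..<b})"
    by (rule strongly_measurable_imp_borel[OF _ strongly_measurable_continuous[OF bochner_Lp_strongly_measurable[OF assms(1)]]])
      (auto intro!: continuous_intros)
  show "(\<lambda>t. 1 + norm (f t) powr r) absolutely_integrable_on {a..b}"
    by (intro set_integral_add bochner_Lp_powr[OF assms(1)] absolutely_integrable_const)
  show "AE t in lebesgue_on {a<..<b}. \<bar>norm (f t)\<bar> \<le> 1 + norm (f t) powr r"
    by (intro always_eventually allI) (simp add: le_one_add_powr assms(2))
qed

lemma powr_add_le:
  assumes "a \<ge> 0" "b \<ge> 0" "r > 0"
  shows "(a + b) powr r \<le> 2 powr r * (a powr r + b powr (r::real))"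
proof -
  have "(a + b) powr r \<le> (2 * max a b) powr r" using assms by (intro powr_mono2) auto
  also have "\<dots> = 2 powr r * max a b powr r" using assms by (simp add: powr_mult)
  also have "\<dots> \<le> 2 powr r * (a powr r + b powr r)" by (intro mult_left_mono) (auto simp: max_def)
  finally show ?thesis .
qed

lemma bochner_Lp_diff:
  assumes f: "bochner_Lp r a b f" and g: "bochner_Lp r a b g" and "r > 0"
  shows "bochner_Lp r a b (\<lambda>t. f t - g t)"
proof -
  have sm: "strongly_measurable (lebesgue_on {a<..<b}) (\<lambda>t. f t - g t)"
    by (intro strongly_measurable_diff bochner_Lp_strongly_measurable[OF f] bochner_Lp_strongly_measurable[OF g])
  have "(\<lambda>t. norm (f t - g t) powr r) absolutely_integrable_on {a..b}"
  proof (rule absolutely_integrable_bound)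
    have "(\<lambda>t. norm (f t - g t)) \<in> borel_measurable (lebesgue_on {a<..<b})"
      by (rule strongly_measurable_imp_borel[OF _ strongly_measurable_continuous[OF sm]]) (auto intro!: continuous_intros)
    then show "(\<lambda>t. norm (f t - g t) powr r) \<in> borel_measurable (lebesgue_on {a<..<b})" by simp
    show "(\<lambda>t. 2 powr r * (norm (f t) powr r + norm (g t) powr r)) absolutely_integrable_on {a..b}"
      by (intro set_integrable_mult_right set_integral_add bochner_Lp_powr[OF f] bochner_Lp_powr[OF g])
    have "norm (f t - g t) powr r \<le> 2 powr r * (norm (f t) powr r + norm (g t) powr r)" for t
    proof -
      have "norm (f t - g t) powr r \<le> (norm (f t) + norm (g t)) powr r"
        using \<open>r > 0\<close> by (intro powr_mono2 norm_triangle_ineq4) auto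
      also have "\<dots> \<le> 2 powr r * (norm (f t) powr r + norm (g t) powr r)"
        by (rule powr_add_le) (use \<open>r > 0\<close> in auto)
      finally show ?thesis .
    qed
    then show "AE t in lebesgue_on {a<..<b}. \<bar>norm (f t - g t) powr r\<bar> \<le> 2 powr r * (norm (f t) powr r + norm (g t) powr r)"
      by simp
  qed
  then show ?thesis using sm by (simp add: bochner_Lp_def integrable_lebesgue_on_open_iff)
qed

lemma bochner_Lp_glue:
  assumes f: "bochner_Lp r a c f" and g: "bochner_Lp r c b g" and "a < c" "c < b"
  shows "bochner_Lp r a b (\<lambda>t. if t < c then f t else g t)"
proof -
  have "(\<lambda>t. norm (if t < c then f t else g t) powr r) absolutely_integrable_on {a..b}"
  proof -
    have "(\<lambda>t. norm (if t < c then f t else g t) powr r) absolutely_integrable_on {a..c}"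
      by (rule absolutely_integrable_spike[OF bochner_Lp_powr[OF f], of "{c}"]) auto
    moreover have "(\<lambda>t. norm (if t < c then f t else g t) powr r) absolutely_integrable_on {c..b}"
      by (rule absolutely_integrable_spike[OF bochner_Lp_powr[OF g], of "{c}"]) auto
    ultimately have "(\<lambda>t. norm (if t < c then f t else g t) powr r) absolutely_integrable_on ({a..c} \<union> {c..b})"
      by (rule absolutely_integrable_Un)
    moreover have "{a..c} \<union> {c..b} = {a..b}" using assms by auto
    ultimately show ?thesis by simp
  qed
  then show ?thesis
    using strongly_measurable_glue[OF bochner_Lp_strongly_measurable[OF f] bochner_Lp_strongly_measurable[OF g] assms(3,4)]
    by (simp add: bochner_Lp_def integrable_lebesgue_on_open_iff)
qed

text \<open>Fatou's lemma for upper bounds of the integrals that merely converge, as they arise from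
  the averages in the energy inequality.\<close>

lemma Fatou_real:
  fixes f :: "nat \<Rightarrow> 'a \<Rightarrow> real"
  assumes int: "\<And>n. integrable M (f n)" and nn: "\<And>n. AE x in M. 0 \<le> f n x"
    and lim: "AE x in M. (\<lambda>n. f n x) \<longlonglongrightarrow> g x" and g: "integrable M g"
    and bound: "\<And>n. integral\<^sup>L M (f n) \<le> c n" and c: "c \<longlonglongrightarrow> C"
  shows "integral\<^sup>L M g \<le> C"
proof -
  have nn': "AE x in M. \<forall>n. 0 \<le> f n x" using nn by (simp add: AE_all_countable)
  have g0: "AE x in M. 0 \<le> g x"
    using nn' lim by eventually_elim (auto intro: LIMSEQ_le_const)
  have c0: "0 \<le> c n" for n
    using integral_nonneg_AE[OF nn] bound[of n] by (meson order_trans)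
  have "ennreal (integral\<^sup>L M g) = (\<integral>\<^sup>+x. g x \<partial>M)"
    by (rule nn_integral_eq_integral[symmetric, OF g g0])
  also have "\<dots> = (\<integral>\<^sup>+x. liminf (\<lambda>n. ennreal (f n x)) \<partial>M)"
  proof (rule nn_integral_cong_AE)
    show "AE x in M. ennreal (g x) = liminf (\<lambda>n. ennreal (f n x))"
      using lim
    proof eventually_elim
      fix x assume "(\<lambda>n. f n x) \<longlonglongrightarrow> g x"
      then have "(\<lambda>n. ennreal (f n x)) \<longlonglongrightarrow> ennreal (g x)" by simp
      then show "ennreal (g x) = liminf (\<lambda>n. ennreal (f n x))"
        by (simp add: lim_imp_Liminf)
    qed
  qed
  also have "\<dots> \<le> liminf (\<lambda>n. \<integral>\<^sup>+x. ennreal (f n x) \<partial>M)"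
    by (rule nn_integral_liminf) (use int in auto)
  also have "\<dots> = liminf (\<lambda>n. ennreal (integral\<^sup>L M (f n)))"
    by (simp add: nn_integral_eq_integral[OF int nn])
  also have "\<dots> \<le> liminf (\<lambda>n. ennreal (c n))"
    by (intro Liminf_mono always_eventually allI ennreal_leI bound)
  also have "\<dots> = ennreal C"
    using c by (intro lim_imp_Liminf tendsto_ennrealI) auto
  finally show ?thesis
    using LIMSEQ_le_const[OF c] c0 by (auto simp: ennreal_le_iff)
qed

section \<open>Lebesgue points and averages of increments\<close>

text \<open>A reflection of the line turns the differentiation theorem for averages over \<open>[x,
  x + h]\<close> into one for averages over \<open>[r - h, r]\<close>.\<close>

lemma Lebesgue_differentiation_left:
  fixes k :: "real \<Rightarrow> real"
  assumes k: "k absolutely_integrable_on {a..b}"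
    and h: "\<And>n. h n > 0" "h \<longlonglongrightarrow> 0"
  shows "AE r in lebesgue_on {a<..<b}. (\<lambda>n. integral {r - h n..r} k / h n) \<longlonglongrightarrow> k r"
proof -
  define f where "f x = (if - x \<in> {a..b} then k (- x) else 0)" for x
  have k0: "(\<lambda>x. if x \<in> {a..b} then k x else 0) integrable_on UNIV"
    using abs_int_imp_int[OF k] by (simp only: integrable_restrict_UNIV)
  have refl: "f = (\<lambda>x. (\<lambda>x. if x \<in> {a..b} then k x else 0) (- x))" by (auto simp: f_def)
  have "f integrable_on {c..d}" for c d
  proof -
    have "(\<lambda>x. if x \<in> {a..b} then k x else 0) integrable_on {- d..- c}"
      by (rule integrable_on_subinterval[OF k0]) simp
    then show ?thesis
      unfolding refl using Henstock_Kurzweil_Integration.integrable_reflect_real[where f="\<lambda>x. if x \<in> {a..b} then k x else 0" and a="- d" and b="- c"]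
      by (simp only: minus_minus)
  qed
  then obtain N where N: "negligible N" "\<And>x e. x \<notin> N \<Longrightarrow> 0 < e \<Longrightarrow>
      \<exists>d>0. \<forall>h. 0 < h \<and> h < d \<longrightarrow> norm (integral (cbox x (x + h *\<^sub>R One)) f /\<^sub>R h ^ DIM(real) - f x) < e"
    using integrable_ccontinuous_explicit[of f] by (metis box_real(2))
  have "(\<lambda>n. integral {r - h n..r} k / h n) \<longlonglongrightarrow> k r" if r: "r \<in> {a<..<b}" "r \<notin> uminus ` N" for r
  proof (rule LIMSEQ_I)
    fix e :: real assume "e > 0"
    have "- r \<notin> N" using r(2) by force
    then obtain d where d: "d > 0" "\<And>h. 0 < h \<Longrightarrow> h < d \<Longrightarrow> norm (integral {- r..- r + h} f / h - f (- r)) < e"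
      using N(2)[OF _ \<open>e > 0\<close>, of "- r"] by (auto simp: divide_inverse mult.commute)
    obtain M where M: "\<And>n. n \<ge> M \<Longrightarrow> h n < min d (r - a)"
      using order_tendstoD(2)[OF h(2), of "min d (r - a)"] d(1) r(1) by (auto simp: eventually_sequentially)
    show "\<exists>no. \<forall>n\<ge>no. norm (integral {r - h n..r} k / h n - k r) < e"
    proof (intro exI[of _ M] allI impI)
      fix n assume "n \<ge> M"
      then have hn: "h n < d" "h n < r - a" using M by auto
      have e: "- r + h n = - (r - h n)" by simp
      have "integral {- r..- r + h n} f = integral {- r..- (r - h n)} (\<lambda>x. k (- x))"
        unfolding e
        by (rule Henstock_Kurzweil_Integration.integral_cong) (use hn r h(1)[of n] in \<open>auto simp: f_def\<close>)
      also have "\<dots> = integral {r - h n..r} k" by (rule Henstock_Kurzweil_Integration.integral_reflect_real)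
      finally show "norm (integral {r - h n..r} k / h n - k r) < e"
        using d(2)[of "h n"] h(1)[of n] hn r by (simp add: f_def)
    qed
  qed
  then have "AE r in lebesgue. r \<in> {a<..<b} \<longrightarrow> (\<lambda>n. integral {r - h n..r} k / h n) \<longlonglongrightarrow> k r"
  proof (intro AE_I'[of "uminus ` N"])
    have "negligible (uminus ` N)"
      by (rule negligible_differentiable_image_negligible[OF _ N(1)])
        (auto intro!: derivative_intros)
    then show "uminus ` N \<in> null_sets lebesgue" by (simp add: negligible_iff_null_sets)
  qed auto
  then show ?thesis by (simp add: AE_lebesgue_on_iff)
qed

lemma average_left_tendsto:
  fixes G :: "real \<Rightarrow> real"
  assumes G: "continuous_on {a..b} G" and t: "a < t" "t \<le> b"
    and h: "\<And>n. h n > 0" "\<And>n. h n \<le> t - a" "h \<longlonglongrightarrow> 0"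
  shows "(\<lambda>n. integral {t - h n..t} G / h n) \<longlonglongrightarrow> G t"
proof (rule LIMSEQ_I)
  fix e :: real assume "e > 0"
  obtain d where d: "d > 0" "\<And>r. r \<in> {a..b} \<Longrightarrow> \<bar>r - t\<bar> < d \<Longrightarrow> \<bar>G r - G t\<bar> < e / 2"
    using G[unfolded continuous_on_iff, rule_format, of t "e / 2"] \<open>e > 0\<close> t by (auto simp: dist_real_def)
  obtain M where M: "\<And>n. n \<ge> M \<Longrightarrow> h n < d"
    using order_tendstoD(2)[OF h(3), of d] d(1) by (auto simp: eventually_sequentially)
  show "\<exists>no. \<forall>n\<ge>no. norm (integral {t - h n..t} G / h n - G t) < e"
  proof (intro exI[of _ M] allI impI)
    fix n assume "n \<ge> M"
    then have hn: "h n < d" using M by auto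
    have Gi: "(G has_integral integral {t - h n..t} G) {t - h n..t}"
      by (intro integrable_integral integrable_continuous_interval continuous_on_subset[OF G])
        (use h(2)[of n] t in auto)
    have ci: "((\<lambda>_. c) has_integral h n * c) {t - h n..t}" for c :: real
      using has_integral_const_real[of c "t - h n" t] h(1)[of n] by simp
    have "norm (integral {t - h n..t} (\<lambda>r. G r - G t)) \<le> integral {t - h n..t} (\<lambda>_. e / 2)"
    proof (rule integral_norm_bound_integral)
      show "(\<lambda>r. G r - G t) integrable_on {t - h n..t}"
        using has_integral_diff[OF Gi ci[of "G t"]] by blast
      fix r assume "r \<in> {t - h n..t}"
      then show "norm (G r - G t) \<le> e / 2" using d(2)[of r] hn h(2)[of n] t by (auto intro!: less_imp_le)
    qed (use ci in blast)
    then have "\<bar>integral {t - h n..t} G - h n * G t\<bar> \<le> h n * (e / 2)"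
      using integral_unique[OF has_integral_diff[OF Gi ci[of "G t"]]] integral_unique[OF ci[of "e / 2"]] h(1)[of n] by simp
    then have "\<bar>integral {t - h n..t} G - h n * G t\<bar> / h n \<le> e / 2"
      using h(1)[of n] by (simp add: field_simps)
    moreover have "\<bar>integral {t - h n..t} G - h n * G t\<bar> / h n = \<bar>integral {t - h n..t} G / h n - G t\<bar>"
    proof -
      have "integral {t - h n..t} G / h n - G t = (integral {t - h n..t} G - h n * G t) / h n"
        using h(1)[of n] by (simp add: diff_divide_distrib)
      then show ?thesis using h(1)[of n] by (simp add: abs_divide)
    qed
    ultimately show "norm (integral {t - h n..t} G / h n - G t) < e" using \<open>e > 0\<close> by simp
  qed
qed

text \<open>By translation the integral equals the difference of the averages of \<open>G\<close>
  over \<open>[t - h, t]\<close> and \<open>[s - h, s]\<close>.\<close>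

lemma average_increment_tendsto:
  fixes G :: "real \<Rightarrow> real"
  assumes G: "continuous_on {a..b} G" and st: "a < s" "s \<le> t" "t \<le> b"
    and h: "\<And>n. h n > 0" "\<And>n. h n \<le> s - a" "h \<longlonglongrightarrow> 0"
  shows "(\<lambda>n. integral {s..t} (\<lambda>r. (G r - G (r - h n)) / h n)) \<longlonglongrightarrow> G t - G s"
proof -
  have eq: "integral {s..t} (\<lambda>r. (G r - G (r - h n)) / h n)
      = integral {t - h n..t} G / h n - integral {s - h n..s} G / h n" for n
  proof -
    have sub: "continuous_on {x..y} G" if "s - h n \<le> x" "y \<le> t" for x y
      by (rule continuous_on_subset[OF G]) (use that st h(2)[of n] in auto)
    have int: "G integrable_on {x..y}" if "s - h n \<le> x" "y \<le> t" for x y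
      by (intro integrable_continuous_interval sub that)
    have sh: "continuous_on {s..t} (\<lambda>r. G (r - h n))"
      by (rule continuous_on_compose2[OF sub[OF order_refl order_refl]])
        (use h(1)[of n] in \<open>auto intro!: continuous_intros\<close>)
    have "integral {s..t} (\<lambda>r. G (r - h n)) = integral {s - h n..t - h n} G"
      using integral_shift[of s "- h n" t G] sub[of "s - h n" "t - h n"] h(1)[of n] by (simp add: o_def less_imp_le)
    moreover have "integral {s - h n..t - h n} G + integral {t - h n..t} G = integral {s - h n..s} G + integral {s..t} G"
      using Henstock_Kurzweil_Integration.integral_combine[of "s - h n" "t - h n" t G]
        Henstock_Kurzweil_Integration.integral_combine[of "s - h n" s t G] int[of "s - h n" t] st h(1)[of n]
      by simp
    moreover have "integral {s..t} (\<lambda>r. G r - G (r - h n)) = integral {s..t} G - integral {s..t} (\<lambda>r. G (r - h n))"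
      by (intro Henstock_Kurzweil_Integration.integral_diff integrable_continuous_interval sh sub) (use h(1)[of n] in auto)
    ultimately have "integral {s..t} (\<lambda>r. G r - G (r - h n)) = integral {t - h n..t} G - integral {s - h n..s} G"
      by linarith
    moreover have "integral {s..t} (\<lambda>r. (G r - G (r - h n)) / h n) = integral {s..t} (\<lambda>r. G r - G (r - h n)) / h n"
      by simp
    ultimately show ?thesis by (simp add: diff_divide_distrib)
  qed
  show ?thesis unfolding eq
    by (intro tendsto_diff average_left_tendsto[OF G]) (use st h order_trans[OF h(2), of "t - a"] in auto)
qed

text \<open>The pair \<open>(\<xi>, w)\<close> is an element of \<open>W\<^sub>p\<^sub>q\<close>
  with its generalized derivative, and \<open>x\<close> is its continuous representative in
  \<open>H\<close>; see \<open>gen_deriv_iff_increments\<close>. In contrast to test functions,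
  increments are easily restricted, subtracted and concatenated.\<close>

definition integral_solution ::
    "('v::real_normed_vector \<Rightarrow>\<^sub>L 'h::real_inner) \<Rightarrow> real \<Rightarrow> real \<Rightarrow> real \<Rightarrow> real \<Rightarrow>
     (real \<Rightarrow> 'h) \<Rightarrow> (real \<Rightarrow> 'v) \<Rightarrow> (real \<Rightarrow> 'v \<Rightarrow>\<^sub>L real) \<Rightarrow> bool" where
  "integral_solution j p q a b x \<xi> w \<longleftrightarrow>
     continuous_on {a..b} x \<and> bochner_Lp p a b \<xi> \<and> bochner_Lp q a b w \<and>
     (AE t in lebesgue_on {a<..<b}. x t = j (\<xi> t)) \<and>
     (\<forall>v s t. a \<le> s \<longrightarrow> s \<le> t \<longrightarrow> t \<le> b \<longrightarrow>
        (x t - x s) \<bullet> j v = integral {s..t} (\<lambda>r. w r v))"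

lemma apply_absolutely_integrable:
  fixes w :: "real \<Rightarrow> 'v::real_normed_vector \<Rightarrow>\<^sub>L real"
  assumes w: "bochner_Lp q a b w" and "q \<ge> 1"
  shows "(\<lambda>r. w r v) absolutely_integrable_on {a..b}"
proof (rule absolutely_integrable_bound)
  show "(\<lambda>r. w r v) \<in> borel_measurable (lebesgue_on {a<..<b})"
    by (rule strongly_measurable_imp_borel[OF _ strongly_measurable_continuous[OF bochner_Lp_strongly_measurable[OF w]]])
      (auto intro!: continuous_intros)
  show "(\<lambda>r. norm (w r) * norm v) absolutely_integrable_on {a..b}"
    by (intro set_integrable_mult_left bochner_Lp_norm[OF w]) (use assms in auto)
  show "AE t in lebesgue_on {a<..<b}. \<bar>w t v\<bar> \<le> norm (w t) * norm v"
    by (intro always_eventually allI) (simp add: norm_blinfun flip: real_norm_def)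
qed

text \<open>Young's inequality gives the majorant.\<close>

lemma pairing_absolutely_integrable:
  fixes w :: "real \<Rightarrow> 'v::real_normed_vector \<Rightarrow>\<^sub>L real"
  assumes pq: "p > 1" "q > 1" "1 / p + 1 / q = 1"
    and \<xi>: "bochner_Lp p a b \<xi>" and w: "bochner_Lp q a b w"
  shows "(\<lambda>r. w r (\<xi> r)) absolutely_integrable_on {a..b}"
proof (rule absolutely_integrable_bound)
  have "continuous_on UNIV (\<lambda>z. blinfun_apply (fst z) (snd z :: 'v) :: real)"
    by (intro continuous_intros)
  from strongly_measurable_continuous[OF strongly_measurable_Pair[OF
      bochner_Lp_strongly_measurable[OF w] bochner_Lp_strongly_measurable[OF \<xi>]] this]
  show "(\<lambda>r. w r (\<xi> r)) \<in> borel_measurable (lebesgue_on {a<..<b})"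
    by (intro strongly_measurable_imp_borel) simp_all
  show "(\<lambda>r. norm (w r) powr q / q + norm (\<xi> r) powr p / p) absolutely_integrable_on {a..b}"
    by (intro set_integral_add set_integrable_divide bochner_Lp_powr[OF w] bochner_Lp_powr[OF \<xi>]) 
  have "\<bar>w r (\<xi> r)\<bar> \<le> norm (w r) powr q / q + norm (\<xi> r) powr p / p" for r
    using norm_blinfun[of "w r" "\<xi> r"] Youngs_inequality[of q p "norm (w r)" "norm (\<xi> r)"] pq by simp
  then show "AE r in lebesgue_on {a<..<b}. \<bar>w r (\<xi> r)\<bar> \<le> norm (w r) powr q / q + norm (\<xi> r) powr p / p"
    by simp
qed

section \<open>The energy inequality\<close>

text \<open>At almost every \<open>r\<close> the vector \<open>\<xi> r\<close> is a limit of values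
  of approximating simple functions. These values form a countable set \<open>D\<close>, so that
  almost every \<open>r\<close> is a Lebesgue point of \<open>w d\<close> for all \<open>d \<in>
  D\<close> at once. The passage from \<open>d\<close> to \<open>\<xi> r\<close> costs at most
  \<open>|d - \<xi> r|\<close> times averages of the norm of \<open>w\<close>, which stay bounded
  where \<open>r\<close> is a Lebesgue point of this norm.\<close>

lemma integral_solution_pairing_difference_quotient:
  fixes j :: "'v::real_normed_vector \<Rightarrow>\<^sub>L 'h::real_inner"
  assumes sol: "integral_solution j p q a b x \<xi> w" and q: "q \<ge> 1"
    and h: "\<And>n. h n > 0" "h \<longlonglongrightarrow> 0"
  shows "AE r in lebesgue_on {a<..<b}.
    (\<lambda>n. integral {r - h n..r} (\<lambda>\<sigma>. w \<sigma> (\<xi> r)) / h n) \<longlonglongrightarrow> w r (\<xi> r)"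
proof -
  have \<xi>: "bochner_Lp p a b \<xi>" and w: "bochner_Lp q a b w"
    using sol by (auto simp: integral_solution_def)
  obtain S where S: "\<And>n::nat. simple_function (lebesgue_on {a<..<b}) (S n)"
    "AE r in lebesgue_on {a<..<b}. (\<lambda>n. S n r) \<longlonglongrightarrow> \<xi> r"
    using bochner_Lp_strongly_measurable[OF \<xi>] unfolding strongly_measurable_def by blast
  define D where "D = (\<Union>n. S n ` {a<..<b})"
  have cD: "countable D"
    unfolding D_def using S(1) by (intro countable_UN countableI_type countable_finite) (simp add: simple_function_def)
  have wv: "(\<lambda>r. w r v) absolutely_integrable_on {a..b}" for v
    by (rule apply_absolutely_integrable[OF w q])
  have wn: "(\<lambda>r. norm (w r)) absolutely_integrable_on {a..b}" by (rule bochner_Lp_norm[OF w q])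
  have "AE r in lebesgue_on {a<..<b}. \<forall>d\<in>D.
      (\<lambda>n. integral {r - h n..r} (\<lambda>\<sigma>. w \<sigma> d) / h n) \<longlonglongrightarrow> w r d"
    unfolding AE_ball_countable[OF cD] using Lebesgue_differentiation_left[OF wv h] by blast
  moreover have "AE r in lebesgue_on {a<..<b}.
      (\<lambda>n. integral {r - h n..r} (\<lambda>\<sigma>. norm (w \<sigma>)) / h n) \<longlonglongrightarrow> norm (w r)"
    by (rule Lebesgue_differentiation_left[OF wn h])
  moreover have "AE r in lebesgue_on {a<..<b}. r \<in> {a<..<b}" using AE_space[of "lebesgue_on {a<..<b}"] by simp
  ultimately show ?thesis using S(2)
  proof eventually_elim
    case (elim r)
    define I where "I v n = integral {r - h n..r} (\<lambda>\<sigma>. w \<sigma> v) / h n" for v n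
    define \<omega> where "\<omega> n = integral {r - h n..r} (\<lambda>\<sigma>. norm (w \<sigma>)) / h n" for n
    have I: "I d \<longlonglongrightarrow> w r d" if "d \<in> D" for d using elim(1) that by (simp add: I_def[abs_def])
    have \<omega>: "\<omega> \<longlonglongrightarrow> norm (w r)" using elim(2) by (simp add: \<omega>_def[abs_def])
    have ev: "\<forall>\<^sub>F n in sequentially. h n < r - a"
      using order_tendstoD(2)[OF h(2), of "r - a"] elim(3) by simp
    show ?case
    proof (rule LIMSEQ_I)
      fix e :: real assume "e > 0"
      define C where "C = 2 * norm (w r) + 1"
      have "C > 0" by (simp add: C_def add_nonneg_pos)
      have "\<forall>\<^sub>F m in sequentially. norm (S m r - \<xi> r) < e / (2 * C)"
        using tendsto_diff[OF elim(4) tendsto_const[of "\<xi> r"]] \<open>e > 0\<close> \<open>C > 0\<close>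
        by (intro order_tendstoD(2)[of _ 0]) (auto intro: tendsto_norm_zero)
      then obtain m where m: "norm (S m r - \<xi> r) < e / (2 * C)" by (auto simp: eventually_sequentially)
      define d where "d = S m r"
      have d: "d \<in> D" using elim(3) unfolding D_def d_def by (intro UN_I[of m] imageI) auto
      have dn: "norm (d - \<xi> r) * C < e / 2" using m \<open>C > 0\<close> by (simp add: d_def field_simps)
      have "\<forall>\<^sub>F n in sequentially. norm (I d n - w r d) < e / 2"
        using tendstoD[OF I[OF d], of "e / 2"] \<open>e > 0\<close> by (simp add: dist_norm)
      moreover have "\<forall>\<^sub>F n in sequentially. \<omega> n < norm (w r) + 1"
        using order_tendstoD(2)[OF \<omega>] by simp
      ultimately have "\<forall>\<^sub>F n in sequentially. norm (I (\<xi> r) n - w r (\<xi> r)) < e"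
        using ev
      proof eventually_elim
        case (elim n)
        have sub: "f absolutely_integrable_on {r - h n..r}" if "f absolutely_integrable_on {a..b}" for f :: "real \<Rightarrow> real"
          by (rule absolutely_integrable_sub[OF that]) (use elim \<open>r \<in> {a<..<b}\<close> in auto)
        note i = abs_int_imp_int[OF sub]
        have "I (\<xi> r) n - I d n = I (\<xi> r - d) n"
          unfolding I_def using Henstock_Kurzweil_Integration.integral_diff[OF i[OF wv] i[OF wv], of "\<xi> r" d]
          by (simp add: blinfun.diff_right diff_divide_distrib)
        moreover have "\<bar>I (\<xi> r - d) n\<bar> \<le> \<omega> n * norm (d - \<xi> r)"
        proof -
          have "norm (integral {r - h n..r} (\<lambda>\<sigma>. w \<sigma> (\<xi> r - d)))
              \<le> integral {r - h n..r} (\<lambda>\<sigma>. norm (w \<sigma>) * norm (d - \<xi> r))"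
          proof (rule integral_norm_bound_integral[OF i[OF wv]])
            show "(\<lambda>\<sigma>. norm (w \<sigma>) * norm (d - \<xi> r)) integrable_on {r - h n..r}"
              by (rule i[OF set_integrable_mult_left[OF wn]])
            show "norm (w \<sigma> (\<xi> r - d)) \<le> norm (w \<sigma>) * norm (d - \<xi> r)" for \<sigma>
              by (subst norm_minus_commute[of d]) (rule norm_blinfun)
          qed
          then have "\<bar>integral {r - h n..r} (\<lambda>\<sigma>. w \<sigma> (\<xi> r - d))\<bar> / h n
              \<le> integral {r - h n..r} (\<lambda>\<sigma>. norm (w \<sigma>)) * norm (d - \<xi> r) / h n"
            using h(1)[of n] by (intro divide_right_mono) auto
          then show ?thesis using h(1)[of n] by (simp add: I_def \<omega>_def)
        qed
        moreover have "\<bar>w r (d - \<xi> r)\<bar> \<le> norm (w r) * norm (d - \<xi> r)"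
          using norm_blinfun[of "w r" "d - \<xi> r"] by simp
        moreover have "\<omega> n * norm (d - \<xi> r) \<le> (norm (w r) + 1) * norm (d - \<xi> r)"
          using elim by (intro mult_right_mono) auto
        moreover have "(norm (w r) + 1) * norm (d - \<xi> r) + norm (w r) * norm (d - \<xi> r) = norm (d - \<xi> r) * C"
          by (simp add: C_def algebra_simps)
        moreover have "w r (d - \<xi> r) = w r d - w r (\<xi> r)"
          by (rule blinfun.diff_right)
        ultimately show ?case using dn elim(1) by (simp only: real_norm_def)
      qed
      then show "\<exists>no. \<forall>n\<ge>no. norm (integral {r - h n..r} (\<lambda>\<sigma>. w \<sigma> (\<xi> r)) / h n
          - w r (\<xi> r)) < e"
        by (simp add: eventually_sequentially I_def)
    qed
  qed
qed

text \<open>Since \<open>|b|\<^sup>2 - |a|\<^sup>2 \<le> 2 (b - a, b)\<close>, the averaged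
  increment of \<open>|x|\<^sup>2\<close> over a time \<open>h\<close> is at most twice the integral
  of the continuous function \<open>g r = (x r - x (r - h), x r) / h\<close>. For almost every
  \<open>r\<close> this is the average over \<open>[r - h, r]\<close> of \<open>\<sigma> \<mapsto>
  w(\<sigma>)(\<xi> r)\<close>, which tends to \<open>w(r)(\<xi> r)\<close> and which Young's
  inequality bounds by an average of \<open>|w|\<^sup>q / q\<close> plus \<open>|\<xi> r|\<^sup>p /
  p\<close>. The integrals of these bounds converge, so Fatou's lemma for the nonnegative gaps
  yields the claim. The start \<open>s > a\<close> leaves room for the shift by
  \<open>h\<close>.\<close>

lemma energy_inequality_interior:
  fixes j :: "'v::real_normed_vector \<Rightarrow>\<^sub>L 'h::real_inner"
  assumes pq: "p > 1" "q > 1" "1 / p + 1 / q = 1"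
    and sol: "integral_solution j p q a b x \<xi> w" and st: "a < s" "s \<le> t" "t \<le> b"
  shows "(norm (x t))\<^sup>2 - (norm (x s))\<^sup>2 \<le> 2 * integral {s..t} (\<lambda>r. w r (\<xi> r))"
proof -
  have x: "continuous_on {a..b} x" and \<xi>: "bochner_Lp p a b \<xi>" and w: "bochner_Lp q a b w"
    and eq: "AE t in lebesgue_on {a<..<b}. x t = j (\<xi> t)"
    and incr: "\<And>v s t. a \<le> s \<Longrightarrow> s \<le> t \<Longrightarrow> t \<le> b \<Longrightarrow> (x t - x s) \<bullet> j v = integral {s..t} (\<lambda>r. w r v)"
    using sol by (auto simp: integral_solution_def)
  define h where "h n = (s - a) / real (n + 1)" for n
  have h0: "h n > 0" for n using st by (simp add: h_def)
  have hs: "h n \<le> s - a" for n using st by (simp add: h_def divide_le_eq mult_le_cancel_left1)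
  have hlim: "h \<longlonglongrightarrow> 0"
    using LIMSEQ_ignore_initial_segment[OF lim_const_over_n[of "s - a"], of 1] by (simp add: h_def[abs_def])
  note h = h0 hs hlim
  define W where "W r = norm (w r) powr q" for r
  define X where "X r = norm (\<xi> r) powr p" for r
  have W: "W absolutely_integrable_on {a..b}" unfolding W_def by (rule bochner_Lp_powr[OF w])
  have X: "X absolutely_integrable_on {a..b}" unfolding X_def by (rule bochner_Lp_powr[OF \<xi>])
  define \<Gamma> where "\<Gamma> r = integral {a..r} W" for r
  have c\<Gamma>: "continuous_on {a..b} \<Gamma>" unfolding \<Gamma>_def
    by (rule indefinite_integral_continuous_1[OF abs_int_imp_int[OF W]])
  have \<Gamma>diff: "\<Gamma> r - \<Gamma> r' = integral {r'..r} W" if "a \<le> r'" "r' \<le> r" "r \<le> b" for r r'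
    unfolding \<Gamma>_def by (rule integral_diff_indefinite[OF W that])
  define g where "g n r = (x r - x (r - h n)) \<bullet> x r / h n" for n r
  define \<gamma> where "\<gamma> n r = (\<Gamma> r - \<Gamma> (r - h n)) / h n" for n r
  \<comment> \<open>the gap in Young's inequality, nonnegative almost everywhere, and its limit\<close>
  define gap where "gap n r = \<gamma> n r / q + X r / p - g n r" for n r
  define lim where "lim r = W r / q + X r / p - w r (\<xi> r)" for r
  have shifted: "continuous_on {s..t} (\<lambda>r. f (r - h n))" if "continuous_on {a..b} f" for f :: "real \<Rightarrow> 'c::topological_space" and n
    by (rule continuous_on_compose2[OF that]) (use st hs[of n] h0[of n] in \<open>auto intro!: continuous_intros\<close>)
  have unshifted: "continuous_on {s..t} f" if "continuous_on {a..b} f" for f :: "real \<Rightarrow> 'c::topological_space"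
    by (rule continuous_on_subset[OF that]) (use st in auto)
  have cg: "continuous_on {s..t} (g n)" for n unfolding g_def
    by (intro continuous_intros shifted unshifted x) (use h0[of n] in auto)
  have c\<gamma>: "continuous_on {s..t} (\<gamma> n)" for n unfolding \<gamma>_def
    by (intro continuous_intros shifted unshifted c\<Gamma>) (use h0[of n] in auto)
  have Xst: "X absolutely_integrable_on {s..t}" and Wst: "W absolutely_integrable_on {s..t}"
    by (rule absolutely_integrable_sub[OF X] absolutely_integrable_sub[OF W]; use st in auto)+
  have pst: "(\<lambda>r. w r (\<xi> r)) absolutely_integrable_on {s..t}"
    by (rule absolutely_integrable_sub[OF pairing_absolutely_integrable[OF pq \<xi> w]]) (use st in auto)
  have gap_int: "gap n absolutely_integrable_on {s..t}" for n unfolding gap_def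
    by (intro set_integral_add set_integral_diff set_integrable_divide absolutely_integrable_continuous_real c\<gamma> cg Xst)
  have lim_int: "lim absolutely_integrable_on {s..t}" unfolding lim_def
    by (intro set_integral_add set_integral_diff set_integrable_divide Wst Xst pst)
  have AEst: "AE r in lebesgue_on {s<..<t}. P r" if "AE r in lebesgue_on {a<..<b}. P r" for P
    by (rule AE_subinterval[OF that]) (use st in auto)
  have space: "AE r in lebesgue_on {s<..<t}. r \<in> {s<..<t}" using AE_space[of "lebesgue_on {s<..<t}"] by simp
  have geq: "AE r in lebesgue_on {s<..<t}. \<forall>n. g n r = integral {r - h n..r} (\<lambda>\<sigma>. w \<sigma> (\<xi> r)) / h n"
    using AEst[OF eq] space
  proof eventually_elim
    case (elim r)
    show ?case
    proof
      fix n
      have "(x r - x (r - h n)) \<bullet> j (\<xi> r) = integral {r - h n..r} (\<lambda>\<sigma>. w \<sigma> (\<xi> r))"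
        by (rule incr) (use elim(2) st hs[of n] h0[of n] in auto)
      then show "g n r = integral {r - h n..r} (\<lambda>\<sigma>. w \<sigma> (\<xi> r)) / h n"
        using elim(1) by (simp add: g_def)
    qed
  qed
  have lim0: "integral\<^sup>L (lebesgue_on {s<..<t}) lim \<le>
      (\<Gamma> t - \<Gamma> s) / q + integral {s..t} X / p - ((norm (x t))\<^sup>2 - (norm (x s))\<^sup>2) / 2"
  proof (rule Fatou_real)
    show "integrable (lebesgue_on {s<..<t}) (gap n)" for n
      using gap_int by (simp add: integrable_lebesgue_on_open_iff)
    show "integrable (lebesgue_on {s<..<t}) lim"
      using lim_int by (simp add: integrable_lebesgue_on_open_iff)
    show "AE r in lebesgue_on {s<..<t}. 0 \<le> gap n r" for n
      using geq space
    proof eventually_elim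
      case (elim r)
      have r: "a \<le> r - h n" "r - h n \<le> r" "r \<le> b" using elim(2) st hs[of n] h0[of n] by auto
      have i1: "(\<lambda>\<sigma>. w \<sigma> (\<xi> r)) integrable_on {r - h n..r}"
        by (rule abs_int_imp_int[OF absolutely_integrable_sub[OF apply_absolutely_integrable[OF w]]])
          (use r pq in auto)
      have i2: "((\<lambda>\<sigma>. W \<sigma> / q + X r / p) has_integral integral {r - h n..r} W / q + h n * (X r / p)) {r - h n..r}"
        using has_integral_add[OF has_integral_divide[OF integrable_integral[OF
            abs_int_imp_int[OF absolutely_integrable_sub[OF W r(1,3)]]], of q]
            has_integral_const_real[of "X r / p" "r - h n" r]] h0[of n] by simp
      have "integral {r - h n..r} (\<lambda>\<sigma>. w \<sigma> (\<xi> r)) \<le> integral {r - h n..r} (\<lambda>\<sigma>. W \<sigma> / q + X r / p)"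
      proof (rule integral_le[OF i1])
        show "(\<lambda>\<sigma>. W \<sigma> / q + X r / p) integrable_on {r - h n..r}" using i2 by blast
        fix \<sigma>
        show "w \<sigma> (\<xi> r) \<le> W \<sigma> / q + X r / p"
          using norm_blinfun[of "w \<sigma>" "\<xi> r"] Youngs_inequality[of q p "norm (w \<sigma>)" "norm (\<xi> r)"] pq
          by (simp add: W_def X_def)
      qed
      then have "integral {r - h n..r} (\<lambda>\<sigma>. w \<sigma> (\<xi> r)) \<le> (\<Gamma> r - \<Gamma> (r - h n)) / q + h n * (X r / p)"
        using integral_unique[OF i2] \<Gamma>diff[OF r] by simp
      then have "integral {r - h n..r} (\<lambda>\<sigma>. w \<sigma> (\<xi> r)) / h n \<le> ((\<Gamma> r - \<Gamma> (r - h n)) / q + h n * (X r / p)) / h n"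
        using h0[of n] by (intro divide_right_mono) auto
      also have "\<dots> = \<gamma> n r / q + X r / p" using h0[of n]
        by (simp add: \<gamma>_def add_divide_distrib mult.commute)
      finally show ?case using elim(1) by (simp add: gap_def)
    qed
    show "AE r in lebesgue_on {s<..<t}. (\<lambda>n. gap n r) \<longlonglongrightarrow> lim r"
      using geq AEst[OF integral_solution_pairing_difference_quotient[OF sol less_imp_le[OF pq(2)] h0 hlim]]
        AEst[OF Lebesgue_differentiation_left[OF W h0 hlim]] space
    proof eventually_elim
      case (elim r)
      have "\<gamma> n r = integral {r - h n..r} W / h n" for n
        unfolding \<gamma>_def by (subst \<Gamma>diff) (use elim(4) st hs[of n] h0[of n] in auto)
      then have "(\<lambda>n. \<gamma> n r) \<longlonglongrightarrow> W r" using elim(3) by simp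
      moreover have "(\<lambda>n. g n r) \<longlonglongrightarrow> w r (\<xi> r)" using elim(1,2) by simp
      ultimately show ?case unfolding gap_def lim_def using pq by (intro tendsto_intros) auto
    qed
    show "integral\<^sup>L (lebesgue_on {s<..<t}) (gap n) \<le>
        integral {s..t} (\<gamma> n) / q + integral {s..t} X / p
          - integral {s..t} (\<lambda>r. ((norm (x r))\<^sup>2 - (norm (x (r - h n)))\<^sup>2) / h n) / 2" for n
    proof -
      have cx: "continuous_on {s..t} (\<lambda>r. ((norm (x r))\<^sup>2 - (norm (x (r - h n)))\<^sup>2) / h n)"
        by (intro continuous_intros shifted unshifted x) (use h0[of n] in auto)
      have "integral {s..t} (\<lambda>r. ((norm (x r))\<^sup>2 - (norm (x (r - h n)))\<^sup>2) / h n / 2) \<le> integral {s..t} (g n)"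
      proof (rule integral_le)
        fix r
        have "(norm (x r))\<^sup>2 - (norm (x (r - h n)))\<^sup>2 = 2 * ((x r - x (r - h n)) \<bullet> x r) - (norm (x r - x (r - h n)))\<^sup>2"
          unfolding power2_norm_eq_inner by (simp add: inner_diff_left inner_diff_right inner_commute)
        then have "((norm (x r))\<^sup>2 - (norm (x (r - h n)))\<^sup>2) / 2 \<le> (x r - x (r - h n)) \<bullet> x r" by simp
        then have "((norm (x r))\<^sup>2 - (norm (x (r - h n)))\<^sup>2) / 2 / h n \<le> g n r"
          unfolding g_def using h0[of n] by (intro divide_right_mono) auto
        then show "((norm (x r))\<^sup>2 - (norm (x (r - h n)))\<^sup>2) / h n / 2 \<le> g n r" by (simp add: mult.commute)
      qed (intro integrable_continuous_interval continuous_intros cx cg; simp)+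
      moreover have "integral {s..t} (gap n) = integral {s..t} (\<gamma> n) / q + integral {s..t} X / p - integral {s..t} (g n)"
      proof -
        have "((\<lambda>r. \<gamma> n r / q + X r / p - g n r) has_integral
            integral {s..t} (\<gamma> n) / q + integral {s..t} X / p - integral {s..t} (g n)) {s..t}"
          by (intro has_integral_diff has_integral_add has_integral_divide integrable_integral
              integrable_continuous_interval c\<gamma> cg abs_int_imp_int[OF Xst])
        then show ?thesis unfolding gap_def by (rule integral_unique)
      qed
      ultimately show ?thesis by (simp add: integral_lebesgue_on_open[OF gap_int])
    qed
    show "(\<lambda>n. integral {s..t} (\<gamma> n) / q + integral {s..t} X / p
          - integral {s..t} (\<lambda>r. ((norm (x r))\<^sup>2 - (norm (x (r - h n)))\<^sup>2) / h n) / 2)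
        \<longlonglongrightarrow> (\<Gamma> t - \<Gamma> s) / q + integral {s..t} X / p - ((norm (x t))\<^sup>2 - (norm (x s))\<^sup>2) / 2"
      unfolding \<gamma>_def
      by (intro tendsto_diff tendsto_add tendsto_divide tendsto_const average_increment_tendsto[OF c\<Gamma> st h]
          average_increment_tendsto[of a b "\<lambda>r. (norm (x r))\<^sup>2", OF _ st h] continuous_intros x)
        (use pq in auto)
  qed
  have "integral {s..t} lim = integral {s..t} W / q + integral {s..t} X / p - integral {s..t} (\<lambda>r. w r (\<xi> r))"
  proof -
    have "((\<lambda>r. W r / q + X r / p - w r (\<xi> r)) has_integral
        integral {s..t} W / q + integral {s..t} X / p - integral {s..t} (\<lambda>r. w r (\<xi> r))) {s..t}"
      by (intro has_integral_diff has_integral_add has_integral_divide integrable_integral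
          abs_int_imp_int[OF Xst] abs_int_imp_int[OF Wst]
          abs_int_imp_int[OF pst])
    then show ?thesis unfolding lim_def by (rule integral_unique)
  qed
  then show ?thesis
    using lim0 \<Gamma>diff[of s t] st by (simp add: integral_lebesgue_on_open[OF lim_int])
qed

lemma energy_inequality:
  fixes j :: "'v::real_normed_vector \<Rightarrow>\<^sub>L 'h::real_inner"
  assumes pq: "p > 1" "q > 1" "1 / p + 1 / q = 1"
    and sol: "integral_solution j p q a b x \<xi> w" and st: "a \<le> s" "s \<le> t" "t \<le> b"
  shows "(norm (x t))\<^sup>2 - (norm (x s))\<^sup>2 \<le> 2 * integral {s..t} (\<lambda>r. w r (\<xi> r))"
proof (cases "a < t")
  case False
  with st have "s = t" by simp
  then show ?thesis by simp
next
  case True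
  have x: "continuous_on {a..b} x" and \<xi>: "bochner_Lp p a b \<xi>" and w: "bochner_Lp q a b w"
    using sol by (auto simp: integral_solution_def)
  define k where "k r = w r (\<xi> r)" for r
  have k: "k absolutely_integrable_on {a..b}"
    unfolding k_def by (rule pairing_absolutely_integrable[OF pq \<xi> w])
  define E where "E s = (norm (x t))\<^sup>2 - (norm (x s))\<^sup>2 - 2 * (integral {a..t} k - integral {a..s} k)" for s
  have cE: "continuous_on {a..t} E" unfolding E_def
    by (intro continuous_intros indefinite_integral_continuous_1 continuous_on_subset[OF x]
        abs_int_imp_int[OF absolutely_integrable_sub[OF k]]) (use st in auto)
  have "E s \<le> 0"
  proof (rule continuous_le_on_closure[of "{a<..t}" E s 0])
    have "closure {a<..t} = {a..t}" using True by simp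
    then show "continuous_on (closure {a<..t}) E" "s \<in> closure {a<..t}" using cE st by auto
    fix r assume "r \<in> {a<..t}"
    then show "E r \<le> 0"
      using energy_inequality_interior[OF pq sol, of r t] integral_diff_indefinite[OF k, of r t] st
      by (simp add: E_def k_def[abs_def])
  qed
  then show ?thesis using integral_diff_indefinite[OF k, of s t] st by (simp add: E_def k_def[abs_def])
qed

section \<open>Generalized derivatives, increments and concatenation of trajectories\<close>

lemma test_fun_deriv:
  assumes "test_fun a b \<phi>"
  shows "(\<phi> has_real_derivative deriv \<phi> x) (at x)" "continuous_on S \<phi>" "continuous_on S (deriv \<phi>)"
    and "\<phi> a = 0" "\<phi> b = 0"
proof -
  have d: "(deriv ^^ n) \<phi> differentiable_on UNIV" for n
    using assms by (auto simp: test_fun_def)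
  from d[of 0] show "(\<phi> has_real_derivative deriv \<phi> x) (at x)"
    by (simp add: differentiable_on_def DERIV_deriv_iff_real_differentiable)
  show "continuous_on S \<phi>" "continuous_on S (deriv \<phi>)"
    using differentiable_imp_continuous_on[OF d[of 0]] differentiable_imp_continuous_on[OF d[of 1]]
    by (auto intro: continuous_on_subset)
  obtain c d where "a < c" "c \<le> d" "d < b" "\<And>t. t \<notin> {c..d} \<Longrightarrow> \<phi> t = 0"
    using assms unfolding test_fun_def by blast
  then show "\<phi> a = 0" "\<phi> b = 0" by auto
qed

text \<open>One direction is the lemma of du Bois-Reymond for \<open>t \<mapsto> (x t, j v)\<close>,
  the other one is integration by parts against test functions, which vanish at both end
  points.\<close>

lemma gen_deriv_iff_increments:
  fixes j :: "'v::real_normed_vector \<Rightarrow>\<^sub>L 'h::real_inner"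
  assumes ab: "a < b" and x: "continuous_on {a..b} x" and \<xi>: "bochner_Lp p a b \<xi>"
    and w: "bochner_Lp q a b w" and q: "q \<ge> 1" and eq: "AE t in lebesgue_on {a<..<b}. x t = j (\<xi> t)"
  shows "gen_deriv j a b \<xi> w \<longleftrightarrow> (\<forall>v s t. a \<le> s \<longrightarrow> s \<le> t \<longrightarrow> t \<le> b \<longrightarrow>
        (x t - x s) \<bullet> j v = integral {s..t} (\<lambda>r. w r v))"
proof -
  have wv: "(\<lambda>r. w r v) absolutely_integrable_on {a..b}" for v
    by (rule apply_absolutely_integrable[OF w q])
  have g: "continuous_on {a..b} (\<lambda>t. x t \<bullet> j v)" for v by (intro continuous_intros x)
  have lhs: "(LINT t|lebesgue_on {a<..<b}. deriv \<phi> t * blinfun_apply (dual_embed j (j (\<xi> t))) v)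
      = integral {a..b} (\<lambda>t. deriv \<phi> t * (x t \<bullet> j v))" if "test_fun a b \<phi>" for \<phi> v
  proof -
    have c: "continuous_on {a..b} (\<lambda>t. deriv \<phi> t * (x t \<bullet> j v))"
      by (intro continuous_intros g test_fun_deriv(3)[OF that])
    then have i: "(\<lambda>t. deriv \<phi> t * (x t \<bullet> j v)) absolutely_integrable_on {a..b}"
      by (rule absolutely_integrable_continuous_real)
    have "(LINT t|lebesgue_on {a<..<b}. deriv \<phi> t * blinfun_apply (dual_embed j (j (\<xi> t))) v)
      = (LINT t|lebesgue_on {a<..<b}. deriv \<phi> t * (x t \<bullet> j v))"
    proof (rule integral_cong_AE)
      have m1: "deriv \<phi> \<in> borel_measurable (lebesgue_on {a<..<b})"
        by (rule continuous_imp_measurable_on_sets_lebesgue) (auto intro!: test_fun_deriv(3)[OF that])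
      have "(\<lambda>t. blinfun_apply (dual_embed j (j (\<xi> t))) v) \<in> borel_measurable (lebesgue_on {a<..<b})"
      proof -
        have "continuous_on UNIV (\<lambda>y. blinfun_apply (dual_embed j (j y)) v)"
          unfolding dual_embed_def by (simp, intro continuous_intros)
        from strongly_measurable_imp_borel[OF _ strongly_measurable_continuous[OF bochner_Lp_strongly_measurable[OF \<xi>] this]]
        show ?thesis by simp
      qed
      with m1 show "(\<lambda>t. deriv \<phi> t * blinfun_apply (dual_embed j (j (\<xi> t))) v) \<in> borel_measurable (lebesgue_on {a<..<b})"
        by (intro borel_measurable_times)
      show "(\<lambda>t. deriv \<phi> t * (x t \<bullet> j v)) \<in> borel_measurable (lebesgue_on {a<..<b})"
        using i by (auto simp flip: integrable_lebesgue_on_open_iff)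
      show "AE t in lebesgue_on {a<..<b}. deriv \<phi> t * blinfun_apply (dual_embed j (j (\<xi> t))) v = deriv \<phi> t * (x t \<bullet> j v)"
        using eq by eventually_elim (simp add: dual_embed_def inner_commute)
    qed
    then show ?thesis by (simp add: integral_lebesgue_on_open[OF i])
  qed
  have rhs: "(LINT t|lebesgue_on {a<..<b}. \<phi> t * w t v)
      = integral {a..b} (\<lambda>t. \<phi> t * w t v)" if "test_fun a b \<phi>" for \<phi> v
    by (rule integral_lebesgue_on_open[OF absolutely_integrable_continuous_mult[OF test_fun_deriv(2)[OF that] wv]])
  show ?thesis
  proof
    assume gd: "gen_deriv j a b \<xi> w"
    show "\<forall>v s t. a \<le> s \<longrightarrow> s \<le> t \<longrightarrow> t \<le> b \<longrightarrow>
        (x t - x s) \<bullet> j v = integral {s..t} (\<lambda>r. w r v)"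
    proof (intro allI impI)
      fix v s t assume st: "a \<le> s" "s \<le> t" "t \<le> b"
      have "x t \<bullet> j v - x s \<bullet> j v = integral {s..t} (\<lambda>r. w r v)"
      proof (rule du_Bois_Reymond[OF ab g wv _ st])
        fix \<phi> assume "test_fun a b \<phi>"
        then show "integral {a..b} (\<lambda>t. deriv \<phi> t * (x t \<bullet> j v)) = - integral {a..b} (\<lambda>t. \<phi> t * w t v)"
          using gd lhs[of \<phi> v] rhs[of \<phi> v] by (simp add: gen_deriv_def)
      qed
      then show "(x t - x s) \<bullet> j v = integral {s..t} (\<lambda>r. w r v)" by (simp add: inner_diff_left)
    qed
  next
    assume incr: "\<forall>v s t. a \<le> s \<longrightarrow> s \<le> t \<longrightarrow> t \<le> b \<longrightarrow>
        (x t - x s) \<bullet> j v = integral {s..t} (\<lambda>r. w r v)"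
    show "gen_deriv j a b \<xi> w" unfolding gen_deriv_def
    proof (intro allI impI)
      fix \<phi> v assume \<phi>: "test_fun a b \<phi>"
      have "integral {a..b} (\<lambda>t. deriv \<phi> t * (x t \<bullet> j v)) + integral {a..b} (\<lambda>t. \<phi> t * w t v)
          = \<phi> b * (x b \<bullet> j v) - \<phi> a * (x a \<bullet> j v)"
        by (rule integral_by_parts_indefinite[OF less_imp_le[OF ab] wv test_fun_deriv(1)[OF \<phi>] test_fun_deriv(3)[OF \<phi>] g])
          (use incr in \<open>simp add: inner_diff_left\<close>)
      then show "(LINT t|lebesgue_on {a<..<b}. deriv \<phi> t * blinfun_apply (dual_embed j (j (\<xi> t))) v)
          = - (LINT t|lebesgue_on {a<..<b}. \<phi> t * w t v)"
        using test_fun_deriv(4,5)[OF \<phi>] lhs[OF \<phi>, of v] rhs[OF \<phi>, of v] by simp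
    qed
  qed
qed

lemma strongly_measurable_restrict:
  fixes f :: "real \<Rightarrow> 'b::real_normed_vector"
  assumes f: "strongly_measurable (lebesgue_on {a<..<b}) f" and "a \<le> s" "t \<le> b"
  shows "strongly_measurable (lebesgue_on {s<..<t}) f"
proof -
  obtain S where S: "\<And>n::nat. simple_function (lebesgue_on {a<..<b}) (S n)"
    "AE x in lebesgue_on {a<..<b}. (\<lambda>n. S n x) \<longlonglongrightarrow> f x"
    using f unfolding strongly_measurable_def by blast
  have sub: "{s<..<t} \<subseteq> {a<..<b}" using assms by auto
  have "simple_function (lebesgue_on {s<..<t}) (S n)" for n
    unfolding simple_function_def
  proof (intro conjI ballI)
    show "finite (S n ` space (lebesgue_on {s<..<t}))"
      using S(1)[of n] sub by (auto simp: simple_function_def intro: finite_subset[OF image_mono])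
    fix y assume "y \<in> S n ` space (lebesgue_on {s<..<t})"
    then have "S n -` {y} \<inter> {a<..<b} \<in> sets (lebesgue_on {a<..<b})"
      using S(1)[of n] sub by (auto simp: simple_function_def)
    then have "S n -` {y} \<inter> {a<..<b} \<in> sets lebesgue"
      by (simp add: sets_restrict_space_iff)
    then have "(S n -` {y} \<inter> {a<..<b}) \<inter> {s<..<t} \<in> sets lebesgue"
      by (rule sets.Int) simp
    also have "(S n -` {y} \<inter> {a<..<b}) \<inter> {s<..<t} = S n -` {y} \<inter> {s<..<t}" using sub by auto
    finally show "S n -` {y} \<inter> space (lebesgue_on {s<..<t}) \<in> sets (lebesgue_on {s<..<t})"
      by (simp add: sets_restrict_space_iff)
  qed
  then show ?thesis using AE_subinterval[OF S(2) assms(2,3)] unfolding strongly_measurable_def by blast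
qed

lemma bochner_Lp_restrict:
  fixes f :: "real \<Rightarrow> 'b::real_normed_vector"
  assumes f: "bochner_Lp r a b f" and st: "a \<le> s" "t \<le> b"
  shows "bochner_Lp r s t f"
  using strongly_measurable_restrict[OF bochner_Lp_strongly_measurable[OF f] st]
    absolutely_integrable_sub[OF bochner_Lp_powr[OF f] st]
  by (simp add: bochner_Lp_def integrable_lebesgue_on_open_iff)

lemma AE_glue:
  fixes a b c :: real
  assumes "AE t in lebesgue_on {a<..<c}. P t" "AE t in lebesgue_on {c<..<b}. P t"
  shows "AE t in lebesgue_on {a<..<b}. P t"
proof -
  have "AE x in lebesgue. x \<noteq> c" by (rule AE_I'[of "{c}"]) auto
  moreover have "AE t in lebesgue. t \<in> {a<..<c} \<longrightarrow> P t"
    using assms(1) by (subst (asm) AE_lebesgue_on_iff) auto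
  moreover have "AE t in lebesgue. t \<in> {c<..<b} \<longrightarrow> P t"
    using assms(2) by (subst (asm) AE_lebesgue_on_iff) auto
  ultimately have "AE t in lebesgue. t \<in> {a<..<b} \<longrightarrow> P t"
    by eventually_elim auto
  then show ?thesis by (simp add: AE_lebesgue_on_iff)
qed

lemma AE_space_open: "AE t in lebesgue_on {a<..<b::real}. a < t \<and> t < b"
  using AE_space[of "lebesgue_on {a<..<b}"] by simp

lemma integral_solution_glue:
  fixes j :: "'v::real_normed_vector \<Rightarrow>\<^sub>L 'h::real_inner"
  assumes 1: "integral_solution j p q a b x1 \<xi>1 w1" and 2: "integral_solution j p q c b x2 \<xi>2 w2"
    and c: "a < c" "c < b" and agree: "\<And>t. t \<in> {a..c} \<Longrightarrow> x2 t = x1 t" and q: "q \<ge> 1"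
  shows "integral_solution j p q a b x2
    (\<lambda>t. if t < c then \<xi>1 t else \<xi>2 t) (\<lambda>t. if t < c then w1 t else w2 t)"
  unfolding integral_solution_def
proof (intro conjI allI impI)
  let ?\<xi> = "\<lambda>t. if t < c then \<xi>1 t else \<xi>2 t" and ?w = "\<lambda>t. if t < c then w1 t else w2 t"
  have p1: "continuous_on {a..b} x1" "bochner_Lp p a b \<xi>1" "bochner_Lp q a b w1"
    "AE t in lebesgue_on {a<..<b}. x1 t = j (\<xi>1 t)"
    and i1: "\<And>v s t. a \<le> s \<Longrightarrow> s \<le> t \<Longrightarrow> t \<le> b \<Longrightarrow> (x1 t - x1 s) \<bullet> j v = integral {s..t} (\<lambda>r. w1 r v)"
    using 1 by (auto simp: integral_solution_def)
  have p2: "continuous_on {c..b} x2" "bochner_Lp p c b \<xi>2" "bochner_Lp q c b w2"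
    "AE t in lebesgue_on {c<..<b}. x2 t = j (\<xi>2 t)"
    and i2: "\<And>v s t. c \<le> s \<Longrightarrow> s \<le> t \<Longrightarrow> t \<le> b \<Longrightarrow> (x2 t - x2 s) \<bullet> j v = integral {s..t} (\<lambda>r. w2 r v)"
    using 2 by (auto simp: integral_solution_def)
  have "continuous_on {a..c} x2"
    by (rule continuous_on_eq[OF continuous_on_subset[OF p1(1)]]) (use c agree in auto)
  then have "continuous_on ({a..c} \<union> {c..b}) x2" by (intro continuous_on_closed_Un p2(1)) auto
  moreover have "{a..c} \<union> {c..b} = {a..b}" using c by auto
  ultimately show "continuous_on {a..b} x2" by simp
  show "bochner_Lp p a b ?\<xi>"
    by (intro bochner_Lp_glue bochner_Lp_restrict[OF p1(2)] p2(2)) (use c in auto)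
  show w: "bochner_Lp q a b ?w"
    by (intro bochner_Lp_glue bochner_Lp_restrict[OF p1(3)] p2(3)) (use c in auto)
  show "AE t in lebesgue_on {a<..<b}. x2 t = j (?\<xi> t)"
  proof (rule AE_glue)
    show "AE t in lebesgue_on {a<..<c}. x2 t = j (?\<xi> t)"
      using AE_subinterval[OF p1(4), of a c] AE_space_open[of a c] c agree
      by (auto elim!: eventually_elim2)
    show "AE t in lebesgue_on {c<..<b}. x2 t = j (?\<xi> t)"
      using p2(4) AE_space_open[of c b] by eventually_elim auto
  qed
  fix v s t assume st: "a \<le> s" "s \<le> t" "t \<le> b"
  have W1: "integral {s..t} (\<lambda>r. ?w r v) = integral {s..t} (\<lambda>r. w1 r v)" if "t \<le> c" for s t
    by (rule integral_spike[of "{c}"]) (use that in auto)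
  have W2: "integral {s..t} (\<lambda>r. ?w r v) = integral {s..t} (\<lambda>r. w2 r v)" if "s \<ge> c" for s t
    by (rule Henstock_Kurzweil_Integration.integral_cong) (use that in auto)
  show "(x2 t - x2 s) \<bullet> j v = integral {s..t} (\<lambda>r. ?w r v)"
  proof -
    consider "t \<le> c" | "c \<le> s" | "s < c" "c < t" by linarith
    then show ?thesis
    proof cases
      case 1
      then show ?thesis using W1[OF 1, of s] i1[of s t v] st agree[of s] agree[of t] by simp
    next
      case 2
      then show ?thesis using W2[OF 2, of t] i2[of s t v] st by simp
    next
      case 3
      have "integral {s..t} (\<lambda>r. ?w r v) =
          integral {s..c} (\<lambda>r. ?w r v) + integral {c..t} (\<lambda>r. ?w r v)"
        by (rule Henstock_Kurzweil_Integration.integral_combine[symmetric])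
          (use 3 st abs_int_imp_int[OF absolutely_integrable_sub[OF apply_absolutely_integrable[OF w q]]] in auto)
      also have "\<dots> = (x2 c - x2 s) \<bullet> j v + (x2 t - x2 c) \<bullet> j v"
        using W1[of c s] W2[of c t] i1[of s c v] i2[of c t v] 3 st c agree[of s] agree[of c] by simp
      finally show ?thesis by (simp add: inner_diff_left)
    qed
  qed
qed

lemma integral_solution_diff:
  fixes j :: "'v::real_normed_vector \<Rightarrow>\<^sub>L 'h::real_inner"
  assumes 1: "integral_solution j p q a b x1 \<xi>1 w1" and 2: "integral_solution j p q a b x2 \<xi>2 w2"
    and pq: "p > 0" "q \<ge> 1"
  shows "integral_solution j p q a b (\<lambda>t. x1 t - x2 t) (\<lambda>t. \<xi>1 t - \<xi>2 t) (\<lambda>t. w1 t - w2 t)"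
  unfolding integral_solution_def
proof (intro conjI allI impI)
  have p1: "continuous_on {a..b} x1" "bochner_Lp p a b \<xi>1" "bochner_Lp q a b w1"
    "AE t in lebesgue_on {a<..<b}. x1 t = j (\<xi>1 t)"
    and i1: "\<And>v s t. a \<le> s \<Longrightarrow> s \<le> t \<Longrightarrow> t \<le> b \<Longrightarrow> (x1 t - x1 s) \<bullet> j v = integral {s..t} (\<lambda>r. w1 r v)"
    using 1 by (auto simp: integral_solution_def)
  have p2: "continuous_on {a..b} x2" "bochner_Lp p a b \<xi>2" "bochner_Lp q a b w2"
    "AE t in lebesgue_on {a<..<b}. x2 t = j (\<xi>2 t)"
    and i2: "\<And>v s t. a \<le> s \<Longrightarrow> s \<le> t \<Longrightarrow> t \<le> b \<Longrightarrow> (x2 t - x2 s) \<bullet> j v = integral {s..t} (\<lambda>r. w2 r v)"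
    using 2 by (auto simp: integral_solution_def)
  show "continuous_on {a..b} (\<lambda>t. x1 t - x2 t)" by (intro continuous_intros p1 p2)
  show "bochner_Lp p a b (\<lambda>t. \<xi>1 t - \<xi>2 t)" by (intro bochner_Lp_diff p1 p2 pq)
  show "bochner_Lp q a b (\<lambda>t. w1 t - w2 t)" using pq by (intro bochner_Lp_diff p1 p2) auto
  show "AE t in lebesgue_on {a<..<b}. x1 t - x2 t = j (\<xi>1 t - \<xi>2 t)"
    using p1(4) p2(4) by eventually_elim (simp add: blinfun.diff_right)
  fix v s t assume st: "a \<le> s" "s \<le> t" "t \<le> b"
  note i = abs_int_imp_int[OF absolutely_integrable_sub[OF apply_absolutely_integrable]]
  have "integral {s..t} (\<lambda>r. blinfun_apply (w1 r - w2 r) v)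
      = integral {s..t} (\<lambda>r. w1 r v) - integral {s..t} (\<lambda>r. w2 r v)"
    unfolding blinfun.diff_left
    by (intro Henstock_Kurzweil_Integration.integral_diff i[OF p1(3) pq(2)] i[OF p2(3) pq(2)]) (use st in auto)
  then show "(x1 t - x2 t - (x1 s - x2 s)) \<bullet> j v = integral {s..t} (\<lambda>r. blinfun_apply (w1 r - w2 r) v)"
    using i1[OF st, of v] i2[OF st, of v] by (simp add: inner_diff_left)
qed

lemma pathsD: "x \<in> paths T \<Longrightarrow> continuous_on {0..T} x"
  by (simp add: paths_def)

lemma paths_uniformly_continuous:
  assumes "x \<in> paths T" "e > 0"
  obtains d where "d > 0" "\<And>s t. s \<in> {0..T} \<Longrightarrow> t \<in> {0..T} \<Longrightarrow> dist t s < d \<Longrightarrow> dist (x t) (x s) < e"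
  using compact_uniformly_continuous[OF pathsD[OF assms(1)] compact_Icc] assms(2)
  unfolding uniformly_continuous_on_def by blast

lemma paths_bdd:
  assumes "x \<in> paths T" "t \<le> T"
  shows "bdd_above ((\<lambda>s. norm (x s)) ` {0..t})"
  by (intro continuous_on_Icc_bdd_above continuous_intros continuous_on_subset[OF pathsD[OF assms(1)]])
    (use assms in auto)

lemma is_trajectory_integral_solution:
  fixes j :: "'v::banach \<Rightarrow>\<^sub>L 'h::{real_inner, complete_space}"
  assumes tr: "is_trajectory j A T p q L t0 x0 x f" and "0 \<le> t0" "t0 < T" "q \<ge> 1"
  obtains \<xi> w where "integral_solution j p q t0 T x \<xi> w"
    "AE t in lebesgue_on {t0<..<T}. w t + A t (\<xi> t) = dual_embed j (f t)"
proof -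
  from tr obtain \<xi> w where *: "Wpq_deriv j p q t0 T \<xi> w"
    "AE t in lebesgue_on {t0<..<T}. x t = j (\<xi> t)"
    "AE t in lebesgue_on {t0<..<T}. w t + A t (\<xi> t) = dual_embed j (f t)" and x: "x \<in> paths T"
    unfolding is_trajectory_def by blast
  have c: "continuous_on {t0..T} x"
    by (rule continuous_on_subset[OF pathsD[OF x]]) (use assms in auto)
  have "integral_solution j p q t0 T x \<xi> w"
    unfolding integral_solution_def
    using gen_deriv_iff_increments[OF \<open>t0 < T\<close> c _ _ \<open>q \<ge> 1\<close> *(2)] * c
    unfolding Wpq_deriv_def by blast
  then show thesis using *(3) by (rule that)
qed

lemma is_trajectoryI:
  fixes j :: "'v::banach \<Rightarrow>\<^sub>L 'h::{real_inner, complete_space}"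
  assumes "integral_solution j p q t0 T x \<xi> w" "t0 < T" "q \<ge> 1"
    "AE t in lebesgue_on {t0<..<T}. w t + A t (\<xi> t) = dual_embed j (f t)"
    "x \<in> paths T" "\<And>t. t \<in> {0..t0} \<Longrightarrow> x t = x0 t" "bochner_Lp 2 t0 T f"
    "AE t in lebesgue_on {t0<..<T}. norm (f t) \<le> L * (1 + (SUP s\<in>{0..t}. norm (x s)))"
  shows "is_trajectory j A T p q L t0 x0 x f"
proof -
  have *: "continuous_on {t0..T} x" "bochner_Lp p t0 T \<xi>" "bochner_Lp q t0 T w"
    "AE t in lebesgue_on {t0<..<T}. x t = j (\<xi> t)"
    using assms(1) by (auto simp: integral_solution_def)
  have "gen_deriv j t0 T \<xi> w"
    using gen_deriv_iff_increments[OF assms(2) *(1-3) assms(3) *(4)] assms(1)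
    by (simp add: integral_solution_def)
  then show ?thesis using assms * unfolding is_trajectory_def Wpq_deriv_def by blast
qed

text \<open>The forcing term and the element of \<open>W\<^sub>p\<^sub>q\<close> are glued at
  \<open>t1\<close>. In the case \<open>t0 = t1\<close> there is nothing to glue, because only the
  values on \<open>[0, t0]\<close> of the initial path matter.\<close>

lemma is_trajectory_concat:
  fixes j :: "'v::banach \<Rightarrow>\<^sub>L 'h::{real_inner, complete_space}"
  assumes 1: "is_trajectory j A T p q L t0 x0 x f" and 2: "is_trajectory j A T p q L t1 x y g"
    and t: "0 \<le> t0" "t0 \<le> t1" "t1 < T" and q: "q \<ge> 1"
  shows "y \<in> trajectories j A T p q L t0 x0"
proof (cases "t0 = t1")
  case True
  then have "is_trajectory j A T p q L t0 x0 y g"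
    using 1 2 unfolding is_trajectory_def by auto
  then show ?thesis by (auto simp: trajectories_def)
next
  case False
  then have t01: "t0 < t1" using t by simp
  obtain \<xi>1 w1 where s1: "integral_solution j p q t0 T x \<xi>1 w1"
    and e1: "AE t in lebesgue_on {t0<..<T}. w1 t + A t (\<xi>1 t) = dual_embed j (f t)"
    by (rule is_trajectory_integral_solution[OF 1]) (use t q in auto)
  obtain \<xi>2 w2 where s2: "integral_solution j p q t1 T y \<xi>2 w2"
    and e2: "AE t in lebesgue_on {t1<..<T}. w2 t + A t (\<xi>2 t) = dual_embed j (g t)"
    by (rule is_trajectory_integral_solution[OF 2]) (use t q in auto)
  have agree: "y t = x t" if "t \<in> {0..t1}" for t using 2 that by (simp add: is_trajectory_def)
  have y: "y \<in> paths T" using 2 by (simp add: is_trajectory_def)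
  let ?f = "\<lambda>t. if t < t1 then f t else g t"
  have "is_trajectory j A T p q L t0 x0 y ?f"
  proof (rule is_trajectoryI)
    show "integral_solution j p q t0 T y (\<lambda>t. if t < t1 then \<xi>1 t else \<xi>2 t) (\<lambda>t. if t < t1 then w1 t else w2 t)"
      by (rule integral_solution_glue[OF s1 s2]) (use t t01 q agree in auto)
    show "bochner_Lp 2 t0 T ?f"
    proof (rule bochner_Lp_glue)
      have "bochner_Lp 2 t0 T f" using 1 by (simp add: is_trajectory_def)
      then show "bochner_Lp 2 t0 t1 f" by (rule bochner_Lp_restrict) (use t in auto)
      show "bochner_Lp 2 t1 T g" using 2 by (simp add: is_trajectory_def)
    qed (use t t01 in auto)
    show "AE t in lebesgue_on {t0<..<T}. (if t < t1 then w1 t else w2 t) +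
        A t (if t < t1 then \<xi>1 t else \<xi>2 t) = dual_embed j (?f t)"
    proof (rule AE_glue)
      show "AE t in lebesgue_on {t0<..<t1}. (if t < t1 then w1 t else w2 t) +
          A t (if t < t1 then \<xi>1 t else \<xi>2 t) = dual_embed j (?f t)"
        using AE_subinterval[OF e1 order_refl less_imp_le[OF t(3)]] AE_space_open[of t0 t1] by eventually_elim simp
      show "AE t in lebesgue_on {t1<..<T}. (if t < t1 then w1 t else w2 t) +
          A t (if t < t1 then \<xi>1 t else \<xi>2 t) = dual_embed j (?f t)"
        using e2 AE_space_open[of t1 T] by eventually_elim simp
    qed
    show "AE t in lebesgue_on {t0<..<T}. norm (?f t) \<le> L * (1 + (SUP s\<in>{0..t}. norm (y s)))"
    proof (rule AE_glue)
      have "AE t in lebesgue_on {t0<..<T}. norm (f t) \<le> L * (1 + (SUP s\<in>{0..t}. norm (x s)))"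
        using 1 by (simp add: is_trajectory_def)
      from AE_subinterval[OF this order_refl less_imp_le[OF t(3)]] AE_space_open[of t0 t1]
      show "AE t in lebesgue_on {t0<..<t1}. norm (?f t) \<le> L * (1 + (SUP s\<in>{0..t}. norm (y s)))"
      proof eventually_elim
        case (elim t)
        have "(SUP s\<in>{0..t}. norm (y s)) = (SUP s\<in>{0..t}. norm (x s))"
          by (rule SUP_cong) (use elim agree in auto)
        then show ?case using elim by simp
      qed
      have "AE t in lebesgue_on {t1<..<T}. norm (g t) \<le> L * (1 + (SUP s\<in>{0..t}. norm (y s)))"
        using 2 by (simp add: is_trajectory_def)
      then show "AE t in lebesgue_on {t1<..<T}. norm (?f t) \<le> L * (1 + (SUP s\<in>{0..t}. norm (y s)))"
        using AE_space_open[of t1 T] by eventually_elim simp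
    qed
    show "y t = x0 t" if "t \<in> {0..t0}" for t using that 1 agree[of t] t01 by (auto simp: is_trajectory_def)
  qed (use t y q in auto)
  then show ?thesis by (auto simp: trajectories_def)
qed

section \<open>Monotone evolution equations\<close>

lemma integral_solution_strongly_measurable:
  assumes "integral_solution j p q a b x \<xi> w"
  shows "strongly_measurable (lebesgue_on {a<..<b}) x"
proof -
  have "bochner_Lp p a b \<xi>" "AE t in lebesgue_on {a<..<b}. x t = j (\<xi> t)"
    using assms by (auto simp: integral_solution_def)
  have "strongly_measurable (lebesgue_on {a<..<b}) (\<lambda>t. j (\<xi> t))"
    by (rule strongly_measurable_continuous[OF bochner_Lp_strongly_measurable[OF \<open>bochner_Lp p a b \<xi>\<close>]])
      (intro continuous_intros)
  then show ?thesis
    by (rule strongly_measurable_AE_cong)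
      (use \<open>AE t in lebesgue_on {a<..<b}. x t = j (\<xi> t)\<close> in \<open>auto elim: eventually_mono\<close>)
qed

lemma inner_absolutely_integrable:
  fixes f x :: "real \<Rightarrow> 'h::real_inner"
  assumes f: "bochner_Lp r a b f" "r \<ge> 1" and x: "continuous_on {a..b} x"
    and xm: "strongly_measurable (lebesgue_on {a<..<b}) x"
  shows "(\<lambda>t. f t \<bullet> x t) absolutely_integrable_on {a..b}"
proof -
  have "compact (x ` {a..b})" by (intro compact_continuous_image x) auto
  then obtain M where M: "\<And>t. t \<in> {a..b} \<Longrightarrow> norm (x t) \<le> M"
    using compact_imp_bounded bounded_iff by (metis imageI)
  show ?thesis
  proof (rule absolutely_integrable_bound)
    have "continuous_on UNIV (\<lambda>z::'h \<times> 'h. fst z \<bullet> snd z)" by (intro continuous_intros)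
    from strongly_measurable_continuous[OF strongly_measurable_Pair[OF bochner_Lp_strongly_measurable[OF f(1)] xm] this]
    show "(\<lambda>t. f t \<bullet> x t) \<in> borel_measurable (lebesgue_on {a<..<b})"
      by (intro strongly_measurable_imp_borel) simp_all
    show "(\<lambda>t. norm (f t) * M) absolutely_integrable_on {a..b}"
      by (intro set_integrable_mult_left bochner_Lp_norm[OF f])
    show "AE t in lebesgue_on {a<..<b}. \<bar>f t \<bullet> x t\<bar> \<le> norm (f t) * M"
      using AE_space_open[of a b]
    proof eventually_elim
      case (elim t)
      have "\<bar>f t \<bullet> x t\<bar> \<le> norm (f t) * norm (x t)" by (rule Cauchy_Schwarz_ineq2)
      also have "\<dots> \<le> norm (f t) * M" by (intro mult_left_mono M) (use elim in auto)
      finally show ?case .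
    qed
  qed
qed

text \<open>Below the constant \<open>C = (1 / l) powr (1 / (r - 1))\<close> the bound is clear,
  above it \<open>l * y powr (r - 1) \<ge> 1\<close>.\<close>

lemma linear_le_small_powr:
  fixes r l :: real
  assumes "r > 1" "l > 0"
  obtains C where "C \<ge> 0" "\<And>y. y \<ge> 0 \<Longrightarrow> y \<le> l * y powr r + C"
proof (rule that[of "(1 / l) powr (1 / (r - 1))"])
  fix y :: real assume y: "y \<ge> 0"
  define C where "C = (1 / l) powr (1 / (r - 1))"
  show "y \<le> l * y powr r + C"
  proof (cases "y \<le> C")
    case True
    then show ?thesis using assms by (simp add: add_increasing)
  next
    case False
    have "C \<ge> 0" by (simp add: C_def)
    then have "y > 0" using False by simp
    have "1 / l = C powr (r - 1)" using assms by (simp add: C_def powr_powr)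
    also have "\<dots> \<le> y powr (r - 1)" using False \<open>C \<ge> 0\<close> assms by (intro powr_mono2) auto
    finally have "1 \<le> l * y powr (r - 1)" using assms by (simp add: field_simps)
    then have "y * 1 \<le> y * (l * y powr (r - 1))" using y by (intro mult_left_mono) auto
    also have "\<dots> = l * y powr r" using \<open>y > 0\<close> by (simp add: powr_diff)
    finally show ?thesis using \<open>C \<ge> 0\<close> by simp
  qed
qed simp

text \<open>For a vector \<open>v\<close> of the unit ball take a member \<open>b\<close> of a
  finite net with \<open>|j v - j b| < \<delta> / 2\<close>. Then \<open>|j v|\<^sup>2 = (j v, j b)
  + (j v, j v - j b)\<close>, so either \<open>|j v| \<le> \<delta>\<close> or one may divide by
  \<open>|j v|\<close>. Both sides are homogeneous of degree one.\<close>

lemma compact_embedding_Ehrling: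
  fixes j :: "'v::real_normed_vector \<Rightarrow>\<^sub>L 'h::real_inner"
  assumes "compact (closure (j ` cball 0 1))" and "\<delta> > 0"
  obtains B where "finite B" "\<And>v. norm (j v) \<le> \<delta> * norm v + (\<Sum>b\<in>B. \<bar>j v \<bullet> j b\<bar>) / \<delta>"
proof -
  have "closure (j ` cball 0 1) \<subseteq> (\<Union>v\<in>cball 0 1. ball (j v) (\<delta> / 2))"
  proof
    fix y assume "y \<in> closure (j ` cball 0 1)"
    then obtain z where "z \<in> j ` cball 0 1" "dist z y < \<delta> / 2"
      using assms(2) by (meson closure_approachable half_gt_zero)
    then show "y \<in> (\<Union>v\<in>cball 0 1. ball (j v) (\<delta> / 2))" by auto
  qed
  then obtain B where B: "B \<subseteq> cball 0 1" "finite B" "closure (j ` cball 0 1) \<subseteq> (\<Union>v\<in>B. ball (j v) (\<delta> / 2))"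
    using compactE_image[OF assms(1), of "cball 0 1" "\<lambda>v. ball (j v) (\<delta> / 2)"] by auto
  have unit: "norm (j v) \<le> \<delta> + (\<Sum>b\<in>B. \<bar>j v \<bullet> j b\<bar>) / \<delta>" if "norm v \<le> 1" for v
  proof (cases "norm (j v) \<le> \<delta>")
    case True
    then show ?thesis using assms(2) by (simp add: add_increasing2 sum_nonneg)
  next
    case False
    have "j v \<in> closure (j ` cball 0 1)" using that closure_subset by fastforce
    then obtain b where b: "b \<in> B" "dist (j b) (j v) < \<delta> / 2" using B(3) by auto
    define S where "S = (\<Sum>b\<in>B. \<bar>j v \<bullet> j b\<bar>)"
    have "(norm (j v))\<^sup>2 = j v \<bullet> j b + j v \<bullet> (j v - j b)"
      by (simp add: power2_norm_eq_inner inner_diff_right)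
    also have "\<dots> \<le> S + norm (j v) * (\<delta> / 2)"
    proof (intro add_mono)
      have "j v \<bullet> j b \<le> \<bar>j v \<bullet> j b\<bar>" by simp
      also have "\<dots> \<le> S" unfolding S_def by (rule member_le_sum) (use b B in auto)
      finally show "j v \<bullet> j b \<le> S" .
      have "j v \<bullet> (j v - j b) \<le> norm (j v) * norm (j v - j b)" by (rule norm_cauchy_schwarz)
      also have "\<dots> \<le> norm (j v) * (\<delta> / 2)"
        using b by (intro mult_left_mono) (auto simp: dist_norm norm_minus_commute)
      finally show "j v \<bullet> (j v - j b) \<le> norm (j v) * (\<delta> / 2)" .
    qed
    finally have *: "(norm (j v) - \<delta> / 2) * norm (j v) \<le> S" by (simp add: power2_eq_square algebra_simps)
    have "(norm (j v) - \<delta> / 2) * \<delta> \<le> (norm (j v) - \<delta> / 2) * norm (j v)"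
      using False assms(2) by (intro mult_left_mono) auto
    with * have "(norm (j v) - \<delta> / 2) * \<delta> \<le> S" by linarith
    then have "norm (j v) - \<delta> / 2 \<le> S / \<delta>" using assms(2) by (simp add: pos_le_divide_eq)
    then show ?thesis unfolding S_def using assms(2) by simp
  qed
  show thesis
  proof (rule that[OF B(2)])
    fix v
    show "norm (j v) \<le> \<delta> * norm v + (\<Sum>b\<in>B. \<bar>j v \<bullet> j b\<bar>) / \<delta>"
    proof (cases "v = 0")
      case False
      define u where "u = (1 / norm v) *\<^sub>R v"
      have v: "v = norm v *\<^sub>R u" using False by (simp add: u_def)
      have jv: "j v = norm v *\<^sub>R j u" by (subst v) (simp add: blinfun.scaleR_right)
      have "norm (j v) = norm v * norm (j u)" by (simp add: jv)
      also have "\<dots> \<le> norm v * (\<delta> + (\<Sum>b\<in>B. \<bar>j u \<bullet> j b\<bar>) / \<delta>)"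
        by (intro mult_left_mono unit) (auto simp: u_def)
      also have "\<dots> = \<delta> * norm v + (\<Sum>b\<in>B. norm v * \<bar>j u \<bullet> j b\<bar>) / \<delta>"
        by (simp add: sum_distrib_left algebra_simps)
      also have "(\<Sum>b\<in>B. norm v * \<bar>j u \<bullet> j b\<bar>) = (\<Sum>b\<in>B. \<bar>j v \<bullet> j b\<bar>)"
        by (simp add: jv abs_mult)
      finally show ?thesis .
    qed (use assms(2) in \<open>simp add: sum_nonneg\<close>)
  qed
qed

locale monotone_evolution =
  fixes j :: "'v::banach \<Rightarrow>\<^sub>L 'h::{real_inner, complete_space}"
    and A :: "real \<Rightarrow> 'v \<Rightarrow> ('v \<Rightarrow>\<^sub>L real)" and T p q :: real
  assumes T: "T > 0" and p: "p \<ge> 2" and q: "q > 1" and pq: "1 / p + 1 / q = 1"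
    and operator: "admissible_operator T p q A"
begin

lemma AE_operator:
  assumes "AE t in lebesgue_on {0..T}. P t" "0 \<le> t0"
  shows "AE t in lebesgue_on {t0<..<T}. P t"
proof -
  have "AE t in lebesgue. t \<in> {0..T} \<longrightarrow> P t"
    using assms(1) by (subst (asm) AE_lebesgue_on_iff) auto
  then have "AE t in lebesgue. t \<in> {t0<..<T} \<longrightarrow> P t" by eventually_elim (use assms in auto)
  then show ?thesis by (simp add: AE_lebesgue_on_iff)
qed

lemma conj_exponent: "(p - 1) * q = p"
  using p q pq by (simp add: field_simps)

text \<open>In the pairing of the difference of the derivatives with the difference of the
  solutions, the contribution of \<open>A\<close> is nonpositive by monotonicity.\<close>

lemma energy_inequality_difference:
  assumes x: "is_trajectory j A T p q L t0 x0 x f" and y: "is_trajectory j A T p q L' t0 y0 y g"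
    and t: "0 \<le> t0" "t0 < T" "t0 \<le> s" "s \<le> t" "t \<le> T"
  shows "(\<lambda>r. (f r - g r) \<bullet> (x r - y r)) absolutely_integrable_on {t0..T}"
    and "(norm (x t - y t))\<^sup>2 - (norm (x s - y s))\<^sup>2 \<le> 2 * integral {s..t} (\<lambda>r. (f r - g r) \<bullet> (x r - y r))"
proof -
  obtain \<xi> w where sx: "integral_solution j p q t0 T x \<xi> w"
    and ex: "AE t in lebesgue_on {t0<..<T}. w t + A t (\<xi> t) = dual_embed j (f t)"
    by (rule is_trajectory_integral_solution[OF x]) (use t q in auto)
  obtain \<eta> z where sy: "integral_solution j p q t0 T y \<eta> z"
    and ey: "AE t in lebesgue_on {t0<..<T}. z t + A t (\<eta> t) = dual_embed j (g t)"
    by (rule is_trajectory_integral_solution[OF y]) (use t q in auto)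
  have sol: "integral_solution j p q t0 T (\<lambda>t. x t - y t) (\<lambda>t. \<xi> t - \<eta> t) (\<lambda>t. w t - z t)"
    by (rule integral_solution_diff[OF sx sy]) (use p q in auto)
  have fg: "bochner_Lp 2 t0 T (\<lambda>t. f t - g t)"
    using x y by (intro bochner_Lp_diff) (auto simp: is_trajectory_def)
  show i: "(\<lambda>r. (f r - g r) \<bullet> (x r - y r)) absolutely_integrable_on {t0..T}"
    by (rule inner_absolutely_integrable[OF fg _ _ integral_solution_strongly_measurable[OF sol]])
      (use sol in \<open>auto simp: integral_solution_def\<close>)
  have p1: "p > 1" using p by simp
  have pair: "(\<lambda>r. blinfun_apply (w r - z r) (\<xi> r - \<eta> r)) absolutely_integrable_on {t0..T}"
    by (rule pairing_absolutely_integrable[OF p1 q pq]) (use sol in \<open>auto simp: integral_solution_def\<close>)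
  have le: "AE r in lebesgue_on {t0<..<T}. blinfun_apply (w r - z r) (\<xi> r - \<eta> r) \<le> (f r - g r) \<bullet> (x r - y r)"
  proof -
    have m: "AE t in lebesgue_on {0..T}. \<forall>x y. blinfun_apply (A t x - A t y) (x - y) \<ge> 0"
      using operator by (simp add: admissible_operator_def)
    have e: "AE t in lebesgue_on {t0<..<T}. x t - y t = j (\<xi> t - \<eta> t)"
      using sol by (simp add: integral_solution_def)
    from AE_operator[OF m t(1)] ex ey e show ?thesis
    proof eventually_elim
        case (elim r)
        have "w r = dual_embed j (f r) - A r (\<xi> r)" "z r = dual_embed j (g r) - A r (\<eta> r)"
          using elim(2,3) by (simp_all add: eq_diff_eq)
        then have "blinfun_apply (w r - z r) (\<xi> r - \<eta> r) =
            (f r - g r) \<bullet> j (\<xi> r - \<eta> r) - blinfun_apply (A r (\<xi> r) - A r (\<eta> r)) (\<xi> r - \<eta> r)"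
          by (simp add: blinfun.diff_left dual_embed_def inner_diff_left inner_commute)
        then show ?case using elim(1,4) by simp
    qed
  qed
  have "(norm (x t - y t))\<^sup>2 - (norm (x s - y s))\<^sup>2 \<le> 2 * integral {s..t} (\<lambda>r. blinfun_apply (w r - z r) (\<xi> r - \<eta> r))"
    by (rule energy_inequality[OF p1 q pq sol t(3-5)])
  also have "integral {s..t} (\<lambda>r. blinfun_apply (w r - z r) (\<xi> r - \<eta> r)) \<le> integral {s..t} (\<lambda>r. (f r - g r) \<bullet> (x r - y r))"
    by (intro integral_bound_real absolutely_integrable_sub[OF pair] absolutely_integrable_sub[OF i] AE_subinterval[OF le])
      (use t in auto)
  finally show "(norm (x t - y t))\<^sup>2 - (norm (x s - y s))\<^sup>2 \<le> 2 * integral {s..t} (\<lambda>r. (f r - g r) \<bullet> (x r - y r))"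
    by simp
qed

text \<open>Coercivity of \<open>A\<close> absorbs the pairing of \<open>A(t, \<xi>)\<close> with
  \<open>\<xi>\<close>; this controls \<open>\<xi>\<close> in \<open>L\<^sup>p\<close>.\<close>

lemma energy_inequality_coercive:
  obtains c where "c > 0" "\<And>L t0 x0 x f \<xi> w s t. is_trajectory j A T p q L t0 x0 x f \<Longrightarrow> 0 \<le> t0 \<Longrightarrow>
      integral_solution j p q t0 T x \<xi> w \<Longrightarrow> AE t in lebesgue_on {t0<..<T}. w t + A t (\<xi> t) = dual_embed j (f t) \<Longrightarrow>
      t0 \<le> s \<Longrightarrow> s \<le> t \<Longrightarrow> t \<le> T \<Longrightarrow>
      (norm (x t))\<^sup>2 + c * integral {s..t} (\<lambda>r. norm (\<xi> r) powr p) \<le> (norm (x s))\<^sup>2 + 2 * integral {s..t} (\<lambda>r. f r \<bullet> x r)"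
    "\<And>L t0 x0 x f \<xi> w. is_trajectory j A T p q L t0 x0 x f \<Longrightarrow> 
      integral_solution j p q t0 T x \<xi> w \<Longrightarrow> (\<lambda>r. f r \<bullet> x r) absolutely_integrable_on {t0..T}"
proof -
  obtain c where c: "c > 0" "AE t in lebesgue_on {0..T}. \<forall>x. blinfun_apply (A t x) x \<ge> c * norm x powr p"
    using operator unfolding admissible_operator_def by blast
  have int: "(\<lambda>r. f r \<bullet> x r) absolutely_integrable_on {t0..T}"
    if tr: "is_trajectory j A T p q L t0 x0 x f" and sol: "integral_solution j p q t0 T x \<xi> w"
    for L t0 x0 x f \<xi> w
    by (rule inner_absolutely_integrable[OF _ _ _ integral_solution_strongly_measurable[OF sol], of 2])
      (use tr sol in \<open>auto simp: integral_solution_def is_trajectory_def\<close>)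
  show thesis
  proof (rule that[of "2 * c"])
    show "2 * c > 0" using c by simp
    fix L t0 x0 x f \<xi> w s t
    assume tr: "is_trajectory j A T p q L t0 x0 x f" and t0: "0 \<le> t0"
      and sol: "integral_solution j p q t0 T x \<xi> w"
      and eq: "AE t in lebesgue_on {t0<..<T}. w t + A t (\<xi> t) = dual_embed j (f t)"
      and t: "t0 \<le> s" "s \<le> t" "t \<le> T"
    have p1: "p > 1" using p by simp
    note i = int[OF tr sol]
    have \<xi>: "bochner_Lp p t0 T \<xi>" and w: "bochner_Lp q t0 T w" using sol by (auto simp: integral_solution_def)
    have X: "(\<lambda>r. norm (\<xi> r) powr p) absolutely_integrable_on {t0..T}" by (rule bochner_Lp_powr[OF \<xi>])
    have pair: "(\<lambda>r. w r (\<xi> r)) absolutely_integrable_on {t0..T}"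
      by (rule pairing_absolutely_integrable[OF p1 q pq \<xi> w])
    have "AE t in lebesgue_on {t0<..<T}. x t = j (\<xi> t)" using sol by (simp add: integral_solution_def)
    with AE_operator[OF c(2) t0] eq
    have le: "AE r in lebesgue_on {t0<..<T}. w r (\<xi> r) \<le> f r \<bullet> x r - c * norm (\<xi> r) powr p"
    proof eventually_elim
      case (elim r)
      have "w r = dual_embed j (f r) - A r (\<xi> r)" using elim(2) by (simp add: eq_diff_eq)
      then have "w r (\<xi> r) = f r \<bullet> j (\<xi> r) - blinfun_apply (A r (\<xi> r)) (\<xi> r)"
        by (simp add: blinfun.diff_left dual_embed_def inner_commute)
      then show ?case using elim(1,3) by simp
    qed
    have ints: "(\<lambda>r. f r \<bullet> x r) absolutely_integrable_on {s..t}" "(\<lambda>r. norm (\<xi> r) powr p) absolutely_integrable_on {s..t}"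
      "(\<lambda>r. w r (\<xi> r)) absolutely_integrable_on {s..t}"
      by (rule absolutely_integrable_sub[OF i] absolutely_integrable_sub[OF X] absolutely_integrable_sub[OF pair]; use t in auto)+
    have "(norm (x t))\<^sup>2 - (norm (x s))\<^sup>2 \<le> 2 * integral {s..t} (\<lambda>r. w r (\<xi> r))"
      by (rule energy_inequality[OF p1 q pq sol t])
    also have "integral {s..t} (\<lambda>r. w r (\<xi> r)) \<le> integral {s..t} (\<lambda>r. f r \<bullet> x r - c * norm (\<xi> r) powr p)"
      by (intro integral_bound_real ints AE_subinterval[OF le] set_integral_diff set_integrable_mult_right) (use t in auto)
    also have "integral {s..t} (\<lambda>r. f r \<bullet> x r - c * norm (\<xi> r) powr p) =
        integral {s..t} (\<lambda>r. f r \<bullet> x r) - c * integral {s..t} (\<lambda>r. norm (\<xi> r) powr p)"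
      using Henstock_Kurzweil_Integration.integral_diff[OF abs_int_imp_int[OF ints(1)]
          abs_int_imp_int[OF set_integrable_mult_right[OF ints(2), of c]]] by simp
    finally show "(norm (x t))\<^sup>2 + 2 * c * integral {s..t} (\<lambda>r. norm (\<xi> r) powr p)
        \<le> (norm (x s))\<^sup>2 + 2 * integral {s..t} (\<lambda>r. f r \<bullet> x r)" by (simp add: algebra_simps)
  qed (rule int)
qed

section \<open>A priori bounds and weak equicontinuity\<close>

lemma forcing_bound:
  assumes tr: "is_trajectory j A T p q L t0 x0 x f" and L: "L \<ge> 0" and t0: "0 \<le> t0"
    and R: "\<And>t. t \<in> {0..T} \<Longrightarrow> norm (x t) \<le> R"
  shows "AE t in lebesgue_on {t0<..<T}. norm (f t) \<le> L * (1 + R)"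
proof -
  have "AE t in lebesgue_on {t0<..<T}. norm (f t) \<le> L * (1 + (SUP s\<in>{0..t}. norm (x s)))"
    using tr by (simp add: is_trajectory_def)
  then show ?thesis using AE_space_open[of t0 T]
  proof eventually_elim
    case (elim r)
    have "(SUP s\<in>{0..r}. norm (x s)) \<le> R"
      by (rule cSUP_least) (use elim t0 R in auto)
    then show ?case using elim(1) L by (meson add_left_mono mult_left_mono order_trans)
  qed
qed

text \<open>Let \<open>M\<close> be the maximum of \<open>exp (- l t) |x(t)|\<^sup>2\<close>. The
  forcing at time \<open>r\<close> is bounded in terms of \<open>sqrt (M exp (l r))\<close>, and
  integrating \<open>exp (l r)\<close> gains a factor \<open>1 / l\<close>. For \<open>l \<ge> 8
  L\<close> the energy inequality becomes \<open>M \<le> const + M / 2\<close>.\<close>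

lemma trajectories_bounds:
  assumes L: "L \<ge> 0" and t0: "0 \<le> t0" "t0 < T" and x0: "x0 \<in> paths T"
  obtains R C where "R \<ge> 0" "C \<ge> 0"
    "\<And>x t. x \<in> trajectories j A T p q L t0 x0 \<Longrightarrow> t \<in> {0..T} \<Longrightarrow> norm (x t) \<le> R"
    "\<And>x f \<xi> w. is_trajectory j A T p q L t0 x0 x f \<Longrightarrow> integral_solution j p q t0 T x \<xi> w \<Longrightarrow>
      AE t in lebesgue_on {t0<..<T}. w t + A t (\<xi> t) = dual_embed j (f t) \<Longrightarrow>
      integral {t0..T} (\<lambda>r. norm (\<xi> r) powr p) \<le> C"
proof -
  obtain c where c: "c > 0" and energy: "\<And>L t0 x0 x f \<xi> w s t. is_trajectory j A T p q L t0 x0 x f \<Longrightarrow> 0 \<le> t0 \<Longrightarrow>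
      integral_solution j p q t0 T x \<xi> w \<Longrightarrow> AE t in lebesgue_on {t0<..<T}. w t + A t (\<xi> t) = dual_embed j (f t) \<Longrightarrow>
      t0 \<le> s \<Longrightarrow> s \<le> t \<Longrightarrow> t \<le> T \<Longrightarrow>
      (norm (x t))\<^sup>2 + c * integral {s..t} (\<lambda>r. norm (\<xi> r) powr p) \<le> (norm (x s))\<^sup>2 + 2 * integral {s..t} (\<lambda>r. f r \<bullet> x r)"
    and int: "\<And>L t0 x0 x f \<xi> w. is_trajectory j A T p q L t0 x0 x f \<Longrightarrow>
      integral_solution j p q t0 T x \<xi> w \<Longrightarrow> (\<lambda>r. f r \<bullet> x r) absolutely_integrable_on {t0..T}"
    by (rule energy_inequality_coercive) blast
  have "compact (x0 ` {0..T})" by (intro compact_continuous_image pathsD[OF x0]) auto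
  then obtain K where K: "\<And>t. t \<in> {0..T} \<Longrightarrow> norm (x0 t) \<le> K"
    using compact_imp_bounded bounded_iff by (metis imageI)
  \<comment> \<open>the weight \<open>exp (- l t)\<close> must beat the factor \<open>4 * L\<close> produced by the energy inequality; \<open>+ 1\<close> covers \<open>L = 0\<close>\<close>
  define l where "l = 8 * L + 1"
  define M0 where "M0 = 2 * (K\<^sup>2 + 2 * L * T)"
  define R where "R = sqrt (M0 * exp (l * T))"
  have l: "l > 0" "l \<ge> 8 * L" using L by (auto simp: l_def)
  have M0: "M0 \<ge> 0" using L T by (auto simp: M0_def)
  have R0: "R \<ge> 0" using M0 by (simp add: R_def)
  have bound: "norm (x t) \<le> R" if tr: "is_trajectory j A T p q L t0 x0 x f" and t: "t \<in> {0..T}" for x f t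
  proof -
    obtain \<xi> w where sol: "integral_solution j p q t0 T x \<xi> w"
      and eq: "AE t in lebesgue_on {t0<..<T}. w t + A t (\<xi> t) = dual_embed j (f t)"
      by (rule is_trajectory_integral_solution[OF tr t0]) (use q in auto)
    have x: "x \<in> paths T" and init: "\<And>t. t \<in> {0..t0} \<Longrightarrow> x t = x0 t"
      and f: "AE t in lebesgue_on {t0<..<T}. norm (f t) \<le> L * (1 + (SUP s\<in>{0..t}. norm (x s)))"
      using tr by (auto simp: is_trajectory_def)
    define N where "N r = exp (- l * r) * (norm (x r))\<^sup>2" for r
    define M where "M = (SUP r\<in>{0..T}. N r)"
    have bdd: "bdd_above (N ` {0..T})" unfolding N_def
      by (intro continuous_on_Icc_bdd_above continuous_intros pathsD[OF x])
    have NM: "N r \<le> M" if "r \<in> {0..T}" for r unfolding M_def by (rule cSUP_upper[OF that bdd])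
    have M: "M \<ge> 0" using NM[of 0] T by (simp add: N_def order_trans[OF zero_le_power2])
    have sq: "(norm (x r))\<^sup>2 \<le> M * exp (l * r)" if "r \<in> {0..T}" for r
    proof -
      have "(norm (x r))\<^sup>2 = exp (l * r) * N r" by (simp add: N_def exp_minus)
      also have "\<dots> \<le> exp (l * r) * M" by (intro mult_left_mono NM that) auto
      finally show ?thesis by (simp add: mult.commute)
    qed
    have fx: "AE r in lebesgue_on {t0<..<T}. f r \<bullet> x r \<le> L * (1 + 2 * (M * exp (l * r)))"
      using f AE_space_open[of t0 T]
    proof eventually_elim
      case (elim r)
      define S where "S = sqrt (M * exp (l * r))"
      have S0: "S \<ge> 0" using M by (simp add: S_def)
      have S2: "S\<^sup>2 = M * exp (l * r)" using M by (simp add: S_def)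
      have xS: "norm (x s) \<le> S" if "s \<in> {0..r}" for s
      proof -
        have "(norm (x s))\<^sup>2 \<le> M * exp (l * s)" by (rule sq) (use that elim t0 in auto)
        also have "\<dots> \<le> M * exp (l * r)" using that l M by (intro mult_left_mono) auto
        finally show ?thesis unfolding S_def by (rule real_le_rsqrt)
      qed
      have sup: "(SUP s\<in>{0..r}. norm (x s)) \<le> S" by (rule cSUP_least) (use elim t0 xS in auto)
      have "f r \<bullet> x r \<le> norm (f r) * norm (x r)" by (rule norm_cauchy_schwarz)
      also have "\<dots> \<le> (L * (1 + S)) * S"
      proof (rule mult_mono)
        show "norm (f r) \<le> L * (1 + S)" using elim(1) sup L by (meson add_left_mono mult_left_mono order_trans)
        show "norm (x r) \<le> S" by (rule xS) (use elim t0 in auto)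
      qed (use L S0 in auto)
      also have "\<dots> = L * ((1 + S) * S)" by (simp add: mult.assoc)
      also have "\<dots> \<le> L * (1 + 2 * S\<^sup>2)"
      proof (rule mult_left_mono[OF _ L])
        have "0 \<le> (S - 1)\<^sup>2" by simp
        then have "2 * S \<le> 1 + S\<^sup>2" by (simp add: power2_eq_square algebra_simps)
        with S0 have "S \<le> 1 + S\<^sup>2" by linarith
        then show "(1 + S) * S \<le> 1 + 2 * S\<^sup>2" by (simp add: power2_eq_square algebra_simps)
      qed
      finally show ?case by (simp add: S2)
    qed
    have main: "N t \<le> K\<^sup>2 + 2 * L * T + M / 2" if t: "t \<in> {0..T}" for t
    proof (cases "t \<le> t0")
      case True
      have "N t \<le> 1 * (norm (x t))\<^sup>2" unfolding N_def
        using t l by (intro mult_right_mono) auto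
      also have "\<dots> \<le> K\<^sup>2" using K[OF t] init[of t] True t by (simp add: power_mono)
      also have "\<dots> \<le> K\<^sup>2 + 2 * L * T + M / 2" using L T M by simp
      finally show ?thesis .
    next
      case False
      have ei: "((\<lambda>r. L * (1 + 2 * (M * exp (l * r)))) has_integral
          (L * (t + 2 * (M * exp (l * t) / l)) - L * (t0 + 2 * (M * exp (l * t0) / l)))) {t0..t}"
      proof (rule fundamental_theorem_of_calculus)
        fix r
        have "((\<lambda>r. L * (r + 2 * (M * exp (l * r) / l))) has_real_derivative L * (1 + 2 * (M * exp (l * r)))) (at r)"
          using l by (auto intro!: derivative_eq_intros)
        then show "((\<lambda>r. L * (r + 2 * (M * exp (l * r) / l))) has_vector_derivative L * (1 + 2 * (M * exp (l * r))))
            (at r within {t0..t})"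
          unfolding has_real_derivative_iff_has_vector_derivative by (rule has_vector_derivative_at_within)
      qed (use False in auto)
      have "integral {t0..t} (\<lambda>r. f r \<bullet> x r) \<le> integral {t0..t} (\<lambda>r. L * (1 + 2 * (M * exp (l * r))))"
        by (intro integral_bound_real absolutely_integrable_sub[OF int[OF tr sol]] AE_subinterval[OF fx]
            absolutely_integrable_continuous_real continuous_intros) (use t in auto)
      also have "\<dots> = L * (t - t0) + 2 * L * M * (exp (l * t) - exp (l * t0)) / l"
        unfolding integral_unique[OF ei] by (simp add: algebra_simps diff_divide_distrib)
      also have "\<dots> \<le> L * T + (M / 4) * exp (l * t)"
      proof (rule add_mono)
        show "L * (t - t0) \<le> L * T" using L t t0 by (intro mult_left_mono) auto
        have "2 * L * M * (exp (l * t) - exp (l * t0)) / l \<le> 2 * L * M * exp (l * t) / l"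
          using L M l by (intro divide_right_mono mult_left_mono) auto
        also have "\<dots> = (2 * L / l) * (M * exp (l * t))" by simp
        also have "\<dots> \<le> (1 / 4) * (M * exp (l * t))"
          using M l by (intro mult_right_mono) (auto simp: field_simps)
        finally show "2 * L * M * (exp (l * t) - exp (l * t0)) / l \<le> (M / 4) * exp (l * t)" by simp
      qed
      finally have I: "integral {t0..t} (\<lambda>r. f r \<bullet> x r) \<le> L * T + (M / 4) * exp (l * t)" .
      have "0 \<le> c * integral {t0..t} (\<lambda>r. norm (\<xi> r) powr p)"
        using c by (intro mult_nonneg_nonneg Henstock_Kurzweil_Integration.integral_nonneg
            abs_int_imp_int[OF absolutely_integrable_sub[OF bochner_Lp_powr]])
          (use sol t in \<open>auto simp: integral_solution_def\<close>)
      then have "(norm (x t))\<^sup>2 \<le> (norm (x t0))\<^sup>2 + 2 * (L * T + (M / 4) * exp (l * t))"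
        using energy[OF tr t0(1) sol eq, of t0 t] I False t by simp
      also have "(norm (x t0))\<^sup>2 \<le> K\<^sup>2" using K[of t0] init[of t0] t0 by (simp add: power_mono)
      finally have "(norm (x t))\<^sup>2 \<le> (K\<^sup>2 + 2 * L * T) + (M / 2) * exp (l * t)" by simp
      then have "N t \<le> exp (- l * t) * ((K\<^sup>2 + 2 * L * T) + (M / 2) * exp (l * t))"
        unfolding N_def by (intro mult_left_mono) auto
      also have "\<dots> = exp (- l * t) * (K\<^sup>2 + 2 * L * T) + M / 2" by (simp add: algebra_simps exp_minus)
      also have "\<dots> \<le> 1 * (K\<^sup>2 + 2 * L * T) + M / 2"
        using l t L T by (intro add_right_mono mult_right_mono) auto
      finally show ?thesis by simp
    qed
    have "(SUP r\<in>{0..T}. N r) \<le> K\<^sup>2 + 2 * L * T + M / 2"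
      by (rule cSUP_least) (use main T in auto)
    then have "M \<le> K\<^sup>2 + 2 * L * T + M / 2" unfolding M_def[symmetric] .
    then have "M \<le> M0" by (simp add: M0_def)
    have "(norm (x t))\<^sup>2 \<le> M * exp (l * t)" by (rule sq[OF t])
    also have "\<dots> \<le> M0 * exp (l * T)" using \<open>M \<le> M0\<close> M0 t l by (intro mult_mono) auto
    finally show ?thesis unfolding R_def by (rule real_le_rsqrt)
  qed
  define C where "C = (R\<^sup>2 + 2 * (L * (1 + R) * R * T)) / c"
  show thesis
  proof (rule that[of R C])
    show "R \<ge> 0" by fact
    show "C \<ge> 0" using R0 L T c by (simp add: C_def)
    show "norm (x t) \<le> R" if "x \<in> trajectories j A T p q L t0 x0" "t \<in> {0..T}" for x t
      using that bound by (auto simp: trajectories_def)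
    fix x f \<xi> w
    assume tr: "is_trajectory j A T p q L t0 x0 x f" and sol: "integral_solution j p q t0 T x \<xi> w"
      and eq: "AE t in lebesgue_on {t0<..<T}. w t + A t (\<xi> t) = dual_embed j (f t)"
    have "AE t in lebesgue_on {t0<..<T}. norm (f t) \<le> L * (1 + R)"
      by (rule forcing_bound[OF tr L t0(1)]) (rule bound[OF tr])
    then have "AE r in lebesgue_on {t0<..<T}. f r \<bullet> x r \<le> L * (1 + R) * R"
      using AE_space_open[of t0 T]
    proof eventually_elim
      case (elim r)
      have "f r \<bullet> x r \<le> norm (f r) * norm (x r)" by (rule norm_cauchy_schwarz)
      also have "\<dots> \<le> (L * (1 + R)) * R"
      proof (rule mult_mono)
        show "norm (f r) \<le> L * (1 + R)" by (rule elim(1))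
        show "norm (x r) \<le> R" by (rule bound[OF tr]) (use elim t0 in auto)
      qed (use L R0 in auto)
      finally show ?case .
    qed
    then have "integral {t0..T} (\<lambda>r. f r \<bullet> x r) \<le> integral {t0..T} (\<lambda>r. L * (1 + R) * R)"
      by (intro integral_bound_real int[OF tr sol] absolutely_integrable_const)
    also have "\<dots> = (T - t0) * (L * (1 + R) * R)" using t0 by simp
    also have "\<dots> \<le> T * (L * (1 + R) * R)" using t0 L R0 by (intro mult_right_mono) auto
    finally have I: "integral {t0..T} (\<lambda>r. f r \<bullet> x r) \<le> L * (1 + R) * R * T" by (simp add: mult.commute)
    have "(norm (x t0))\<^sup>2 \<le> R\<^sup>2" using bound[OF tr, of t0] t0 by (simp add: power_mono)
    moreover have "0 \<le> (norm (x T))\<^sup>2" by simp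
    ultimately have "c * integral {t0..T} (\<lambda>r. norm (\<xi> r) powr p) \<le> R\<^sup>2 + 2 * (L * (1 + R) * R * T)"
      using energy[OF tr t0(1) sol eq, of t0 T] t0 I by linarith
    then show "integral {t0..T} (\<lambda>r. norm (\<xi> r) powr p) \<le> C"
      using c by (simp add: C_def pos_le_divide_eq mult.commute)
  qed
qed

text \<open>The increment tested with \<open>v\<close> is an integral of \<open>w v\<close>, where
  \<open>|w|\<close> is at most a constant plus \<open>|a1| + c1
  |\<xi>|\<^sup>p\<^sup>-\<^sup>1\<close>. The \<open>q\<close>-th powers of the last two terms have
  bounded integrals, because \<open>(p - 1) q = p\<close>, so by \<open>linear_le_small_powr\<close>
  their integrals over short intervals are uniformly small.\<close>

lemma trajectories_weakly_equicontinuous: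
  assumes L: "L \<ge> 0" and t0: "0 \<le> t0" "t0 < T" and x0: "x0 \<in> paths T" and e: "e > 0"
  obtains d where "d > 0" "\<And>x s t. x \<in> trajectories j A T p q L t0 x0 \<Longrightarrow> t0 \<le> s \<Longrightarrow> s \<le> t \<Longrightarrow> t \<le> T \<Longrightarrow>
      t - s < d \<Longrightarrow> \<bar>(x t - x s) \<bullet> j v\<bar> < e"
proof -
  obtain R C where R: "R \<ge> 0" and C: "C \<ge> 0"
    and xR: "\<And>x t. x \<in> trajectories j A T p q L t0 x0 \<Longrightarrow> t \<in> {0..T} \<Longrightarrow> norm (x t) \<le> R"
    and \<xi>C: "\<And>x f \<xi> w. is_trajectory j A T p q L t0 x0 x f \<Longrightarrow> integral_solution j p q t0 T x \<xi> w \<Longrightarrow>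
      AE t in lebesgue_on {t0<..<T}. w t + A t (\<xi> t) = dual_embed j (f t) \<Longrightarrow>
      integral {t0..T} (\<lambda>r. norm (\<xi> r) powr p) \<le> C"
    by (rule trajectories_bounds[OF L t0 x0]) (rule that; assumption)
  obtain a1 c1 where a1: "bochner_Lp q 0 T (a1 :: real \<Rightarrow> real)" and c1: "c1 \<ge> 0"
    and growth: "AE t in lebesgue_on {0..T}. \<forall>x. norm (A t x) \<le> a1 t + c1 * norm x powr (p - 1)"
    using operator unfolding admissible_operator_def by blast
  have a1i: "(\<lambda>t. norm (a1 t) powr q) absolutely_integrable_on {t0..T}"
    by (rule absolutely_integrable_sub[OF bochner_Lp_powr[OF a1]]) (use t0 in auto)
  define I where "I = integral {t0..T} (\<lambda>t. norm (a1 t) powr q)"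
  have I: "I \<ge> 0" unfolding I_def
    by (intro Henstock_Kurzweil_Integration.integral_nonneg abs_int_imp_int[OF a1i]) auto
  define V where "V = norm v + 1"
  have V: "V > 0" by (simp add: V_def add_nonneg_pos)
  \<comment> \<open>\<open>l\<close> makes the contribution of \<open>a1\<close> and \<open>\<xi>\<close> at most \<open>e / 2\<close>; below, \<open>d\<close> does the same for the constant part \<open>B\<close>\<close>
  define l where "l = e / (2 * V * (I + c1 * C + 1))"
  have pos: "I + c1 * C + 1 > 0" using I c1 C by (simp add: add_nonneg_pos)
  have l: "l > 0" unfolding l_def using e V pos by simp
  obtain D where D: "D \<ge> 0" "\<And>y. y \<ge> 0 \<Longrightarrow> y \<le> l * y powr q + D"
    using linear_le_small_powr[OF q l] by blast
  define B where "B = L * (1 + R) * norm j + D + c1 * D + 1"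
  have B: "B > 0" using L R D c1 by (simp add: B_def add_nonneg_pos)
  define d where "d = e / (2 * V * B)"
  have d: "d > 0" using e V B by (simp add: d_def)
  show thesis
  proof (rule that[OF d])
    fix x s t assume "x \<in> trajectories j A T p q L t0 x0" and st: "t0 \<le> s" "s \<le> t" "t \<le> T" "t - s < d"
    then obtain f where tr: "is_trajectory j A T p q L t0 x0 x f" by (auto simp: trajectories_def)
    have xX: "x \<in> trajectories j A T p q L t0 x0" by fact
    obtain \<xi> w where sol: "integral_solution j p q t0 T x \<xi> w"
      and eq: "AE t in lebesgue_on {t0<..<T}. w t + A t (\<xi> t) = dual_embed j (f t)"
      by (rule is_trajectory_integral_solution[OF tr t0]) (use q in auto)
    have \<xi>: "bochner_Lp p t0 T \<xi>" and w: "bochner_Lp q t0 T w" using sol by (auto simp: integral_solution_def)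
    define g where "g r = l * norm (a1 r) powr q + (c1 * l) * norm (\<xi> r) powr p + B" for r
    have gi: "g absolutely_integrable_on {t0..T}" unfolding g_def
      by (intro set_integral_add set_integrable_mult_right a1i bochner_Lp_powr[OF \<xi>] absolutely_integrable_const)
    have fb: "AE t in lebesgue_on {t0<..<T}. norm (f t) \<le> L * (1 + R)"
      by (rule forcing_bound[OF tr L t0(1)]) (rule xR[OF xX])
    have wg: "AE r in lebesgue_on {t0<..<T}. norm (w r) \<le> g r"
      using eq AE_operator[OF growth t0(1)] fb
    proof eventually_elim
      case (elim r)
      have "w r = dual_embed j (f r) - A r (\<xi> r)" using elim(1) by (simp add: eq_diff_eq)
      then have "norm (w r) \<le> norm (dual_embed j (f r)) + norm (A r (\<xi> r))" by (simp add: norm_triangle_ineq4)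
      also have "norm (dual_embed j (f r)) \<le> norm (f r) * norm j"
      proof (rule norm_blinfun_bound)
        show "norm (blinfun_apply (dual_embed j (f r)) v) \<le> norm (f r) * norm j * norm v" for v
        proof -
          have "norm (blinfun_apply (dual_embed j (f r)) v) = \<bar>f r \<bullet> j v\<bar>" by (simp add: dual_embed_def inner_commute)
          also have "\<dots> \<le> norm (f r) * norm (j v)" by (rule Cauchy_Schwarz_ineq2)
          also have "\<dots> \<le> norm (f r) * (norm j * norm v)" by (intro mult_left_mono norm_blinfun) auto
          finally show ?thesis by (simp add: mult.assoc)
        qed
      qed simp
      also have "norm (f r) * norm j \<le> L * (1 + R) * norm j" using elim(3) by (intro mult_right_mono) auto
      also have "norm (A r (\<xi> r)) \<le> a1 r + c1 * norm (\<xi> r) powr (p - 1)" using elim(2) by blast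
      also have "a1 r \<le> norm (a1 r)" by simp
      also have "norm (a1 r) \<le> l * norm (a1 r) powr q + D" by (rule D) simp
      also have "norm (\<xi> r) powr (p - 1) \<le> l * (norm (\<xi> r) powr (p - 1)) powr q + D" by (rule D) simp
      also have "(norm (\<xi> r) powr (p - 1)) powr q = norm (\<xi> r) powr p" by (simp add: powr_powr conj_exponent)
      finally have "norm (w r) \<le> L * (1 + R) * norm j + (l * norm (a1 r) powr q + D + c1 * (l * norm (\<xi> r) powr p + D))"
        using c1 by (simp add: mult_left_mono)
      then show ?case by (simp add: g_def B_def algebra_simps)
    qed
    have wi: "(\<lambda>r. w r v) absolutely_integrable_on {t0..T}"
      by (rule apply_absolutely_integrable[OF w]) (use q in auto)
    have V0: "(\<lambda>r. V * g r) absolutely_integrable_on {t0..T}" by (intro set_integrable_mult_right gi)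
    have abs: "AE r in lebesgue_on {t0<..<T}. \<bar>w r v\<bar> \<le> V * g r"
      using wg
    proof eventually_elim
      case (elim r)
      have "\<bar>w r v\<bar> \<le> norm (w r) * norm v" using norm_blinfun[of "w r" v] by simp
      also have "\<dots> \<le> g r * V" using elim by (intro mult_mono) (auto simp: V_def order_trans[OF norm_ge_zero])
      finally show ?case by (simp add: mult.commute)
    qed
    have absi: "(\<lambda>r. \<bar>w r v\<bar>) absolutely_integrable_on {t0..T}"
      using absolutely_integrable_norm[OF wi] by (simp add: o_def)
    have sub: "k absolutely_integrable_on {s..t}" if "k absolutely_integrable_on {t0..T}" for k :: "real \<Rightarrow> real"
      by (rule absolutely_integrable_sub[OF that]) (use st in auto)
    have "\<bar>integral {s..t} (\<lambda>r. w r v)\<bar> \<le> integral {s..t} (\<lambda>r. \<bar>w r v\<bar>)"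
      using integral_norm_bound_integral[OF abs_int_imp_int[OF sub[OF wi]]
          abs_int_imp_int[OF sub[OF absi]]] by simp
    also have "\<dots> \<le> integral {s..t} (\<lambda>r. V * g r)"
      by (intro integral_bound_real sub absi V0 AE_subinterval[OF abs] st)
    also have "\<dots> = V * integral {s..t} g" by simp
    also have "integral {s..t} g \<le> l * I + c1 * l * C + B * (t - s)"
    proof -
      have X: "(\<lambda>r. norm (\<xi> r) powr p) absolutely_integrable_on {t0..T}" by (rule bochner_Lp_powr[OF \<xi>])
      have "(g has_integral l * integral {s..t} (\<lambda>r. norm (a1 r) powr q) + (c1 * l) * integral {s..t} (\<lambda>r. norm (\<xi> r) powr p)
          + (t - s) *\<^sub>R B) {s..t}"
        unfolding g_def
        by (intro has_integral_add has_integral_mult_right integrable_integral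
            abs_int_imp_int[OF sub[OF a1i]] abs_int_imp_int[OF sub[OF X]])
          (use has_integral_const_real[of B s t] st in auto)
      then have "integral {s..t} g = l * integral {s..t} (\<lambda>r. norm (a1 r) powr q)
          + (c1 * l) * integral {s..t} (\<lambda>r. norm (\<xi> r) powr p) + B * (t - s)"
        by (simp add: integral_unique mult.commute)
      moreover have "integral {s..t} (\<lambda>r. norm (a1 r) powr q) \<le> I" unfolding I_def
        by (rule integral_subset_le) (use st abs_int_imp_int[OF sub[OF a1i]]
          abs_int_imp_int[OF a1i] in auto)
      moreover have "integral {s..t} (\<lambda>r. norm (\<xi> r) powr p) \<le> C"
        by (rule order_trans[OF integral_subset_le \<xi>C[OF tr sol eq]]) (use st abs_int_imp_int[OF sub[OF X]]
          abs_int_imp_int[OF X] in auto)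
      ultimately show ?thesis using l c1 by (simp add: add_mono mult_left_mono)
    qed
    also have "V * (l * I + c1 * l * C + B * (t - s)) < e"
    proof -
      have "V * (l * (I + c1 * C)) \<le> V * (l * (I + c1 * C + 1))" using V l by simp
      also have "\<dots> = e / 2" using V pos by (simp add: l_def)
      finally have "V * (l * (I + c1 * C)) \<le> e / 2" .
      moreover have "V * (B * (t - s)) < V * (B * d)" using st V B by simp
      moreover have "V * (B * d) = e / 2" using V B by (simp add: d_def)
      ultimately show ?thesis by (simp add: algebra_simps)
    qed
    finally have "\<bar>integral {s..t} (\<lambda>r. w r v)\<bar> < e" using V by simp
    then show "\<bar>(x t - x s) \<bullet> j v\<bar> < e" using sol st by (simp add: integral_solution_def)
  qed
qed

section \<open>Compactness of the set of trajectories\<close>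

text \<open>The inequality of Ehrling type at almost every time, integrated.\<close>

lemma trajectories_L1_distance:
  assumes t0: "0 \<le> t0" "t0 < T"
    and xX: "x \<in> trajectories j A T p q L t0 x0" and yX: "y \<in> trajectories j A T p q L t0 x0"
    and C: "\<And>x f \<xi> w. is_trajectory j A T p q L t0 x0 x f \<Longrightarrow> integral_solution j p q t0 T x \<xi> w \<Longrightarrow>
      AE t in lebesgue_on {t0<..<T}. w t + A t (\<xi> t) = dual_embed j (f t) \<Longrightarrow>
      integral {t0..T} (\<lambda>r. norm (\<xi> r) powr p) \<le> C"
    and B: "\<And>v. norm (j v) \<le> \<delta> * norm v + (\<Sum>b\<in>B. \<bar>j v \<bullet> j b\<bar>) / \<delta>" and \<delta>: "\<delta> > 0"
    and e: "\<And>b t. b \<in> B \<Longrightarrow> t \<in> {t0..T} \<Longrightarrow> \<bar>(x t - y t) \<bullet> j b\<bar> \<le> e"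
  shows "integral {t0..T} (\<lambda>t. norm (x t - y t)) \<le> \<delta> * (2 * (T + C)) + T * (real (card B) * e / \<delta>)"
proof -
  obtain f g where tr_x: "is_trajectory j A T p q L t0 x0 x f" and tr_y: "is_trajectory j A T p q L t0 x0 y g"
    using xX yX by (auto simp: trajectories_def)
  obtain \<xi> w where sx: "integral_solution j p q t0 T x \<xi> w"
    and ex: "AE t in lebesgue_on {t0<..<T}. w t + A t (\<xi> t) = dual_embed j (f t)"
    by (rule is_trajectory_integral_solution[OF tr_x t0]) (use q in auto)
  obtain \<eta> z where sy: "integral_solution j p q t0 T y \<eta> z"
    and ey: "AE t in lebesgue_on {t0<..<T}. z t + A t (\<eta> t) = dual_embed j (g t)"
    by (rule is_trajectory_integral_solution[OF tr_y t0]) (use q in auto)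
  have cx: "continuous_on {t0..T} x" and cy: "continuous_on {t0..T} y"
    and \<xi>: "bochner_Lp p t0 T \<xi>" and \<eta>: "bochner_Lp p t0 T \<eta>"
    and xe: "AE t in lebesgue_on {t0<..<T}. x t = j (\<xi> t)" and ye: "AE t in lebesgue_on {t0<..<T}. y t = j (\<eta> t)"
    using sx sy by (auto simp: integral_solution_def)
  have n\<xi>: "(\<lambda>t. norm (\<xi> t)) absolutely_integrable_on {t0..T}" by (rule bochner_Lp_norm[OF \<xi>]) (use p in auto)
  have n\<eta>: "(\<lambda>t. norm (\<eta> t)) absolutely_integrable_on {t0..T}" by (rule bochner_Lp_norm[OF \<eta>]) (use p in auto)
  have one: "integral {t0..T} (\<lambda>t. norm (\<zeta> t)) \<le> T + C"
    if \<zeta>: "bochner_Lp p t0 T \<zeta>" and "integral {t0..T} (\<lambda>t. norm (\<zeta> t) powr p) \<le> C" for \<zeta> :: "real \<Rightarrow> 'v"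
  proof -
    have "integral {t0..T} (\<lambda>t. norm (\<zeta> t)) \<le> integral {t0..T} (\<lambda>t. 1 + norm (\<zeta> t) powr p)"
      by (intro integral_bound_real bochner_Lp_norm[OF \<zeta>] set_integral_add absolutely_integrable_const bochner_Lp_powr[OF \<zeta>])
        (use p le_one_add_powr in auto)
    also have "\<dots> = (T - t0) + integral {t0..T} (\<lambda>t. norm (\<zeta> t) powr p)"
      using Henstock_Kurzweil_Integration.integral_add[OF integrable_const_ivl
          abs_int_imp_int[OF bochner_Lp_powr[OF \<zeta>]], of "1::real"] t0 by simp
    finally show ?thesis using that(2) t0 by simp
  qed
  define K where "K = real (card B) * e / \<delta>"
  have "AE t in lebesgue_on {t0<..<T}. norm (x t - y t) \<le> \<delta> * (norm (\<xi> t) + norm (\<eta> t)) + K"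
    using xe ye AE_space_open[of t0 T]
  proof eventually_elim
    case (elim t)
    have eq: "x t - y t = j (\<xi> t - \<eta> t)" using elim by (simp add: blinfun.diff_right)
    have "norm (x t - y t) \<le> \<delta> * norm (\<xi> t - \<eta> t) + (\<Sum>b\<in>B. \<bar>(x t - y t) \<bullet> j b\<bar>) / \<delta>"
      unfolding eq by (rule B)
    also have "(\<Sum>b\<in>B. \<bar>(x t - y t) \<bullet> j b\<bar>) \<le> real (card B) * e"
    proof (rule sum_bounded_above)
      fix b assume "b \<in> B"
      then show "\<bar>(x t - y t) \<bullet> j b\<bar> \<le> e" by (rule e) (use elim(3) in auto)
    qed
    also have "norm (\<xi> t - \<eta> t) \<le> norm (\<xi> t) + norm (\<eta> t)" by (rule norm_triangle_ineq4)
    finally show ?case using \<delta> by (simp add: K_def divide_right_mono mult_left_mono)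
  qed
  then have "integral {t0..T} (\<lambda>t. norm (x t - y t)) \<le> integral {t0..T} (\<lambda>t. \<delta> * (norm (\<xi> t) + norm (\<eta> t)) + K)"
    by (intro integral_bound_real absolutely_integrable_continuous_real continuous_intros cx cy
        set_integral_add set_integrable_mult_right n\<xi> n\<eta> absolutely_integrable_const)
  also have "\<dots> = \<delta> * (integral {t0..T} (\<lambda>t. norm (\<xi> t)) + integral {t0..T} (\<lambda>t. norm (\<eta> t))) + (T - t0) * K"
  proof -
    have "((\<lambda>t. \<delta> * (norm (\<xi> t) + norm (\<eta> t)) + K) has_integral
      \<delta> * (integral {t0..T} (\<lambda>t. norm (\<xi> t)) + integral {t0..T} (\<lambda>t. norm (\<eta> t))) + (T - t0) *\<^sub>R K) {t0..T}"
      by (intro has_integral_add has_integral_mult_right integrable_integral abs_int_imp_int[OF n\<xi>]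
          abs_int_imp_int[OF n\<eta>])
        (use has_integral_const_real[of K t0 T] t0 in auto)
    then show ?thesis by (simp add: integral_unique)
  qed
  also have "\<dots> \<le> \<delta> * ((T + C) + (T + C)) + T * K"
  proof (intro add_mono mult_left_mono mult_right_mono)
    show "integral {t0..T} (\<lambda>t. norm (\<xi> t)) \<le> T + C" by (rule one[OF \<xi> C[OF tr_x sx ex]])
    show "integral {t0..T} (\<lambda>t. norm (\<eta> t)) \<le> T + C" by (rule one[OF \<eta> C[OF tr_y sy ey]])
    have "real (card B) * e \<ge> 0"
    proof (cases "B = {}")
      case False
      then obtain b where "b \<in> B" by blast
      from e[OF this, of t0] t0 have "e \<ge> 0" by auto
      then show ?thesis by simp
    qed simp
    then show "K \<ge> 0" using \<delta> by (simp add: K_def)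
  qed (use \<delta> t0 in auto)
  finally show ?thesis by (simp add: K_def)
qed

text \<open>Two trajectories from the same initial path coincide at \<open>t0\<close>, and their
  forcing terms are bounded; the energy inequality for the difference leaves only the integral of
  \<open>|x - y|\<close>.\<close>

lemma trajectories_sup_distance:
  assumes t0: "0 \<le> t0" "t0 < T" and L: "L \<ge> 0"
    and xX: "x \<in> trajectories j A T p q L t0 x0" and yX: "y \<in> trajectories j A T p q L t0 x0"
    and R: "\<And>x t. x \<in> trajectories j A T p q L t0 x0 \<Longrightarrow> t \<in> {0..T} \<Longrightarrow> norm (x t) \<le> R"
    and t: "t \<in> {0..T}"
  shows "(norm (x t - y t))\<^sup>2 \<le> 4 * L * (1 + R) * integral {t0..T} (\<lambda>t. norm (x t - y t))"
proof -
  obtain f g where tr_x: "is_trajectory j A T p q L t0 x0 x f" and tr_y: "is_trajectory j A T p q L t0 x0 y g"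
    using xX yX by (auto simp: trajectories_def)
  have px: "x \<in> paths T" "y \<in> paths T" and init: "\<And>t. t \<in> {0..t0} \<Longrightarrow> x t = y t"
    using tr_x tr_y by (auto simp: is_trajectory_def)
  have c: "continuous_on {t0..T} (\<lambda>t. norm (x t - y t))"
    by (intro continuous_intros continuous_on_subset[OF pathsD]) (use px t0 in auto)
  have R0: "R \<ge> 0" using R[OF xX, of 0] T by (auto intro: order_trans[OF norm_ge_zero])
  define K where "K = 2 * L * (1 + R)"
  have K: "K \<ge> 0" using L R0 by (simp add: K_def)
  have I0: "integral {t0..T} (\<lambda>t. norm (x t - y t)) \<ge> 0"
    by (intro Henstock_Kurzweil_Integration.integral_nonneg integrable_continuous_interval c) auto
  show ?thesis
  proof (cases "t \<le> t0")
    case True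
    then show ?thesis using init[of t] t I0 L R0 by simp
  next
    case False
    have fb: "AE t in lebesgue_on {t0<..<T}. norm (f t) \<le> L * (1 + R)"
      by (rule forcing_bound[OF tr_x L t0(1)]) (rule R[OF xX])
    have gb: "AE t in lebesgue_on {t0<..<T}. norm (g t) \<le> L * (1 + R)"
      by (rule forcing_bound[OF tr_y L t0(1)]) (rule R[OF yX])
    have le: "AE r in lebesgue_on {t0<..<T}. (f r - g r) \<bullet> (x r - y r) \<le> K * norm (x r - y r)"
      using fb gb
    proof eventually_elim
      case (elim r)
      have "(f r - g r) \<bullet> (x r - y r) \<le> norm (f r - g r) * norm (x r - y r)" by (rule norm_cauchy_schwarz)
      also have "\<dots> \<le> K * norm (x r - y r)"
        using norm_triangle_ineq4[of "f r" "g r"] elim by (intro mult_right_mono) (auto simp: K_def)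
      finally show ?case .
    qed
    have "(norm (x t - y t))\<^sup>2 - (norm (x t0 - y t0))\<^sup>2 \<le> 2 * integral {t0..t} (\<lambda>r. (f r - g r) \<bullet> (x r - y r))"
      by (rule energy_inequality_difference(2)[OF tr_x tr_y t0]) (use False t in auto)
    also have "integral {t0..t} (\<lambda>r. (f r - g r) \<bullet> (x r - y r)) \<le> integral {t0..t} (\<lambda>r. K * norm (x r - y r))"
      by (intro integral_bound_real AE_subinterval[OF le] absolutely_integrable_sub[OF
            energy_inequality_difference(1)[OF tr_x tr_y t0 order_refl _ order_refl]]
            set_integrable_mult_right absolutely_integrable_continuous_real continuous_on_subset[OF c])
        (use t t0 in auto)
    also have "\<dots> = K * integral {t0..t} (\<lambda>r. norm (x r - y r))" by simp
    also have "integral {t0..t} (\<lambda>r. norm (x r - y r)) \<le> integral {t0..T} (\<lambda>r. norm (x r - y r))"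
      by (rule integral_subset_le) (use t in \<open>auto intro!: integrable_continuous_interval continuous_on_subset[OF c]\<close>)
    finally have "(norm (x t - y t))\<^sup>2 \<le> 2 * (K * integral {t0..T} (\<lambda>r. norm (x r - y r)))"
      using init[of t0] t0 K by (simp add: mult_left_mono)
    then show ?thesis by (simp add: K_def mult.assoc)
  qed
qed

text \<open>A diagonal sequence converges when tested at rational times with the countably many
  vectors of all the Ehrling nets. Weak equicontinuity makes this uniform in time,
  \<open>trajectories_L1_distance\<close> yields a Cauchy sequence in the mean, and
  \<open>trajectories_sup_distance\<close> a uniform Cauchy sequence.\<close>

lemma trajectories_seq_compact:
  fixes xs :: "nat \<Rightarrow> real \<Rightarrow> 'h"
  assumes K: "compact (closure (j ` cball 0 1))"
    and L: "L \<ge> 0" and t0: "0 \<le> t0" "t0 < T" and x0: "x0 \<in> paths T"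
    and xs: "\<And>n. xs n \<in> trajectories j A T p q L t0 x0"
  obtains k x where "strict_mono (k :: nat \<Rightarrow> nat)" "x \<in> paths T"
    "uniform_limit {0..T} (\<lambda>n. xs (k n)) x sequentially"
proof -
  let ?X = "trajectories j A T p q L t0 x0"
  obtain R C where R: "R \<ge> 0" and C: "C \<ge> 0"
    and xR: "\<And>x t. x \<in> ?X \<Longrightarrow> t \<in> {0..T} \<Longrightarrow> norm (x t) \<le> R"
    and \<xi>C: "\<And>x f \<xi> w. is_trajectory j A T p q L t0 x0 x f \<Longrightarrow> integral_solution j p q t0 T x \<xi> w \<Longrightarrow>
      AE t in lebesgue_on {t0<..<T}. w t + A t (\<xi> t) = dual_embed j (f t) \<Longrightarrow>
      integral {t0..T} (\<lambda>r. norm (\<xi> r) powr p) \<le> C"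
    by (rule trajectories_bounds[OF L t0 x0]) (rule that; assumption)
  define \<delta> where "\<delta> m = 1 / real (m + 1)" for m :: nat
  have \<delta>: "\<delta> m > 0" for m by (simp add: \<delta>_def)
  have "\<exists>B. finite B \<and> (\<forall>v. norm (j v) \<le> \<delta> m * norm v + (\<Sum>b\<in>B. \<bar>j v \<bullet> j b\<bar>) / \<delta> m)" for m
    by (rule compact_embedding_Ehrling[OF K \<delta>[of m]]) blast
  then obtain B where B: "\<And>m. finite (B m)"
    "\<And>m v. norm (j v) \<le> \<delta> m * norm v + (\<Sum>b\<in>B m. \<bar>j v \<bullet> j b\<bar>) / \<delta> m" by metis
  define D where "D = (\<Union>m. B m)"
  define Q where "Q = {t0..T} \<inter> \<rat>"
  have cD: "countable (Q \<times> D)"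
    unfolding D_def Q_def using B(1) by (intro countable_SIGMA countable_UN countable_Int2 countable_rat) (auto intro: countable_finite)
  have "norm (case z of (t, v) \<Rightarrow> (xs n t \<bullet> j v) / (1 + norm (j v))) \<le> R" if "z \<in> Q \<times> D" for n z
  proof -
    obtain t v where z: "z = (t, v)" by force
    have "t \<in> {0..T}" using that z t0 by (auto simp: Q_def)
    have "\<bar>xs n t \<bullet> j v\<bar> \<le> norm (xs n t) * norm (j v)" by (rule Cauchy_Schwarz_ineq2)
    also have "\<dots> \<le> R * (1 + norm (j v))" by (intro mult_mono xR xs \<open>t \<in> {0..T}\<close> R) auto
    finally show ?thesis by (simp add: z abs_divide divide_le_eq add_pos_nonneg)
  qed
  then obtain k where k: "strict_mono (k :: nat \<Rightarrow> nat)"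
    "\<And>z. z \<in> Q \<times> D \<Longrightarrow> \<exists>l. (\<lambda>n. case z of (t, v) \<Rightarrow> (xs (k n) t \<bullet> j v) / (1 + norm (j v))) \<longlonglongrightarrow> l"
    using function_convergent_subsequence[OF cD, where f="\<lambda>n z. case z of (t, v) \<Rightarrow> (xs n t \<bullet> j v) / (1 + norm (j v))"]
    by blast
  define y where "y n = xs (k n)" for n
  have yX: "y n \<in> ?X" for n by (simp add: y_def xs)
  have conv: "\<exists>l. (\<lambda>n. y n t \<bullet> j v) \<longlonglongrightarrow> l" if tv: "t \<in> Q" "v \<in> D" for t v
  proof -
    obtain l where "(\<lambda>n. (y n t \<bullet> j v) / (1 + norm (j v))) \<longlonglongrightarrow> l"
      using k(2)[of "(t, v)"] tv by (auto simp: y_def)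
    from tendsto_mult[OF this tendsto_const[of "1 + norm (j v)"]]
    have "(\<lambda>n. (y n t \<bullet> j v) / (1 + norm (j v)) * (1 + norm (j v))) \<longlonglongrightarrow> l * (1 + norm (j v))" .
    moreover have "1 + norm (j v) \<noteq> 0" using norm_ge_zero[of "j v"] by linarith
    ultimately show ?thesis by auto
  qed
  have weak: "\<exists>N. \<forall>n\<ge>N. \<forall>m\<ge>N. \<forall>t\<in>{t0..T}. \<bar>(y n t - y m t) \<bullet> j v\<bar> \<le> e" if v: "v \<in> D" and e: "e > 0" for v e
  proof -
    obtain d where d: "d > 0" "\<And>x s t. x \<in> ?X \<Longrightarrow> t0 \<le> s \<Longrightarrow> s \<le> t \<Longrightarrow> t \<le> T \<Longrightarrow> t - s < d \<Longrightarrow> \<bar>(x t - x s) \<bullet> j v\<bar> < e / 4"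
      by (rule trajectories_weakly_equicontinuous[OF L t0 x0, of "e / 4"]) (use e in auto)
    have eqc: "\<bar>y n t \<bullet> j v - y n r \<bullet> j v\<bar> < e / 4" if "t \<in> {t0..T}" "r \<in> {t0..T}" "\<bar>t - r\<bar> < d" for n t r
    proof (cases "r \<le> t")
      case True
      then show ?thesis using d(2)[OF yX, of r t n] that by (simp add: inner_diff_left)
    next
      case False
      then show ?thesis using d(2)[OF yX, of t r n] that by (simp add: inner_diff_left abs_minus_commute)
    qed
    have "{t0..T} \<subseteq> (\<Union>r\<in>Q. ball r d)"
    proof
      fix t assume t: "t \<in> {t0..T}"
      have "max t0 (t - d) < min T (t + d)" using t t0 d(1) by auto
      then obtain r where "r \<in> \<rat>" "max t0 (t - d) < r" "r < min T (t + d)" using Rats_dense_in_real by blast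
      then show "t \<in> (\<Union>r\<in>Q. ball r d)" by (auto simp: Q_def dist_real_def intro!: bexI[of _ r])
    qed
    then obtain P where P: "P \<subseteq> Q" "finite P" "{t0..T} \<subseteq> (\<Union>r\<in>P. ball r d)"
      using compactE_image[of "{t0..T}" Q "\<lambda>r. ball r d"] by auto
    obtain l where l: "\<And>r. r \<in> Q \<Longrightarrow> (\<lambda>n. y n r \<bullet> j v) \<longlonglongrightarrow> l r" using conv[OF _ v] by metis
    have "\<forall>\<^sub>F n in sequentially. \<forall>r\<in>P. \<bar>y n r \<bullet> j v - l r\<bar> < e / 4"
    proof (rule eventually_ball_finite[OF P(2)], rule ballI)
      fix r assume "r \<in> P"
      with P(1) have "r \<in> Q" by blast
      from tendstoD[OF l[OF this], of "e / 4"] e show "\<forall>\<^sub>F n in sequentially. \<bar>y n r \<bullet> j v - l r\<bar> < e / 4"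
        by (simp add: dist_real_def)
    qed
    then obtain N where N: "\<And>n r. n \<ge> N \<Longrightarrow> r \<in> P \<Longrightarrow> \<bar>y n r \<bullet> j v - l r\<bar> < e / 4"
      by (auto simp: eventually_sequentially)
    show ?thesis
    proof (intro exI[of _ N] allI impI ballI)
      fix n m t assume nm: "n \<ge> N" "m \<ge> N" and t: "t \<in> {t0..T}"
      obtain r where r: "r \<in> P" "\<bar>r - t\<bar> < d" using P(3) t by (auto simp: dist_real_def)
      have "r \<in> {t0..T}" using r P(1) by (auto simp: Q_def)
      then show "\<bar>(y n t - y m t) \<bullet> j v\<bar> \<le> e"
        using eqc[OF t, of r n] eqc[OF t, of r m] N[OF nm(1) r(1)] N[OF nm(2) r(1)] r(2)
        unfolding inner_diff_left by linarith
    qed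
  qed
  have L1: "\<exists>N. \<forall>n\<ge>N. \<forall>m\<ge>N. integral {t0..T} (\<lambda>t. norm (y n t - y m t)) \<le> e" if e: "e > 0" for e
  proof -
    obtain m where m: "4 * (T + C) / e < real m" using reals_Archimedean2 by blast
    have TC: "T + C > 0" using T C by simp
    have 1: "\<delta> m * (2 * (T + C)) \<le> e / 2"
      using m e TC by (simp add: \<delta>_def field_simps)
    \<comment> \<open>the accuracy of the tests that compensates the factor \<open>card (B m) / \<delta> m\<close>\<close>
    define e' where "e' = e * \<delta> m / (2 * (T * (real (card (B m)) + 1)))"
    have e': "e' > 0" using e \<delta>[of m] T by (simp add: e'_def)
    have 2: "T * (real (card (B m)) * e' / \<delta> m) \<le> e / 2"
    proof -
      have "T * (real (card (B m)) * e' / \<delta> m) \<le> T * ((real (card (B m)) + 1) * e' / \<delta> m)"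
        using T e' \<delta>[of m] by (intro mult_left_mono divide_right_mono mult_right_mono) auto
      also have "\<dots> = e / 2"
      proof -
        have "real (card (B m)) + 1 \<noteq> 0" by linarith
        then show ?thesis using T \<delta>[of m] by (simp add: e'_def)
      qed
      finally show ?thesis .
    qed
    have "\<forall>\<^sub>F N in sequentially. \<forall>b\<in>B m. \<forall>n\<ge>N. \<forall>n'\<ge>N. \<forall>t\<in>{t0..T}. \<bar>(y n t - y n' t) \<bullet> j b\<bar> \<le> e'"
    proof (rule eventually_ball_finite[OF B(1)], rule ballI)
      fix b assume "b \<in> B m"
      then have "b \<in> D" by (auto simp: D_def)
      from weak[OF this e'] obtain N where "\<forall>n\<ge>N. \<forall>m\<ge>N. \<forall>t\<in>{t0..T}. \<bar>(y n t - y m t) \<bullet> j b\<bar> \<le> e'" ..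
      then show "\<forall>\<^sub>F N in sequentially. \<forall>n\<ge>N. \<forall>n'\<ge>N. \<forall>t\<in>{t0..T}. \<bar>(y n t - y n' t) \<bullet> j b\<bar> \<le> e'"
        unfolding eventually_sequentially by (meson order_trans)
    qed
    then obtain N where N: "\<And>b n n' t. b \<in> B m \<Longrightarrow> n \<ge> N \<Longrightarrow> n' \<ge> N \<Longrightarrow> t \<in> {t0..T} \<Longrightarrow> \<bar>(y n t - y n' t) \<bullet> j b\<bar> \<le> e'"
      unfolding eventually_sequentially by blast
    show ?thesis
    proof (intro exI[of _ N] allI impI)
      fix n n' assume nn: "n \<ge> N" "n' \<ge> N"
      have "integral {t0..T} (\<lambda>t. norm (y n t - y n' t)) \<le> \<delta> m * (2 * (T + C)) + T * (real (card (B m)) * e' / \<delta> m)"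
        by (rule trajectories_L1_distance[OF t0 yX yX \<xi>C B(2) \<delta>]) (assumption+, rule N[OF _ nn])
      then show "integral {t0..T} (\<lambda>t. norm (y n t - y n' t)) \<le> e" using 1 2 by linarith
    qed
  qed
  have "uniformly_Cauchy_on {0..T} y"
  proof (rule uniformly_Cauchy_onI)
    fix e :: real assume e: "e > 0"
    define M where "M = 4 * L * (1 + R) + 1"
    have M: "M > 0" using L R by (simp add: M_def add_nonneg_pos)
    have "e\<^sup>2 / (2 * M) > 0" using e M by simp
    from L1[OF this] obtain N where N: "\<And>n m. n \<ge> N \<Longrightarrow> m \<ge> N \<Longrightarrow> integral {t0..T} (\<lambda>t. norm (y n t - y m t)) \<le> e\<^sup>2 / (2 * M)"
      by blast
    show "\<exists>M. \<forall>x\<in>{0..T}. \<forall>m\<ge>M. \<forall>n\<ge>M. dist (y m x) (y n x) < e"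
    proof (intro exI[of _ N] ballI allI impI)
      fix t n m assume t: "t \<in> {0..T}" and nm: "n \<ge> N" "m \<ge> N"
      have "(norm (y n t - y m t))\<^sup>2 \<le> 4 * L * (1 + R) * integral {t0..T} (\<lambda>t. norm (y n t - y m t))"
        by (rule trajectories_sup_distance[OF t0 L yX[of n] yX[of m] _ t]) (rule xR)
      also have "\<dots> \<le> 4 * L * (1 + R) * (e\<^sup>2 / (2 * M))"
        using L R by (intro mult_left_mono N nm) auto
      also have "\<dots> \<le> M * (e\<^sup>2 / (2 * M))" using M by (intro mult_right_mono) (auto simp: M_def)
      also have "\<dots> = e\<^sup>2 / 2" using M by simp
      also have "\<dots> < e\<^sup>2" using e by simp
      finally show "dist (y n t) (y m t) < e" using e by (simp add: dist_norm power_less_imp_less_base)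
    qed
  qed
  then obtain l where l: "uniform_limit {0..T} y l sequentially"
    using Cauchy_uniformly_convergent uniformly_convergent_on_def by blast
  have "continuous_on {0..T} l"
    by (rule uniform_limit_theorem[OF _ l])
      (use yX in \<open>auto simp: trajectories_def is_trajectory_def paths_def intro!: always_eventually\<close>)
  then have path: "restrict l {0..T} \<in> paths T"
    unfolding paths_def using continuous_on_eq[of "{0..T}" l "restrict l {0..T}"] by auto
  have "uniform_limit {0..T} (\<lambda>n. xs (k n)) (restrict l {0..T}) sequentially"
    using l by (subst uniform_limit_cong'[of _ _ y _ l]) (auto simp: y_def)
  then show thesis by (rule that[OF k(1) path])
qed

lemma trajectories_equicontinuous:
  assumes K: "compact (closure (j ` cball 0 1))"
    and L: "L \<ge> 0" and t0: "0 \<le> t0" "t0 < T" and x0: "x0 \<in> paths T" and e: "e > 0"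
  obtains d where "d > 0" "\<And>x s t. x \<in> trajectories j A T p q L t0 x0 \<Longrightarrow> s \<in> {0..T} \<Longrightarrow> t \<in> {0..T} \<Longrightarrow>
      \<bar>t - s\<bar> < d \<Longrightarrow> norm (x t - x s) < e"
proof (rule ccontr)
  let ?X = "trajectories j A T p q L t0 x0"
  assume no: "\<not> thesis"
  have "\<exists>x s t. x \<in> ?X \<and> s \<in> {0..T} \<and> t \<in> {0..T} \<and> \<bar>t - s\<bar> < 1 / real (Suc n) \<and> norm (x t - x s) \<ge> e" for n
  proof (rule ccontr)
    assume n: "\<nexists>x s t. x \<in> ?X \<and> s \<in> {0..T} \<and> t \<in> {0..T} \<and> \<bar>t - s\<bar> < 1 / real (Suc n) \<and> norm (x t - x s) \<ge> e"
    have thesis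
    proof (rule that[of "1 / real (Suc n)"])
      fix x s t assume "x \<in> ?X" "s \<in> {0..T}" "t \<in> {0..T}" "\<bar>t - s\<bar> < 1 / real (Suc n)"
      then show "norm (x t - x s) < e" using n not_le by blast
    qed simp
    with no show False by contradiction
  qed
  then obtain xs s t where xs: "\<And>n. xs n \<in> ?X" "\<And>n::nat. s n \<in> {0..T}" "\<And>n. t n \<in> {0..T}"
    "\<And>n. \<bar>t n - s n\<bar> < 1 / real (Suc n)" "\<And>n. norm (xs n (t n) - xs n (s n)) \<ge> e" by metis
  obtain k x where k: "strict_mono (k :: nat \<Rightarrow> nat)" "x \<in> paths T"
    "uniform_limit {0..T} (\<lambda>n. xs (k n)) x sequentially"
    by (rule trajectories_seq_compact[OF K L t0 x0 xs(1)])
  have "e / 3 > 0" using e by simp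
  then obtain d where d: "d > 0" "\<And>s t. s \<in> {0..T} \<Longrightarrow> t \<in> {0..T} \<Longrightarrow> dist t s < d \<Longrightarrow> dist (x t) (x s) < e / 3"
    using paths_uniformly_continuous[OF k(2)] by blast
  have "\<forall>\<^sub>F n in sequentially. 1 / real (Suc n) < d"
    using order_tendstoD(2)[OF LIMSEQ_inverse_real_of_nat d(1)] by (simp add: inverse_eq_divide)
  then have "\<forall>\<^sub>F n in sequentially. 1 / real (Suc (k n)) < d"
    by (rule eventually_subseq[OF k(1)])
  moreover have "\<forall>\<^sub>F n in sequentially. \<forall>r\<in>{0..T}. dist (xs (k n) r) (x r) < e / 3"
    by (rule uniform_limitD[OF k(3)]) (use e in auto)
  ultimately have "\<forall>\<^sub>F n in sequentially. False"
  proof eventually_elim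
    case (elim n)
    have "dist (x (t (k n))) (x (s (k n))) < e / 3"
      using d(2)[OF xs(2,3), of "k n" "k n"] xs(4)[of "k n"] elim(1) by (simp add: dist_real_def)
    moreover have "dist (xs (k n) (t (k n))) (x (t (k n))) < e / 3" "dist (xs (k n) (s (k n))) (x (s (k n))) < e / 3"
      using elim(2) xs(2,3) by auto
    ultimately have "dist (xs (k n) (t (k n))) (xs (k n) (s (k n))) < e"
      using dist_triangle[of "xs (k n) (t (k n))" "xs (k n) (s (k n))" "x (t (k n))"]
        dist_triangle[of "x (t (k n))" "xs (k n) (s (k n))" "x (s (k n))"]
      by (simp add: dist_commute)
    then show False using xs(5)[of "k n"] by (simp add: dist_norm)
  qed
  then show False by simp
qed

end

section \<open>Sub- and supersolutions along trajectories\<close>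

lemma terminal_tendsto:
  assumes h: "terminal_continuous T h" and T: "T \<ge> 0" and x: "x \<in> paths T" "\<And>n. xs n \<in> paths T"
    and lim: "uniform_limit {0..T} xs x sequentially"
  shows "(\<lambda>n. h (xs n)) \<longlonglongrightarrow> h x"
proof (rule tendstoI)
  fix e :: real assume "e > 0"
  then obtain d where d: "d > 0" "\<And>y. y \<in> paths T \<Longrightarrow> dist_sup T x y < d \<Longrightarrow> \<bar>h x - h y\<bar> < e"
    using h x(1) unfolding terminal_continuous_def by meson
  have "\<forall>\<^sub>F n in sequentially. \<forall>r\<in>{0..T}. dist (xs n r) (x r) < d / 2"
    by (rule uniform_limitD[OF lim]) (use d in simp)
  then show "\<forall>\<^sub>F n in sequentially. dist (h (xs n)) (h x) < e"
  proof eventually_elim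
    case (elim n)
    have "dist_sup T x (xs n) \<le> d / 2" unfolding dist_sup_def
      by (rule cSUP_least) (use elim T in \<open>auto simp: dist_norm norm_minus_commute intro: less_imp_le\<close>)
    then have "\<bar>h x - h (xs n)\<bar> < e" using d(1) by (intro d(2) x(2)) auto
    then show ?case by (simp add: dist_real_def abs_minus_commute)
  qed
qed

lemma hamiltonian_tendsto:
  assumes F: "hamiltonian_continuous T F" and T: "T \<ge> 0" and x: "x \<in> paths T" "\<And>n. xs n \<in> paths T"
    and lim: "uniform_limit {0..T} xs x sequentially"
    and t: "t \<in> {0..T}" "\<And>n. ts n \<in> {0..T}" "ts \<longlonglongrightarrow> t"
  shows "(\<lambda>n. F (ts n) (xs n) z) \<longlonglongrightarrow> F t x z"
proof (rule tendstoI)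
  fix e :: real assume "e > 0"
  have "\<exists>d>0. \<forall>s\<in>{0..T}. \<forall>y\<in>paths T. \<forall>z'.
      d_infty T (t, x) (s, y) < d \<and> norm (z - z') < d \<longrightarrow> \<bar>F t x z - F s y z'\<bar> < e"
    using F[unfolded hamiltonian_continuous_def, rule_format, OF t(1) x(1) \<open>e > 0\<close>] by simp
  then obtain d where d: "d > 0" "\<And>s y z'. s \<in> {0..T} \<Longrightarrow> y \<in> paths T \<Longrightarrow>
      d_infty T (t, x) (s, y) < d \<and> norm (z - z') < d \<Longrightarrow> \<bar>F t x z - F s y z'\<bar> < e"
    by blast
  have "d / 4 > 0" using d by simp
  then obtain d' where d': "d' > 0" "\<And>s t. s \<in> {0..T} \<Longrightarrow> t \<in> {0..T} \<Longrightarrow> dist t s < d' \<Longrightarrow> dist (x t) (x s) < d / 4"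
    using paths_uniformly_continuous[OF x(1)] by blast
  have "\<forall>\<^sub>F n in sequentially. \<forall>r\<in>{0..T}. dist (xs n r) (x r) < d / 4"
    by (rule uniform_limitD[OF lim]) (use d in simp)
  moreover have "\<forall>\<^sub>F n in sequentially. dist (ts n) t < min d' (d / 4)"
    by (rule tendstoD[OF t(3)]) (use d d' in simp)
  ultimately show "\<forall>\<^sub>F n in sequentially. dist (F (ts n) (xs n) z) (F t x z) < e"
  proof eventually_elim
    case (elim n)
    have "(SUP r\<in>{0..T}. norm (x (min r t) - xs n (min r (ts n)))) \<le> d / 2"
    proof (rule cSUP_least)
      fix r assume r: "r \<in> {0..T}"
      have m: "min r t \<in> {0..T}" "min r (ts n) \<in> {0..T}" using r t(1) t(2)[of n] by auto
      have "dist (x (min r t)) (x (min r (ts n))) < d / 4"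
        by (rule d'(2)[OF m(2,1)]) (use elim(2) in \<open>auto simp: dist_real_def\<close>)
      moreover have "dist (xs n (min r (ts n))) (x (min r (ts n))) < d / 4" using elim(1) m by blast
      ultimately show "norm (x (min r t) - xs n (min r (ts n))) \<le> d / 2"
        using dist_triangle2[of "x (min r t)" "xs n (min r (ts n))" "x (min r (ts n))"] by (simp add: dist_norm)
    qed (use T in auto)
    then have "d_infty T (t, x) (ts n, xs n) < d"
      using elim(2) d(1) abs_minus_commute[of t "ts n"] by (simp add: d_infty_def dist_real_def)
    then have "\<bar>F t x z - F (ts n) (xs n) z\<bar> < e" using d(1) by (intro d(2) t(2) x(2)) auto
    then show ?case by (simp add: dist_real_def abs_minus_commute)
  qed
qed

lemma hamiltonian_continuous_time:
  assumes F: "hamiltonian_continuous T F" and T: "T \<ge> 0" and x: "x \<in> paths T"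
  shows "continuous_on {0..T} (\<lambda>s. F s x z)"
  unfolding continuous_on_sequentially o_def
proof (intro allI ballI impI)
  fix ts t assume "t \<in> {0..T}" "(\<forall>n. ts n \<in> {0..T}) \<and> ts \<longlonglongrightarrow> t"
  then show "(\<lambda>n. F (ts n) x z) \<longlonglongrightarrow> F t x z"
    using hamiltonian_tendsto[OF F T x, where xs="\<lambda>_. x" and t=t and ts=ts and z=z] x
    by (simp add: uniform_limit_const)
qed

lemma minimax_integrand_absolutely_integrable:
  fixes f :: "real \<Rightarrow> 'h::real_inner"
  assumes F: "hamiltonian_continuous T F" and T: "T \<ge> 0" and x: "x \<in> paths T"
    and f: "bochner_Lp 2 \<tau> T f" and t: "0 \<le> \<tau>" "t \<le> T"
  shows "(\<lambda>s. - (f s \<bullet> z) + F s x z) absolutely_integrable_on {\<tau>..t}"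
    and "(LINT s|lebesgue_on {\<tau>..t}. - (f s \<bullet> z) + F s x z) = integral {\<tau>..t} (\<lambda>s. - (f s \<bullet> z) + F s x z)"
proof -
  have "strongly_measurable (lebesgue_on {\<tau><..<T}) (\<lambda>_. - z)"
    unfolding strongly_measurable_def by (intro exI[of _ "\<lambda>_ _. - z"]) auto
  then have "(\<lambda>s. f s \<bullet> - z) absolutely_integrable_on {\<tau>..T}"
    by (intro inner_absolutely_integrable[OF f]) auto
  then have "(\<lambda>s. - (f s \<bullet> z)) absolutely_integrable_on {\<tau>..t}"
    using absolutely_integrable_sub[where f="\<lambda>s. f s \<bullet> - z" and a=\<tau> and b=T and s=\<tau> and t=t] t by simp
  moreover have "(\<lambda>s. F s x z) absolutely_integrable_on {\<tau>..t}"
    by (intro absolutely_integrable_continuous_real continuous_on_subset[OF hamiltonian_continuous_time[OF F T x]])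
      (use t in auto)
  ultimately show i: "(\<lambda>s. - (f s \<bullet> z) + F s x z) absolutely_integrable_on {\<tau>..t}"
    by (rule set_integral_add)
  show "(LINT s|lebesgue_on {\<tau>..t}. - (f s \<bullet> z) + F s x z) = integral {\<tau>..t} (\<lambda>s. - (f s \<bullet> z) + F s x z)"
    by (rule lebesgue_integral_eq_integral[OF absolutely_integrable_imp_integrable[OF i]]) auto
qed

locale minimax_pair = monotone_evolution j A T p q
  for j :: "'v::banach \<Rightarrow>\<^sub>L 'h::{real_inner, complete_space}" and A T p q +
  fixes F :: "real \<Rightarrow> (real \<Rightarrow> 'h) \<Rightarrow> 'h \<Rightarrow> real" and h :: "(real \<Rightarrow> 'h) \<Rightarrow> real" and L :: real
    and \<Omega> :: "(real \<Rightarrow> 'h) set" and u v :: "real \<Rightarrow> (real \<Rightarrow> 'h) \<Rightarrow> real"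
    and t0 :: real and x0 :: "real \<Rightarrow> 'h"
  assumes embedding: "compact (closure (j ` cball 0 1))"
    and terminal: "terminal_continuous T h" and hamiltonian: "admissible_hamiltonian j A T p q F"
    and L: "L \<ge> 0" and \<Omega>: "\<Omega> \<subseteq> paths T"
    and sub: "minimax_subsolution j A T p q F h L \<Omega> u"
    and super: "minimax_supersolution j A T p q F h L \<Omega> v"
    and t0: "0 \<le> t0" "t0 < T" and x0: "x0 \<in> \<Omega>"
begin

abbreviation X :: "(real \<Rightarrow> 'h) set" where
  "X \<equiv> trajectories j A T p q L t0 x0"

lemma x0_path: "x0 \<in> paths T" using x0 \<Omega> by blast

lemma X_paths: "x \<in> X \<Longrightarrow> x \<in> paths T"
  by (auto simp: trajectories_def is_trajectory_def)

lemma F_cont: "hamiltonian_continuous T F"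
  using hamiltonian by (simp add: admissible_hamiltonian_def)

lemma X_continue:
  assumes "x \<in> X" "is_trajectory j A T p q L t x y f" "t0 \<le> t" "t < T"
  shows "y \<in> X"
  using assms t0 q is_trajectory_concat[of j A T p q L t0 x0 x _ t y f]
  unfolding trajectories_def by auto

lemmas X_subsequence = trajectories_seq_compact[OF embedding L t0 x0_path]

text \<open>Otherwise two sequences of trajectories with vanishing distance would have a common
  uniform limit, at which \<open>h\<close> is continuous.\<close>

lemma terminal_uniformly_continuous:
  assumes e: "e > 0"
  obtains d where "d > 0" "\<And>x y. x \<in> X \<Longrightarrow> y \<in> X \<Longrightarrow> (\<And>t. t \<in> {0..T} \<Longrightarrow> norm (x t - y t) \<le> d) \<Longrightarrow> \<bar>h x - h y\<bar> < e"
proof (rule ccontr)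
  assume no: "\<not> thesis"
  have "\<exists>x y. x \<in> X \<and> y \<in> X \<and> (\<forall>t\<in>{0..T}. norm (x t - y t) \<le> inverse (real (Suc n))) \<and> \<bar>h x - h y\<bar> \<ge> e" for n
  proof (rule ccontr)
    assume n: "\<nexists>x y. x \<in> X \<and> y \<in> X \<and> (\<forall>t\<in>{0..T}. norm (x t - y t) \<le> inverse (real (Suc n))) \<and> \<bar>h x - h y\<bar> \<ge> e"
    have thesis
    proof (rule that[of "inverse (real (Suc n))"])
      fix x y assume "x \<in> X" "y \<in> X" "\<And>t. t \<in> {0..T} \<Longrightarrow> norm (x t - y t) \<le> inverse (real (Suc n))"
      then show "\<bar>h x - h y\<bar> < e" using n not_le by blast
    qed simp
    with no show False by contradiction
  qed
  then obtain xs ys where xs: "\<And>n. xs n \<in> X" "\<And>n. ys n \<in> X"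
    "\<And>n t. t \<in> {0..T} \<Longrightarrow> norm (xs n t - ys n t) \<le> inverse (real (Suc n))" "\<And>n::nat. \<bar>h (xs n) - h (ys n)\<bar> \<ge> e"
    by metis
  obtain k x where k: "strict_mono (k :: nat \<Rightarrow> nat)" "x \<in> paths T"
    "uniform_limit {0..T} (\<lambda>n. xs (k n)) x sequentially"
    by (rule X_subsequence[OF xs(1)])
  have ky: "uniform_limit {0..T} (\<lambda>n. ys (k n)) x sequentially"
  proof (rule uniform_limitI)
    fix e :: real assume "e > 0"
    have "\<forall>\<^sub>F n in sequentially. inverse (real (Suc n)) < e / 2"
      using order_tendstoD(2)[OF LIMSEQ_inverse_real_of_nat, of "e / 2"] \<open>e > 0\<close> by simp
    then have "\<forall>\<^sub>F n in sequentially. inverse (real (Suc (k n))) < e / 2" by (rule eventually_subseq[OF k(1)])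
    moreover have "\<forall>\<^sub>F n in sequentially. \<forall>r\<in>{0..T}. dist (xs (k n) r) (x r) < e / 2"
      by (rule uniform_limitD[OF k(3)]) (use \<open>e > 0\<close> in auto)
    ultimately show "\<forall>\<^sub>F n in sequentially. \<forall>r\<in>{0..T}. dist (ys (k n) r) (x r) < e"
    proof eventually_elim
      case (elim n)
      show ?case
      proof
        fix r assume r: "r \<in> {0..T}"
        have "dist (xs (k n) r) (ys (k n) r) < e / 2" using xs(3)[OF r, of "k n"] elim(1) by (simp add: dist_norm)
        then show "dist (ys (k n) r) (x r) < e"
          using elim(2) r dist_triangle3[of "ys (k n) r" "x r" "xs (k n) r"] by fastforce
      qed
    qed
  qed
  have "(\<lambda>n. h (xs (k n)) - h (ys (k n))) \<longlonglongrightarrow> h x - h x"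
    using T k ky xs(1,2) X_paths by (intro tendsto_diff terminal_tendsto[OF terminal]) auto
  then have "\<forall>\<^sub>F n in sequentially. \<bar>h (xs (k n)) - h (ys (k n))\<bar> < e"
    using tendstoD[of _ "0::real" sequentially e] e by (simp add: dist_real_def)
  then show False using xs(4) by (auto simp: eventually_sequentially not_less[symmetric])
qed

lemma terminal_bounded: obtains B where "\<And>x. x \<in> X \<Longrightarrow> \<bar>h x\<bar> \<le> B"
proof (rule ccontr)
  assume no: "\<not> thesis"
  have "\<exists>x. x \<in> X \<and> \<bar>h x\<bar> > real n" for n
    using no that[of "real n"] not_le by blast
  then obtain xs where xs: "\<And>n. xs n \<in> X" "\<And>n::nat. \<bar>h (xs n)\<bar> > real n" by metis
  obtain k x where k: "strict_mono (k :: nat \<Rightarrow> nat)" "x \<in> paths T"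
    "uniform_limit {0..T} (\<lambda>n. xs (k n)) x sequentially"
    by (rule X_subsequence[OF xs(1)])
  have "(\<lambda>n. \<bar>h (xs (k n))\<bar>) \<longlonglongrightarrow> \<bar>h x\<bar>"
    using T k xs(1) X_paths by (intro tendsto_rabs terminal_tendsto[OF terminal]) auto
  then have "Bseq (\<lambda>n. \<bar>h (xs (k n))\<bar>)" by (intro convergent_imp_Bseq convergentI)
  then obtain b where b: "\<And>n. \<bar>h (xs (k n))\<bar> \<le> b" by (auto simp: Bseq_def)
  obtain n where "b < real n" using reals_Archimedean2 by blast
  then show False using b[of n] xs(2)[of "k n"] seq_suble[OF k(1), of n] by linarith
qed

lemma hamiltonian_bounded: obtains B where "\<And>x t. x \<in> X \<Longrightarrow> t \<in> {0..T} \<Longrightarrow> \<bar>F t x 0\<bar> \<le> B"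
proof (rule ccontr)
  assume no: "\<not> thesis"
  have "\<exists>x t. x \<in> X \<and> t \<in> {0..T} \<and> \<bar>F t x 0\<bar> > real n" for n
    using no that[of "real n"] not_le by blast
  then have "\<forall>n. \<exists>x. x \<in> X \<and> (\<exists>t. t \<in> {0..T} \<and> \<bar>F t x 0\<bar> > real n)" by blast
  from choice[OF this] obtain xs where xs1: "\<forall>n. xs n \<in> X \<and> (\<exists>t. t \<in> {0..T} \<and> \<bar>F t (xs n) 0\<bar> > real n)" ..
  then have "\<forall>n. \<exists>t. t \<in> {0..T} \<and> \<bar>F t (xs n) 0\<bar> > real n" by blast
  from choice[OF this] obtain ts where "\<forall>n. ts n \<in> {0..T} \<and> \<bar>F (ts n) (xs n) 0\<bar> > real n" ..
  with xs1 have xs: "\<And>n. xs n \<in> X" "\<And>n. ts n \<in> {0..T}" "\<And>n::nat. \<bar>F (ts n) (xs n) 0\<bar> > real n"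
    by blast+
  obtain k x where k: "strict_mono (k :: nat \<Rightarrow> nat)" "x \<in> paths T"
    "uniform_limit {0..T} (\<lambda>n. xs (k n)) x sequentially"
    by (rule X_subsequence[OF xs(1)])
  obtain t r where t: "t \<in> {0..T}" and r: "strict_mono (r :: nat \<Rightarrow> nat)" "((\<lambda>n. ts (k n)) \<circ> r) \<longlonglongrightarrow> t"
    using compact_Icc[of 0 T, unfolded compact_def, rule_format, of "\<lambda>n. ts (k n)"] xs(2) by blast
  have lim: "uniform_limit {0..T} (\<lambda>n. xs (k (r n))) x sequentially"
    unfolding uniform_limit_iff
  proof (intro allI impI)
    fix e :: real assume "e > 0"
    then show "\<forall>\<^sub>F n in sequentially. \<forall>x'\<in>{0..T}. dist (xs (k (r n)) x') (x x') < e"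
      using eventually_subseq[OF r(1) uniform_limitD[OF k(3)]] by blast
  qed
  have "(\<lambda>n. \<bar>F (ts (k (r n))) (xs (k (r n))) 0\<bar>) \<longlonglongrightarrow> \<bar>F t x 0\<bar>"
    using T k xs(1,2) X_paths t r lim by (intro tendsto_rabs hamiltonian_tendsto[OF F_cont]) (auto simp: o_def)
  then have "Bseq (\<lambda>n. \<bar>F (ts (k (r n))) (xs (k (r n))) 0\<bar>)" by (intro convergent_imp_Bseq convergentI)
  then obtain b where b: "\<And>n. \<bar>F (ts (k (r n))) (xs (k (r n))) 0\<bar> \<le> b" by (auto simp: Bseq_def)
  obtain n where "b < real n" using reals_Archimedean2 by blast
  then show False using b[of n] xs(3)[of "k (r n)"] seq_suble[OF k(1), of "r n"] seq_suble[OF r(1), of n] by linarith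
qed

lemma subsolution_step:
  assumes x: "x \<in> X \<inter> \<Omega>" and \<tau>: "t0 \<le> \<tau>" "\<tau> < T"
  obtains y f where "y \<in> X \<inter> \<Omega>" "is_trajectory j A T p q L \<tau> x y f"
    "\<And>t. \<tau> \<le> t \<Longrightarrow> t \<le> T \<Longrightarrow> (\<lambda>s. - (f s \<bullet> z) + F s y z) absolutely_integrable_on {\<tau>..t}"
    "\<And>t. \<tau> \<le> t \<Longrightarrow> t \<le> T \<Longrightarrow> u \<tau> x \<le> integral {\<tau>..t} (\<lambda>s. - (f s \<bullet> z) + F s y z) + u t y"
proof -
  have "\<tau> \<in> {0..<T}" "x \<in> \<Omega>" using assms t0 by auto
  with sub obtain y f where *: "y \<in> \<Omega>" "is_trajectory j A T p q L \<tau> x y f"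
    "\<forall>t\<in>{\<tau>..T}. u \<tau> x \<le> (LINT s|lebesgue_on {\<tau>..t}. - (f s \<bullet> z) + F s y z) + u t y"
    unfolding minimax_subsolution_def by blast
  have y: "y \<in> X" using X_continue[OF _ *(2) \<tau>] x by blast
  have f: "bochner_Lp 2 \<tau> T f" using *(2) by (simp add: is_trajectory_def)
  note i = minimax_integrand_absolutely_integrable[OF F_cont _ X_paths[OF y] f]
  show thesis
    by (rule that[of y f]) (use * y i[of _ z] T \<tau> t0 in auto)
qed

lemma supersolution_step:
  assumes x: "x \<in> X \<inter> \<Omega>" and \<tau>: "t0 \<le> \<tau>" "\<tau> < T"
  obtains y f where "y \<in> X \<inter> \<Omega>" "is_trajectory j A T p q L \<tau> x y f"
    "\<And>t. \<tau> \<le> t \<Longrightarrow> t \<le> T \<Longrightarrow> (\<lambda>s. - (f s \<bullet> z) + F s y z) absolutely_integrable_on {\<tau>..t}"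
    "\<And>t. \<tau> \<le> t \<Longrightarrow> t \<le> T \<Longrightarrow> integral {\<tau>..t} (\<lambda>s. - (f s \<bullet> z) + F s y z) + v t y \<le> v \<tau> x"
proof -
  have "\<tau> \<in> {0..<T}" "x \<in> \<Omega>" using assms t0 by auto
  with super obtain y f where *: "y \<in> \<Omega>" "is_trajectory j A T p q L \<tau> x y f"
    "\<forall>t\<in>{\<tau>..T}. v \<tau> x \<ge> (LINT s|lebesgue_on {\<tau>..t}. - (f s \<bullet> z) + F s y z) + v t y"
    unfolding minimax_supersolution_def by blast
  have y: "y \<in> X" using X_continue[OF _ *(2) \<tau>] x by blast
  have f: "bochner_Lp 2 \<tau> T f" using *(2) by (simp add: is_trajectory_def)
  note i = minimax_integrand_absolutely_integrable[OF F_cont _ X_paths[OF y] f]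
  show thesis
    by (rule that[of y f]) (use * y i[of _ z] T \<tau> t0 in auto)
qed

text \<open>The path \<open>x0\<close> itself is in general no trajectory after \<open>t0\<close>.
  The minimax inequalities at \<open>t = t0\<close>, where the integrals vanish, replace it by
  trajectories which agree with it up to \<open>t0\<close>.\<close>

lemma initial_pair:
  obtains x y where "x \<in> X \<inter> \<Omega>" "y \<in> X \<inter> \<Omega>" "\<And>s. s \<in> {0..t0} \<Longrightarrow> x s = y s" "u t0 x0 \<le> u t0 x" "v t0 y \<le> v t0 x0"
proof -
  have t0': "t0 \<in> {0..<T}" using t0 by auto
  from sub t0' x0 obtain x f where x: "x \<in> \<Omega>" "is_trajectory j A T p q L t0 x0 x f"
    "\<forall>t\<in>{t0..T}. u t0 x0 \<le> (LINT s|lebesgue_on {t0..t}. - (f s \<bullet> 0) + F s x 0) + u t x"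
    unfolding minimax_subsolution_def by blast
  from super t0' x0 obtain y g where y: "y \<in> \<Omega>" "is_trajectory j A T p q L t0 x0 y g"
    "\<forall>t\<in>{t0..T}. v t0 x0 \<ge> (LINT s|lebesgue_on {t0..t}. - (g s \<bullet> 0) + F s y 0) + v t y"
    unfolding minimax_supersolution_def by blast
  have fg: "bochner_Lp 2 t0 T f" "bochner_Lp 2 t0 T g" "x \<in> paths T" "y \<in> paths T"
    using x(2) y(2) by (auto simp: is_trajectory_def)
  note i = minimax_integrand_absolutely_integrable(2)[OF F_cont less_imp_le[OF T] _ _ t0(1), of _ _ t0 0]
  show thesis
  proof (rule that[of x y])
    show "x \<in> X \<inter> \<Omega>" "y \<in> X \<inter> \<Omega>" using x y by (auto simp: trajectories_def)
    show "x s = y s" if "s \<in> {0..t0}" for s using x(2) y(2) that by (simp add: is_trajectory_def)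
    show "u t0 x0 \<le> u t0 x" using x(3)[rule_format, of t0] i[OF fg(3,1)] t0 by simp
    show "v t0 y \<le> v t0 x0" using y(3)[rule_format, of t0] i[OF fg(4,2)] t0 by simp
  qed
qed

text \<open>Follow the minimax inequalities with \<open>z = 0\<close> up to time \<open>T\<close>;
  there the terminal condition takes over.\<close>

lemma difference_bounded:
  obtains B where "\<And>t x y. t0 \<le> t \<Longrightarrow> t \<le> T \<Longrightarrow> x \<in> X \<inter> \<Omega> \<Longrightarrow> y \<in> X \<inter> \<Omega> \<Longrightarrow> u t x - v t y \<le> B"
proof -
  obtain H where H: "\<And>x. x \<in> X \<Longrightarrow> \<bar>h x\<bar> \<le> H" using terminal_bounded by blast
  obtain K where K: "\<And>x t. x \<in> X \<Longrightarrow> t \<in> {0..T} \<Longrightarrow> \<bar>F t x 0\<bar> \<le> K" using hamiltonian_bounded by blast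
  have uT: "u T x \<le> H" if "x \<in> X \<inter> \<Omega>" for x
    using sub H[of x] that unfolding minimax_subsolution_def by fastforce
  have vT: "- H \<le> v T x" if "x \<in> X \<inter> \<Omega>" for x
    using super H[of x] that unfolding minimax_supersolution_def by fastforce
  have int: "\<bar>integral {t..T} (\<lambda>s. - (f s \<bullet> 0) + F s y 0)\<bar> \<le> T * K"
    if y: "y \<in> X" and t: "t0 \<le> t" "t < T"
      and i: "(\<lambda>s. - (f s \<bullet> 0) + F s y 0) absolutely_integrable_on {t..T}" for y t and f :: "real \<Rightarrow> 'h"
  proof -
    have K0: "K \<ge> 0" using K[OF y, of 0] T by (auto intro: order_trans[OF abs_ge_zero])
    have "norm (integral {t..T} (\<lambda>s. - (f s \<bullet> 0) + F s y 0)) \<le> integral {t..T} (\<lambda>_. K)"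
      by (rule integral_norm_bound_integral[OF abs_int_imp_int[OF i]])
        (use K[OF y] t t0 in auto)
    also have "\<dots> = (T - t) * K" using t by simp
    also have "\<dots> \<le> T * K" using t t0 K0 by (intro mult_right_mono) auto
    finally show ?thesis by simp
  qed
  have K0: "K \<ge> 0"
  proof -
    obtain x y where "x \<in> X \<inter> \<Omega>" "y \<in> X \<inter> \<Omega>" by (rule initial_pair)
    then show ?thesis using K[of x 0] T by (auto intro: order_trans[OF abs_ge_zero])
  qed
  have ub: "u t x \<le> T * K + H" if x: "x \<in> X \<inter> \<Omega>" and t: "t0 \<le> t" "t \<le> T" for t x
  proof (cases "t = T")
    case True
    then show ?thesis using uT[OF x] T K0 by (simp add: add_increasing)
  next
    case False
    then have tT: "t < T" using t by simp
    obtain y f where y: "y \<in> X \<inter> \<Omega>" "is_trajectory j A T p q L t x y f"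
      and i: "\<And>s. t \<le> s \<Longrightarrow> s \<le> T \<Longrightarrow> (\<lambda>r. - (f r \<bullet> 0) + F r y 0) absolutely_integrable_on {t..s}"
      and le: "\<And>s. t \<le> s \<Longrightarrow> s \<le> T \<Longrightarrow> u t x \<le> integral {t..s} (\<lambda>r. - (f r \<bullet> 0) + F r y 0) + u s y"
      using subsolution_step[OF x t(1) tT, of 0] by blast
    show ?thesis using le[of T] int[OF _ t(1) tT i[of T]] uT[OF y(1)] y(1) tT by fastforce
  qed
  have vb: "- (T * K + H) \<le> v t x" if x: "x \<in> X \<inter> \<Omega>" and t: "t0 \<le> t" "t \<le> T" for t x
  proof (cases "t = T")
    case True
    have "0 \<le> T * K" using T K0 by simp
    then show ?thesis using vT[OF x] True by simp
  next
    case False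
    then have tT: "t < T" using t by simp
    obtain y f where y: "y \<in> X \<inter> \<Omega>" "is_trajectory j A T p q L t x y f"
      and i: "\<And>s. t \<le> s \<Longrightarrow> s \<le> T \<Longrightarrow> (\<lambda>r. - (f r \<bullet> 0) + F r y 0) absolutely_integrable_on {t..s}"
      and le: "\<And>s. t \<le> s \<Longrightarrow> s \<le> T \<Longrightarrow> integral {t..s} (\<lambda>r. - (f r \<bullet> 0) + F r y 0) + v s y \<le> v t x"
      using supersolution_step[OF x t(1) tT, of 0] by blast
    show ?thesis using le[of T] int[OF _ t(1) tT i[of T]] vT[OF y(1)] y(1) tT by fastforce
  qed
  show thesis by (rule that[of "2 * (T * K + H)"]) (use ub vb in \<open>force simp: algebra_simps\<close>)
qed

section \<open>Euler scheme and comparison\<close>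

text \<open>One step of the scheme with \<open>z\<close> frozen at time \<open>\<tau>\<close>. Here
  \<open>\<eta>\<close> bounds the oscillation of trajectories during the step. The size conditions
  guarantee that \<open>|x' - y'|\<^sup>2 \<le> (|x - y| + 2 \<eta>)\<^sup>2 \<le> 5 \<delta>
  \<epsilon> \<le> \<Sigma>\<^sup>2\<close> holds throughout the step, which keeps the uniform
  distance at most \<open>\<Sigma>\<close> and the argument of the modulus at most \<open>10
  \<delta>\<close>.\<close>

lemma Euler_step:
  assumes xy: "x \<in> X \<inter> \<Omega>" "y \<in> X \<inter> \<Omega>" and \<tau>: "t0 \<le> \<tau>" "\<tau> \<le> t" "\<tau> < T" "t \<le> T"
    and pos: "\<epsilon> > 0" "\<delta> > 0" "\<Sigma> > 0"
    and R: "\<And>x s. x \<in> X \<Longrightarrow> s \<in> {0..T} \<Longrightarrow> norm (x s) \<le> R" "R \<ge> 0"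
    and L0: "L0 \<ge> 0" "\<And>s x z z'. s \<in> {0..T} \<Longrightarrow> x \<in> paths T \<Longrightarrow>
        \<bar>F s x z - F s x z'\<bar> \<le> L0 * (1 + (SUP r\<in>{0..s}. norm (x r))) * norm (z - z')"
    and m: "mono_on {0..} m" "\<And>s x y. s \<in> {t0..T} \<Longrightarrow> x \<in> X \<Longrightarrow> y \<in> X \<Longrightarrow>
        F s x ((1 / \<epsilon>) *\<^sub>R (x s - y s)) - F s y ((1 / \<epsilon>) *\<^sub>R (x s - y s))
          \<le> m ((1 / \<epsilon>) * (norm (x s - y s))\<^sup>2 + (SUP r\<in>{0..s}. norm (x r - y r)))"
    and osc: "\<eta> \<ge> 0" "\<And>x r s. x \<in> X \<Longrightarrow> r \<in> {\<tau>..t} \<Longrightarrow> s \<in> {\<tau>..t} \<Longrightarrow> norm (x r - x s) \<le> \<eta>"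
    and near: "\<And>s. s \<in> {0..\<tau>} \<Longrightarrow> norm (x s - y s) \<le> \<Sigma>" and pen: "(norm (x \<tau> - y \<tau>))\<^sup>2 \<le> 2 * \<epsilon> * \<delta>"
    and size: "8 * \<eta>\<^sup>2 \<le> \<epsilon> * \<delta>" "5 * \<delta> * \<epsilon> \<le> \<Sigma>\<^sup>2" "\<Sigma> \<le> 5 * \<delta>"
  obtains x' y' where "x' \<in> X \<inter> \<Omega>" "y' \<in> X \<inter> \<Omega>" "\<And>s. s \<in> {0..t} \<Longrightarrow> norm (x' s - y' s) \<le> \<Sigma>"
    "u \<tau> x - v \<tau> y - (norm (x \<tau> - y \<tau>))\<^sup>2 / (2 * \<epsilon>) \<le>
      u t x' - v t y' - (norm (x' t - y' t))\<^sup>2 / (2 * \<epsilon>) + (t - \<tau>) * (m (10 * \<delta>) + 4 * (L + L0) * (1 + R) * \<eta> / \<epsilon>)"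
proof -
  define z where "z = (1 / \<epsilon>) *\<^sub>R (x \<tau> - y \<tau>)"
  obtain x' f where x': "x' \<in> X \<inter> \<Omega>" and tr_x: "is_trajectory j A T p q L \<tau> x x' f"
    and ix: "\<And>t. \<tau> \<le> t \<Longrightarrow> t \<le> T \<Longrightarrow> (\<lambda>s. - (f s \<bullet> z) + F s x' z) absolutely_integrable_on {\<tau>..t}"
    and ux: "\<And>t. \<tau> \<le> t \<Longrightarrow> t \<le> T \<Longrightarrow> u \<tau> x \<le> integral {\<tau>..t} (\<lambda>s. - (f s \<bullet> z) + F s x' z) + u t x'"
    using subsolution_step[OF xy(1) \<tau>(1,3), of z] by blast
  obtain y' g where y': "y' \<in> X \<inter> \<Omega>" and tr_y: "is_trajectory j A T p q L \<tau> y y' g"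
    and iy: "\<And>t. \<tau> \<le> t \<Longrightarrow> t \<le> T \<Longrightarrow> (\<lambda>s. - (g s \<bullet> z) + F s y' z) absolutely_integrable_on {\<tau>..t}"
    and vy: "\<And>t. \<tau> \<le> t \<Longrightarrow> t \<le> T \<Longrightarrow> integral {\<tau>..t} (\<lambda>s. - (g s \<bullet> z) + F s y' z) + v t y' \<le> v \<tau> y"
    using supersolution_step[OF xy(2) \<tau>(1,3), of z] by blast
  have X': "x' \<in> X" "y' \<in> X" using x' y' by auto
  have P': "x' \<in> paths T" "y' \<in> paths T" using X' X_paths by auto
  have agree: "x' s = x s" "y' s = y s" if "s \<in> {0..\<tau>}" for s
    using tr_x tr_y that by (auto simp: is_trajectory_def)
  have \<tau>0: "0 \<le> \<tau>" using \<tau> t0 by simp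
  have \<tau>m: "\<tau> \<in> {0..\<tau>}" using \<tau>0 by simp
  define D where "D s = x' s - y' s" for s
  have D\<tau>: "D \<tau> = x \<tau> - y \<tau>" using agree[OF \<tau>m] by (simp add: D_def)
  have Dosc: "norm (D s - D \<tau>) \<le> 2 * \<eta>" if "s \<in> {\<tau>..t}" for s
  proof -
    have "D s - D \<tau> = (x' s - x' \<tau>) - (y' s - y' \<tau>)" by (simp add: D_def)
    also have "norm \<dots> \<le> norm (x' s - x' \<tau>) + norm (y' s - y' \<tau>)" by (rule norm_triangle_ineq4)
    also have "\<dots> \<le> \<eta> + \<eta>" by (intro add_mono osc X') (use that \<tau> in auto)
    finally show ?thesis by simp
  qed
  have Dsq: "(norm (D s))\<^sup>2 \<le> 5 * \<delta> * \<epsilon>" if s: "s \<in> {\<tau>..t}" for s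
  proof -
    have "norm (D s) \<le> norm (D \<tau>) + 2 * \<eta>"
      using Dosc[OF s] norm_triangle_sub[of "D s" "D \<tau>"] by linarith
    then have "(norm (D s))\<^sup>2 \<le> (norm (D \<tau>) + 2 * \<eta>)\<^sup>2" by (intro power_mono) auto
    also have "\<dots> \<le> 2 * (norm (D \<tau>))\<^sup>2 + 8 * \<eta>\<^sup>2"
    proof -
      have "0 \<le> (norm (D \<tau>) - 2 * \<eta>)\<^sup>2" by simp
      then show ?thesis by (simp add: power2_eq_square algebra_simps)
    qed
    also have "\<dots> \<le> 2 * (2 * \<epsilon> * \<delta>) + \<epsilon> * \<delta>" unfolding D\<tau> using pen size(1) by linarith
    finally show ?thesis by (simp add: algebra_simps)
  qed
  have D\<Sigma>: "norm (D s) \<le> \<Sigma>" if s: "s \<in> {0..t}" for s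
  proof (cases "s \<le> \<tau>")
    case True
    then show ?thesis using near[of s] agree[of s] s by (simp add: D_def)
  next
    case False
    then have "(norm (D s))\<^sup>2 \<le> \<Sigma>\<^sup>2" using Dsq[of s] s size(2) by simp
    then show ?thesis by (rule power2_le_imp_le) (use pos in auto)
  qed
  define Z where "Z s = (1 / \<epsilon>) *\<^sub>R D s" for s
  have Zz: "norm (Z s - z) \<le> 2 * \<eta> / \<epsilon>" if s: "s \<in> {\<tau>..t}" for s
  proof -
    have "Z s - z = (1 / \<epsilon>) *\<^sub>R (D s - D \<tau>)" by (simp add: Z_def z_def D\<tau> scaleR_diff_right)
    then have "norm (Z s - z) = norm (D s - D \<tau>) / \<epsilon>" using pos by simp
    also have "\<dots> \<le> 2 * \<eta> / \<epsilon>" using Dosc[OF s] pos by (intro divide_right_mono) auto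
    finally show ?thesis .
  qed
  define \<kappa> where "\<kappa> = 4 * (L + L0) * (1 + R) * \<eta> / \<epsilon>"
  have Fz: "\<bar>F s w z - F s w (Z s)\<bar> \<le> L0 * (1 + R) * (2 * \<eta> / \<epsilon>)" if s: "s \<in> {\<tau>..t}" and w: "w \<in> X" for s w
  proof -
    have s0: "s \<in> {0..T}" using s \<tau> \<tau>0 by auto
    have "(SUP r\<in>{0..s}. norm (w r)) \<le> R" by (rule cSUP_least) (use s0 R(1)[OF w] in auto)
    have "0 \<le> norm (w 0)" by simp
    also have "\<dots> \<le> (SUP r\<in>{0..s}. norm (w r))"
      by (rule cSUP_upper[OF _ paths_bdd[OF X_paths[OF w]]]) (use s0 in auto)
    finally have S0: "0 \<le> (SUP r\<in>{0..s}. norm (w r))" .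
    have "\<bar>F s w z - F s w (Z s)\<bar> \<le> L0 * (1 + (SUP r\<in>{0..s}. norm (w r))) * norm (z - Z s)"
      by (rule L0(2)[OF s0 X_paths[OF w]])
    also have "\<dots> \<le> L0 * (1 + R) * (2 * \<eta> / \<epsilon>)"
      using Zz[OF s] \<open>(SUP r\<in>{0..s}. norm (w r)) \<le> R\<close> L0(1) S0 R(2)
      by (intro mult_mono mult_left_mono) (auto simp: norm_minus_commute)
    finally show ?thesis .
  qed
  have FZ: "F s x' (Z s) - F s y' (Z s) \<le> m (10 * \<delta>)" if s: "s \<in> {\<tau>..t}" for s
  proof -
    have sT: "s \<in> {t0..T}" using s \<tau> by auto
    have s0: "s \<in> {0..T}" using s \<tau> \<tau>0 by auto
    have D0: "(SUP r\<in>{0..s}. norm (x' r - y' r)) \<le> \<Sigma>"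
      by (rule cSUP_least) (use s s0 D\<Sigma> in \<open>auto simp: D_def\<close>)
    have bdd: "bdd_above ((\<lambda>r. norm (x' r - y' r)) ` {0..s})"
      by (intro continuous_on_Icc_bdd_above continuous_intros continuous_on_subset[OF pathsD[OF P'(1)]]
          continuous_on_subset[OF pathsD[OF P'(2)]]) (use s0 in auto)
    have "0 \<le> norm (x' 0 - y' 0)" by simp
    also have "\<dots> \<le> (SUP r\<in>{0..s}. norm (x' r - y' r))" by (rule cSUP_upper[OF _ bdd]) (use s0 in auto)
    finally have S0: "0 \<le> (SUP r\<in>{0..s}. norm (x' r - y' r))" .
    have "(1 / \<epsilon>) * (norm (D s))\<^sup>2 \<le> (1 / \<epsilon>) * (5 * \<delta> * \<epsilon>)" using Dsq[OF s] pos by (intro mult_left_mono) auto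
    then have arg: "(1 / \<epsilon>) * (norm (x' s - y' s))\<^sup>2 + (SUP r\<in>{0..s}. norm (x' r - y' r)) \<le> 10 * \<delta>"
      using D0 size(3) pos by (simp add: D_def)
    have nn: "0 \<le> (1 / \<epsilon>) * (norm (x' s - y' s))\<^sup>2" using pos by simp
    have "F s x' (Z s) - F s y' (Z s) \<le> m ((1 / \<epsilon>) * (norm (x' s - y' s))\<^sup>2 + (SUP r\<in>{0..s}. norm (x' r - y' r)))"
      using m(2)[OF sT X'] by (simp add: Z_def D_def)
    also have "\<dots> \<le> m (10 * \<delta>)" using arg nn S0 by (intro mono_onD[OF m(1)]) auto
    finally show ?thesis .
  qed
  have sub: "\<tau> \<le> t" "t \<le> T" by (fact \<tau>)+
  define E where "E s = (f s - g s) \<bullet> D s" for s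
  have Ei: "E absolutely_integrable_on {\<tau>..t}" unfolding E_def D_def
    by (rule absolutely_integrable_sub[OF energy_inequality_difference(1)[OF tr_x tr_y \<tau>0 \<tau>(3) order_refl _ order_refl]])
      (use \<tau> in auto)
  have energy: "(norm (D t))\<^sup>2 - (norm (D \<tau>))\<^sup>2 \<le> 2 * integral {\<tau>..t} E" unfolding E_def D_def
    by (rule energy_inequality_difference(2)[OF tr_x tr_y \<tau>0 \<tau>(3) order_refl \<tau>(2,4)])
  \<comment> \<open>the integrands of the two minimax inequalities and of the energy inequality; the terms \<open>f\<close> and \<open>g\<close> cancel up to \<open>(f - g, Z - z)\<close>\<close>
  define I where "I s = (- (f s \<bullet> z) + F s x' z) - (- (g s \<bullet> z) + F s y' z) + (1 / \<epsilon>) * E s" for s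
  have Ii: "I absolutely_integrable_on {\<tau>..t}" unfolding I_def
    by (intro set_integral_add set_integral_diff set_integrable_mult_right ix[OF sub] iy[OF sub] Ei)
  have fb: "AE s in lebesgue_on {\<tau><..<T}. norm (f s) \<le> L * (1 + R)"
    by (rule forcing_bound[OF tr_x L \<tau>0]) (rule R(1)[OF X'(1)])
  have gb: "AE s in lebesgue_on {\<tau><..<T}. norm (g s) \<le> L * (1 + R)"
    by (rule forcing_bound[OF tr_y L \<tau>0]) (rule R(1)[OF X'(2)])
  have "AE s in lebesgue_on {\<tau><..<t}. I s \<le> m (10 * \<delta>) + \<kappa>"
    using AE_subinterval[OF fb order_refl \<tau>(4)] AE_subinterval[OF gb order_refl \<tau>(4)] AE_space_open[of \<tau> t]
  proof eventually_elim
    case (elim s)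
    then have s: "s \<in> {\<tau>..t}" by auto
    have "(f s - g s) \<bullet> (Z s - z) \<le> norm (f s - g s) * norm (Z s - z)" by (rule norm_cauchy_schwarz)
    also have "\<dots> \<le> (2 * (L * (1 + R))) * (2 * \<eta> / \<epsilon>)"
      using elim norm_triangle_ineq4[of "f s" "g s"] Zz[OF s] L R(2)
      by (intro mult_mono) auto
    finally have 1: "(f s - g s) \<bullet> (Z s - z) \<le> (2 * (L * (1 + R))) * (2 * \<eta> / \<epsilon>)" .
    have "I s = (f s - g s) \<bullet> (Z s - z) + (F s x' z - F s y' z)"
      by (simp add: I_def E_def Z_def inner_diff_left inner_diff_right algebra_simps)
    also have "\<dots> \<le> (2 * (L * (1 + R))) * (2 * \<eta> / \<epsilon>) + (m (10 * \<delta>) + 2 * (L0 * (1 + R) * (2 * \<eta> / \<epsilon>)))"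
      using 1 Fz[OF s X'(1)] Fz[OF s X'(2)] FZ[OF s] by (intro add_mono) linarith+
    also have "\<dots> = m (10 * \<delta>) + \<kappa>" by (simp add: \<kappa>_def algebra_simps add_divide_distrib)
    finally show ?case .
  qed
  then have "integral {\<tau>..t} I \<le> integral {\<tau>..t} (\<lambda>_. m (10 * \<delta>) + \<kappa>)"
    by (intro integral_bound_real Ii absolutely_integrable_const)
  then have Ib: "integral {\<tau>..t} I \<le> (t - \<tau>) * (m (10 * \<delta>) + \<kappa>)" using \<tau>(2) by simp
  have Ieq: "integral {\<tau>..t} I = integral {\<tau>..t} (\<lambda>s. - (f s \<bullet> z) + F s x' z)
      - integral {\<tau>..t} (\<lambda>s. - (g s \<bullet> z) + F s y' z) + (1 / \<epsilon>) * integral {\<tau>..t} E"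
    unfolding I_def
    by (intro integral_unique has_integral_add has_integral_diff has_integral_mult_right integrable_integral
        abs_int_imp_int[OF ix[OF sub]] abs_int_imp_int[OF iy[OF sub]]
        abs_int_imp_int[OF Ei])
  have "((norm (D t))\<^sup>2 - (norm (D \<tau>))\<^sup>2) / (2 * \<epsilon>) \<le> (2 * integral {\<tau>..t} E) / (2 * \<epsilon>)"
    using energy pos by (intro divide_right_mono) auto
  then have pen': "(norm (D t))\<^sup>2 / (2 * \<epsilon>) - (norm (D \<tau>))\<^sup>2 / (2 * \<epsilon>) \<le> (1 / \<epsilon>) * integral {\<tau>..t} E"
    by (simp add: diff_divide_distrib)
  show thesis
  proof (rule that[OF x' y'])
    show "norm (x' s - y' s) \<le> \<Sigma>" if "s \<in> {0..t}" for s using D\<Sigma>[OF that] by (simp add: D_def)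
    have "u \<tau> x - v \<tau> y - (norm (D \<tau>))\<^sup>2 / (2 * \<epsilon>) \<le>
      u t x' - v t y' - (norm (D t))\<^sup>2 / (2 * \<epsilon>) + (t - \<tau>) * (m (10 * \<delta>) + \<kappa>)"
      using ux[OF sub] vy[OF sub] Ib Ieq pen' by linarith
    then show "u \<tau> x - v \<tau> y - (norm (x \<tau> - y \<tau>))\<^sup>2 / (2 * \<epsilon>) \<le>
      u t x' - v t y' - (norm (x' t - y' t))\<^sup>2 / (2 * \<epsilon>) + (t - \<tau>) * (m (10 * \<delta>) + 4 * (L + L0) * (1 + R) * \<eta> / \<epsilon>)"
      unfolding D\<tau> \<kappa>_def by (simp add: D_def)
  qed
qed

text \<open>Steps of length \<open>d / 2\<close> are repeated as long as the penalty is at most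
  \<open>\<delta>\<close> and the time is less than \<open>T\<close>. The strict inequality \<open>m
  (10 \<delta>) < c\<close> leaves room for the errors caused by freezing \<open>z\<close>.\<close>

lemma Euler_scheme:
  assumes xy: "x \<in> X \<inter> \<Omega>" "y \<in> X \<inter> \<Omega>" and t1: "t0 \<le> t1" "t1 \<le> T"
    and pos: "\<epsilon> > 0" "\<delta> > 0" "\<Sigma> > 0"
    and m: "mono_on {0..} m" "\<And>s x y. s \<in> {t0..T} \<Longrightarrow> x \<in> X \<Longrightarrow> y \<in> X \<Longrightarrow>
        F s x ((1 / \<epsilon>) *\<^sub>R (x s - y s)) - F s y ((1 / \<epsilon>) *\<^sub>R (x s - y s))
          \<le> m ((1 / \<epsilon>) * (norm (x s - y s))\<^sup>2 + (SUP r\<in>{0..s}. norm (x r - y r)))"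
    and near: "\<And>s. s \<in> {0..t1} \<Longrightarrow> norm (x s - y s) \<le> \<Sigma>"
    and size: "5 * \<delta> * \<epsilon> \<le> \<Sigma>\<^sup>2" "\<Sigma> \<le> 5 * \<delta>" and rate: "m (10 * \<delta>) < c"
  obtains \<tau> x' y' where "t1 \<le> \<tau>" "\<tau> \<le> T" "x' \<in> X \<inter> \<Omega>" "y' \<in> X \<inter> \<Omega>"
    "\<And>s. s \<in> {0..\<tau>} \<Longrightarrow> norm (x' s - y' s) \<le> \<Sigma>"
    "u t1 x - v t1 y - (norm (x t1 - y t1))\<^sup>2 / (2 * \<epsilon>) \<le>
      u \<tau> x' - v \<tau> y' - (norm (x' \<tau> - y' \<tau>))\<^sup>2 / (2 * \<epsilon>) + (\<tau> - t1) * c"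
    "\<tau> = T \<or> \<delta> < (norm (x' \<tau> - y' \<tau>))\<^sup>2 / (2 * \<epsilon>)"
proof -
  obtain R where R0: "R \<ge> 0" and R: "\<And>x t. x \<in> X \<Longrightarrow> t \<in> {0..T} \<Longrightarrow> norm (x t) \<le> R"
    by (rule trajectories_bounds[OF L t0 x0_path]) (rule that; assumption)
  obtain L0 where L0: "L0 \<ge> 0" "\<And>s x z z'. s \<in> {0..T} \<Longrightarrow> x \<in> paths T \<Longrightarrow>
        \<bar>F s x z - F s x z'\<bar> \<le> L0 * (1 + (SUP r\<in>{0..s}. norm (x r))) * norm (z - z')"
    using hamiltonian unfolding admissible_hamiltonian_def by blast
  define \<kappa> where "\<kappa> = c - m (10 * \<delta>)"
  have \<kappa>: "\<kappa> > 0" using rate by (simp add: \<kappa>_def)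
  define G where "G = 4 * (L + L0) * (1 + R) + 1"
  have G: "G > 0" using L L0(1) R0 by (simp add: G_def add_nonneg_pos)
  \<comment> \<open>the oscillation per step must preserve the size condition of \<open>Euler_step\<close> and cost at most the slack \<open>\<kappa>\<close> in the rate\<close>
  define \<eta> where "\<eta> = min (sqrt (\<epsilon> * \<delta> / 8)) (\<kappa> * \<epsilon> / G)"
  have \<eta>: "\<eta> > 0" using pos \<kappa> G by (simp add: \<eta>_def)
  have \<eta>1: "8 * \<eta>\<^sup>2 \<le> \<epsilon> * \<delta>"
  proof -
    have "\<eta>\<^sup>2 \<le> (sqrt (\<epsilon> * \<delta> / 8))\<^sup>2" using \<eta> by (intro power_mono) (auto simp: \<eta>_def)
    then show ?thesis using pos by simp
  qed
  have \<eta>2: "4 * (L + L0) * (1 + R) * \<eta> / \<epsilon> \<le> \<kappa>"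
  proof -
    have "4 * (L + L0) * (1 + R) * \<eta> \<le> G * (\<kappa> * \<epsilon> / G)"
      using L L0(1) R0 G \<eta> by (intro mult_mono) (auto simp: G_def \<eta>_def)
    also have "\<dots> = \<kappa> * \<epsilon>" using G by simp
    finally show ?thesis using pos by (simp add: divide_le_eq)
  qed
  obtain d where d: "d > 0" "\<And>x s t. x \<in> X \<Longrightarrow> s \<in> {0..T} \<Longrightarrow> t \<in> {0..T} \<Longrightarrow> \<bar>t - s\<bar> < d \<Longrightarrow> norm (x t - x s) < \<eta>"
    using trajectories_equicontinuous[OF embedding L t0 x0_path \<eta>] by blast
  define V where "V x y t = u t x - v t y - (norm (x t - y t))\<^sup>2 / (2 * \<epsilon>)" for x y and t :: real
  define good where "good \<tau> x' y' \<longleftrightarrow> t1 \<le> \<tau> \<and> \<tau> \<le> T \<and> x' \<in> X \<inter> \<Omega> \<and> y' \<in> X \<inter> \<Omega> \<and>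
      (\<forall>s\<in>{0..\<tau>}. norm (x' s - y' s) \<le> \<Sigma>) \<and> V x y t1 \<le> V x' y' \<tau> + (\<tau> - t1) * c" for \<tau> x' y'
  have step: "\<exists>x'' y''. good (min (\<tau> + d / 2) T) x'' y''"
    if g: "good \<tau> x' y'" and \<tau>: "\<tau> < T" and pen: "(norm (x' \<tau> - y' \<tau>))\<^sup>2 / (2 * \<epsilon>) \<le> \<delta>" for \<tau> x' y'
  proof -
    define t where "t = min (\<tau> + d / 2) T"
    have t: "\<tau> \<le> t" "t \<le> T" "t - \<tau> < d" using \<tau> d(1) by (auto simp: t_def)
    have g': "t1 \<le> \<tau>" "x' \<in> X \<inter> \<Omega>" "y' \<in> X \<inter> \<Omega>" "\<And>s. s \<in> {0..\<tau>} \<Longrightarrow> norm (x' s - y' s) \<le> \<Sigma>"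
      "V x y t1 \<le> V x' y' \<tau> + (\<tau> - t1) * c" using g by (auto simp: good_def)
    have "t0 \<le> \<tau>" using g'(1) t1 by simp
    have pen': "(norm (x' \<tau> - y' \<tau>))\<^sup>2 \<le> 2 * \<epsilon> * \<delta>" using pen pos by (simp add: divide_le_eq mult_ac)
    have osc: "norm (w r - w s) \<le> \<eta>" if "w \<in> X" "r \<in> {\<tau>..t}" "s \<in> {\<tau>..t}" for w r s
      using d(2)[OF that(1), of s r] that t \<open>t0 \<le> \<tau>\<close> t0 by (auto intro!: less_imp_le)
    obtain x'' y'' where n: "x'' \<in> X \<inter> \<Omega>" "y'' \<in> X \<inter> \<Omega>" "\<And>s. s \<in> {0..t} \<Longrightarrow> norm (x'' s - y'' s) \<le> \<Sigma>"
      "u \<tau> x' - v \<tau> y' - (norm (x' \<tau> - y' \<tau>))\<^sup>2 / (2 * \<epsilon>) \<le>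
        u t x'' - v t y'' - (norm (x'' t - y'' t))\<^sup>2 / (2 * \<epsilon>) + (t - \<tau>) * (m (10 * \<delta>) + 4 * (L + L0) * (1 + R) * \<eta> / \<epsilon>)"
    proof -
      show thesis
      proof (rule Euler_step[where R=R and ?L0.0=L0 and m=m and \<eta>=\<eta> and \<epsilon>=\<epsilon> and \<delta>=\<delta>
          and \<Sigma>=\<Sigma> and t=t and \<tau>=\<tau> and x=x' and y=y'])
        show "\<eta> \<ge> 0" using \<eta> by simp
      qed (fact that | fact)+
    qed
    have "(t - \<tau>) * (m (10 * \<delta>) + 4 * (L + L0) * (1 + R) * \<eta> / \<epsilon>) \<le> (t - \<tau>) * c"
      using \<eta>2 t by (intro mult_left_mono) (auto simp: \<kappa>_def)
    then have "V x y t1 \<le> V x'' y'' t + (t - t1) * c"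
      using n(4) g'(5) by (simp add: V_def algebra_simps)
    then have "good t x'' y''" using n t g'(1) by (auto simp: good_def)
    then show ?thesis unfolding t_def by blast
  qed
  have iter: "(\<exists>\<tau> x' y'. good \<tau> x' y' \<and> \<delta> < (norm (x' \<tau> - y' \<tau>))\<^sup>2 / (2 * \<epsilon>)) \<or>
      (\<exists>x' y'. good (min (t1 + real n * (d / 2)) T) x' y')" for n
  proof (induction n)
    case 0
    have "good t1 x y" using xy t1 near by (simp add: good_def)
    then show ?case using t1 by auto
  next
    case (Suc n)
    then show ?case
    proof (elim disjE exE)
      fix x' y' assume g: "good (min (t1 + real n * (d / 2)) T) x' y'"
      let ?\<tau> = "min (t1 + real n * (d / 2)) T"
      show ?case
      proof (cases "?\<tau> < T \<and> (norm (x' ?\<tau> - y' ?\<tau>))\<^sup>2 / (2 * \<epsilon>) \<le> \<delta>")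
        case True
        then have "\<exists>x'' y''. good (min (?\<tau> + d / 2) T) x'' y''" using step[OF g] by blast
        moreover have "min (?\<tau> + d / 2) T = min (t1 + real (Suc n) * (d / 2)) T"
        proof -
          have "?\<tau> = t1 + real n * (d / 2)" using True by linarith
          moreover have "real (Suc n) * (d / 2) = real n * (d / 2) + d / 2"
            unfolding of_nat_Suc distrib_right by simp
          ultimately show ?thesis by (simp only: add.assoc)
        qed
        ultimately show ?thesis by metis
      next
        case False
        show ?thesis
        proof (cases "?\<tau> < T")
          case True
          with False g show ?thesis by (intro disjI1) (metis not_le)
        next
          case F: False
          have "real n * (d / 2) \<le> real (Suc n) * (d / 2)" using d(1) by (intro mult_right_mono) auto
          then have "min (t1 + real (Suc n) * (d / 2)) T = ?\<tau>" using F by linarith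
          with g show ?thesis by metis
        qed
      qed
    qed blast
  qed
  obtain n where n: "(T - t1) / (d / 2) < real n" using reals_Archimedean2 by blast
  then have "T - t1 < real n * (d / 2)" using d(1) by (simp add: divide_less_eq)
  then have "min (t1 + real n * (d / 2)) T = T" by simp
  with iter[of n] obtain \<tau> x' y' where g: "good \<tau> x' y'" "\<tau> = T \<or> \<delta> < (norm (x' \<tau> - y' \<tau>))\<^sup>2 / (2 * \<epsilon>)"
    by metis
  show thesis by (rule that[of \<tau> x' y']) (use g in \<open>auto simp: good_def V_def\<close>)
qed

text \<open>The contradiction is obtained from a pair that is maximal up to \<open>a\<close> for the
  supremum of \<open>u - v + c t\<close> over nearby pairs, as explained at the beginning.\<close>

theorem comparison_at: "u t0 x0 \<le> v t0 x0"
proof (rule ccontr)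
  assume "\<not> u t0 x0 \<le> v t0 x0"
  define \<kappa> where "\<kappa> = u t0 x0 - v t0 x0"
  have \<kappa>: "\<kappa> > 0" using \<open>\<not> u t0 x0 \<le> v t0 x0\<close> by (simp add: \<kappa>_def)
  \<comment> \<open>over the whole interval the drift \<open>c t\<close> consumes only half of the gap \<open>\<kappa>\<close>\<close>
  define c where "c = \<kappa> / (2 * T)"
  have c: "c > 0" using \<kappa> T by (simp add: c_def)
  have "t0 \<in> {0..<T}" using t0 by simp
  with hamiltonian L x0_path obtain m where m: "modulus_of_continuity m"
    and mF: "\<forall>\<epsilon>>0. \<forall>t\<in>{t0..T}. \<forall>x\<in>X. \<forall>y\<in>X.
      F t x ((1 / \<epsilon>) *\<^sub>R (x t - y t)) - F t y ((1 / \<epsilon>) *\<^sub>R (x t - y t))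
        \<le> m ((1 / \<epsilon>) * (norm (x t - y t))\<^sup>2 + (SUP s\<in>{0..t}. norm (x s - y s)))"
    unfolding admissible_hamiltonian_def by blast
  have mono: "mono_on {0..} m" and mlim: "(m \<longlongrightarrow> 0) (at_right 0)"
    using m by (auto simp: modulus_of_continuity_def)
  obtain b where b: "b > 0" "\<And>r. 0 < r \<Longrightarrow> r < b \<Longrightarrow> m r < c"
    using order_tendstoD(2)[OF mlim c] by (auto simp: eventually_at_right_field)
  \<comment> \<open>the argument \<open>10 * \<delta>\<close> of the modulus in the scheme lies below \<open>b\<close>\<close>
  define \<delta> where "\<delta> = b / 20"
  have \<delta>: "\<delta> > 0" "m (10 * \<delta>) < c" using b by (auto simp: \<delta>_def)
  define W where "W \<sigma> = {u t x - v t y + c * t |t x y. t0 \<le> t \<and> t \<le> T \<and> x \<in> X \<inter> \<Omega> \<and> y \<in> X \<inter> \<Omega> \<and>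
      (\<forall>s\<in>{0..t}. norm (x s - y s) \<le> \<sigma>)}" for \<sigma>
  have WI: "u t x - v t y + c * t \<in> W \<sigma>" if "t0 \<le> t" "t \<le> T" "x \<in> X \<inter> \<Omega>" "y \<in> X \<inter> \<Omega>"
    "\<And>s. s \<in> {0..t} \<Longrightarrow> norm (x s - y s) \<le> \<sigma>" for t x y \<sigma>
    using that unfolding W_def by blast
  obtain B where B: "\<And>t x y. t0 \<le> t \<Longrightarrow> t \<le> T \<Longrightarrow> x \<in> X \<inter> \<Omega> \<Longrightarrow> y \<in> X \<inter> \<Omega> \<Longrightarrow> u t x - v t y \<le> B"
    using difference_bounded by blast
  have Wup: "r \<le> B + c * T" if "r \<in> W \<sigma>" for r \<sigma>
    using that B c by (auto simp: W_def intro!: add_mono)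
  have Wbdd: "bdd_above (W \<sigma>)" for \<sigma> by (rule bdd_aboveI) (rule Wup)
  obtain xi yi where init: "xi \<in> X \<inter> \<Omega>" "yi \<in> X \<inter> \<Omega>" "\<And>s. s \<in> {0..t0} \<Longrightarrow> xi s = yi s"
    "u t0 x0 \<le> u t0 xi" "v t0 yi \<le> v t0 x0"
    by (rule initial_pair) (rule that; blast)
  have Winit: "u t0 xi - v t0 yi + c * t0 \<in> W \<sigma>" if "\<sigma> > 0" for \<sigma>
    by (rule WI) (use init t0 that in auto)
  have W\<kappa>: "\<kappa> + c * t0 \<le> Sup (W \<sigma>)" if "\<sigma> > 0" for \<sigma>
  proof -
    have "\<kappa> + c * t0 \<le> u t0 xi - v t0 yi + c * t0" using init(4,5) by (simp add: \<kappa>_def)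
    also have "\<dots> \<le> Sup (W \<sigma>)" by (rule cSup_upper[OF Winit[OF that] Wbdd])
    finally show ?thesis .
  qed
  define M where "M = (INF \<sigma>\<in>{0<..}. Sup (W \<sigma>))"
  have bddM: "bdd_below ((\<lambda>\<sigma>. Sup (W \<sigma>)) ` {0<..})" by (rule bdd_belowI2[of _ "\<kappa> + c * t0"]) (use W\<kappa> in auto)
  have M\<kappa>: "\<kappa> + c * t0 \<le> M" unfolding M_def by (rule cINF_greatest) (use W\<kappa> in auto)
  have Mle: "M \<le> Sup (W \<sigma>)" if "\<sigma> > 0" for \<sigma> unfolding M_def by (rule cINF_lower[OF bddM]) (use that in simp)
  \<comment> \<open>the final estimates are \<open>3 * a \<le> \<delta>\<close> for the penalty and \<open>3 * a < \<kappa> / 2\<close> at time \<open>T\<close>\<close>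
  define a where "a = min (\<delta> / 4) (\<kappa> / 12)"
  have a: "a > 0" "4 * a \<le> \<delta>" "12 * a \<le> \<kappa>" using \<delta> \<kappa> by (auto simp: a_def)
  obtain \<sigma>1 where \<sigma>1: "\<sigma>1 > 0" "Sup (W \<sigma>1) < M + a"
    using cINF_less_iff[OF _ bddM, of "M + a"] a unfolding M_def by auto
  obtain dh where dh: "dh > 0" "\<And>x y. x \<in> X \<Longrightarrow> y \<in> X \<Longrightarrow> (\<And>t. t \<in> {0..T} \<Longrightarrow> norm (x t - y t) \<le> dh) \<Longrightarrow> \<bar>h x - h y\<bar> < a"
    using terminal_uniformly_continuous[OF a(1)] by blast
  define \<Sigma> where "\<Sigma> = min \<sigma>1 (min dh (5 * \<delta>))"
  have \<Sigma>: "\<Sigma> > 0" "\<Sigma> \<le> \<sigma>1" "\<Sigma> \<le> dh" "\<Sigma> \<le> 5 * \<delta>" using \<sigma>1 dh \<delta> by (auto simp: \<Sigma>_def)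
  \<comment> \<open>with this \<open>\<epsilon>\<close>, penalties up to the size allowed in a step keep the paths within \<open>\<Sigma>\<close>\<close>
  define \<epsilon> where "\<epsilon> = \<Sigma>\<^sup>2 / (5 * \<delta>)"
  have \<epsilon>: "\<epsilon> > 0" "5 * \<delta> * \<epsilon> \<le> \<Sigma>\<^sup>2" using \<Sigma> \<delta> by (auto simp: \<epsilon>_def)
  \<comment> \<open>a starting pair within \<open>\<sigma>2\<close> has penalty at most \<open>a\<close>\<close>
  define \<sigma>2 where "\<sigma>2 = min \<Sigma> (sqrt (2 * \<epsilon> * a))"
  have \<sigma>2: "\<sigma>2 > 0" "\<sigma>2 \<le> \<Sigma>" "\<sigma>2\<^sup>2 \<le> 2 * \<epsilon> * a"
  proof -
    show "\<sigma>2 > 0" using \<Sigma> \<epsilon> a by (simp add: \<sigma>2_def)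
    have "\<sigma>2\<^sup>2 \<le> (sqrt (2 * \<epsilon> * a))\<^sup>2" using \<open>\<sigma>2 > 0\<close> by (intro power_mono) (auto simp: \<sigma>2_def)
    then show "\<sigma>2\<^sup>2 \<le> 2 * \<epsilon> * a" using \<epsilon> a by simp
  qed (simp add: \<sigma>2_def)
  have "M - a < Sup (W \<sigma>2)" using Mle[OF \<sigma>2(1)] a by simp
  then obtain r where r: "r \<in> W \<sigma>2" "M - a < r"
    using less_cSup_iff[OF _ Wbdd] Winit[OF \<sigma>2(1)] by blast
  then obtain t x y where txy: "t0 \<le> t" "t \<le> T" "x \<in> X \<inter> \<Omega>" "y \<in> X \<inter> \<Omega>"
    "\<And>s. s \<in> {0..t} \<Longrightarrow> norm (x s - y s) \<le> \<sigma>2" "M - a < u t x - v t y + c * t"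
    unfolding W_def by blast
  have near: "norm (x s - y s) \<le> \<Sigma>" if "s \<in> {0..t}" for s using txy(5)[OF that] \<sigma>2(2) by simp
  have mF': "F s x ((1 / \<epsilon>) *\<^sub>R (x s - y s)) - F s y ((1 / \<epsilon>) *\<^sub>R (x s - y s))
      \<le> m ((1 / \<epsilon>) * (norm (x s - y s))\<^sup>2 + (SUP r\<in>{0..s}. norm (x r - y r)))"
    if "s \<in> {t0..T}" "x \<in> X" "y \<in> X" for s x y using mF \<epsilon>(1) that by blast
  obtain \<tau> x' y' where e: "t \<le> \<tau>" "\<tau> \<le> T" "x' \<in> X \<inter> \<Omega>" "y' \<in> X \<inter> \<Omega>"
    "\<And>s. s \<in> {0..\<tau>} \<Longrightarrow> norm (x' s - y' s) \<le> \<Sigma>"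
    "u t x - v t y - (norm (x t - y t))\<^sup>2 / (2 * \<epsilon>) \<le>
      u \<tau> x' - v \<tau> y' - (norm (x' \<tau> - y' \<tau>))\<^sup>2 / (2 * \<epsilon>) + (\<tau> - t) * c"
    "\<tau> = T \<or> \<delta> < (norm (x' \<tau> - y' \<tau>))\<^sup>2 / (2 * \<epsilon>)"
  proof -
    show thesis
      by (rule Euler_scheme[where m=m and \<epsilon>=\<epsilon> and \<delta>=\<delta> and \<Sigma>=\<Sigma> and c=c and ?t1.0=t and x=x and y=y])
        (fact that | fact)+
  qed
  have P0: "(norm (x t - y t))\<^sup>2 / (2 * \<epsilon>) \<le> a"
  proof -
    have "(norm (x t - y t))\<^sup>2 \<le> \<sigma>2\<^sup>2" using txy(5)[of t] txy(1) t0 by (intro power_mono) auto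
    then have "(norm (x t - y t))\<^sup>2 \<le> 2 * \<epsilon> * a" using \<sigma>2(3) by simp
    then show ?thesis using \<epsilon>(1) by (simp add: divide_le_eq mult_ac)
  qed
  have "u \<tau> x' - v \<tau> y' + c * \<tau> \<in> W \<sigma>1"
    using e(1-4) txy(1) order_trans[OF e(5) \<Sigma>(2)] by (intro WI) auto
  then have "u \<tau> x' - v \<tau> y' + c * \<tau> \<le> Sup (W \<sigma>1)" by (rule cSup_upper[OF _ Wbdd])
  then have up: "u \<tau> x' - v \<tau> y' + c * \<tau> < M + a" using \<sigma>1(2) by simp
  have gain: "u t x - v t y + c * t - a + (norm (x' \<tau> - y' \<tau>))\<^sup>2 / (2 * \<epsilon>) \<le> u \<tau> x' - v \<tau> y' + c * \<tau>"
    using e(6) P0 by (simp add: algebra_simps)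
  have "(norm (x' \<tau> - y' \<tau>))\<^sup>2 / (2 * \<epsilon>) \<le> \<delta>" using gain up txy(6) a by linarith
  then have \<tau>T: "\<tau> = T" using e(7) by simp
  have "0 \<le> (norm (x' \<tau> - y' \<tau>))\<^sup>2 / (2 * \<epsilon>)" using \<epsilon>(1) by simp
  moreover have "u T x' \<le> h x'" "h y' \<le> v T y'"
    using sub super e(3,4) by (auto simp: minimax_subsolution_def minimax_supersolution_def)
  moreover have "\<bar>h x' - h y'\<bar> < a"
    by (rule dh(2)) (use e(3,4) order_trans[OF e(5) \<Sigma>(3)] \<tau>T in auto)
  ultimately have "M < 3 * a + c * T" using gain txy(6) \<tau>T by simp
  moreover have "c * T = \<kappa> / 2" using T by (simp add: c_def)
  moreover have "0 \<le> c * t0" using c t0 by simp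
  ultimately show False using M\<kappa> a(3) \<kappa> by linarith
qed

end

theorem theorem4p4:
  fixes j :: "'v::banach \<Rightarrow>\<^sub>L 'h::{real_inner, complete_space}"
    and A :: "real \<Rightarrow> 'v \<Rightarrow> ('v \<Rightarrow>\<^sub>L real)"
    and T p q L :: real
    and F :: "real \<Rightarrow> (real \<Rightarrow> 'h) \<Rightarrow> 'h \<Rightarrow> real"
    and h :: "(real \<Rightarrow> 'h) \<Rightarrow> real"
    and xstar :: 'h
    and \<Omega> :: "(real \<Rightarrow> 'h) set"
    and u v :: "real \<Rightarrow> (real \<Rightarrow> 'h) \<Rightarrow> real"
  assumes "T > 0"
    and "p \<ge> 2" and "q > 1" and "1 / p + 1 / q = 1"
    and "evolution_triple j"
    and "admissible_operator T p q A"
    and "terminal_continuous T h"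
    and "admissible_hamiltonian j A T p q F"
    and "L \<ge> 0"
    and "trajectories j A T p q L 0 (const_path T xstar) \<subseteq> \<Omega>" and "\<Omega> \<subseteq> paths T"
    and "minimax_subsolution j A T p q F h L \<Omega> u"
    and "minimax_supersolution j A T p q F h L \<Omega> v"
  shows "\<forall>t\<in>{0..T}. \<forall>x\<in>\<Omega>. u t x \<le> v t x"
proof (intro ballI)
  fix t x assume t: "t \<in> {0..T}" and x: "x \<in> \<Omega>"
  show "u t x \<le> v t x"
  proof (cases "t = T")
    case True
    have "u T x \<le> h x" "h x \<le> v T x"
      using assms(12,13) x by (auto simp: minimax_subsolution_def minimax_supersolution_def)
    then show ?thesis using True by simp
  next
    case False
    have "compact (closure (j ` cball 0 1))"
      using assms(5) by (simp add: evolution_triple_def)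
    then interpret minimax_pair j A T p q F h L \<Omega> u v t x
      by unfold_locales (use assms t x False in auto)
    show ?thesis by (rule comparison_at)
  qed
qed

end
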